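(* Let $\nu>0$, $\beta\in(0,1)$, $\alpha\in(0,2)$ and $d<(2\wedge\beta^{-1})\alpha$. Let $\sigma:\mathbb{R}\to\mathbb{R}$ be a locally Lipschitz function for which there is $\gamma>0$ with $\sigma(x)\ge |x|^{1+\gamma}$ for all $x\in\mathbb{R}$. Let $u_0:\mathbb{R}^d\to[0,\infty)$ be bounded and deterministic with $\kappa:=\inf_{x\in\mathbb{R}^d}u_0(x)>0$, and let $u_t(x)$ be the solution of $$\partial_t^\beta u_t(x)=-\nu(-\Delta)^{\alpha/2}u_t(x)+I^{1-\beta}[\sigma(u)\dot W(t,x)],\qquad t>0,\ x\in\mathbb{R}^d,$$ with initial condition $u_0$, where $\dot W$ is space-time white noise. Then there exists $t_0>0$ such that for all $x\in\mathbb{R}^d$, $$\mathbb{E}|u_t(x)|^2=\infty\quad\text{whenever } t\ge t_0.$$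
   Context: $\partial_t^\beta$ is the Caputo derivative, $\partial_t^\beta u_t(x)=\frac{1}{\Gamma(1-\beta)}\int_0^t\frac{\partial u_r(x)}{\partial r}\frac{dr}{(t-r)^\beta}$, and $I^{\gamma'}h(t)=\frac{1}{\Gamma(\gamma')}\int_0^t(t-\tau)^{\gamma'-1}h(\tau)\,d\tau$ for $\gamma'>0$. The operator $-\nu(-\Delta)^{\alpha/2}$ is the generator of the isotropic $\alpha$-stable Lévy process $X$ with transition density $p(t,x)$ determined by $\int_{\mathbb{R}^d}e^{i\xi\cdot x}p(t,x)\,dx=e^{-t\nu|\xi|^\alpha}$. Let $D$ be a $\beta$-stable subordinator independent of $X$ ($\mathbb{E}e^{-\lambda D_r}=e^{-r\lambda^\beta}$), $E_t=\inf\{r: D_r>t\}$ its first passage time with density $f_{E_t}$, and let $G_t(x)=\int_0^\infty p(s,x)f_{E_t}(s)\,ds$ be the density of $X_{E_t}$. Space-time white noise $\dot W$ is the centered Gaussian noise with $\mathbb{E}[\dot W(s,x)\dot W(t,y)]=\delta_0(t-s)\delta_0(x-y)$. The solution is understood as the mild solution in the sense of Walsh: $u$ is adapted to the filtration generated by the noise and satisfies $$u_t(x)=\int_{\mathbb{R}^d}G_t(x-y)u_0(y)\,dy+\int_{\mathbb{R}^d}\int_0^tG_{t-s}(x-y)\sigma(u_s(y))\,W(ds\,dy).$$ *)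

theory Defs
  imports "HOL-Probability.Probability"
begin

section \<open>The kernel \<open>G\<close>\<close>

text \<open>The isotropic stable density is the function that is jointly continuous on
  \<open>(0,\<infinity>) \<times> \<real>\<^sup>d\<close> and has the given Fourier transform; without continuity the Fourier transform
  would fix \<open>p t\<close> only up to a null set for each \<open>t\<close>.\<close>

definition stable_transition_density ::
    "real \<Rightarrow> real \<Rightarrow> (real \<Rightarrow> 'a::euclidean_space \<Rightarrow> real) \<Rightarrow> bool" where
  "stable_transition_density \<nu> \<alpha> p \<longleftrightarrow>
     continuous_on ({0<..} \<times> UNIV) (\<lambda>(t, x). p t x) \<and>
     (\<forall>t>0. (\<forall>x. 0 \<le> p t x) \<and> integrable lborel (p t) \<and>
        (\<forall>\<xi>. (LINT x|lborel. exp (\<i> * complex_of_real (\<xi> \<bullet> x)) * complex_of_real (p t x))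
             = complex_of_real (exp (- (t * \<nu> * norm \<xi> powr \<alpha>)))))"

text \<open>Time is \<open>r \<ge> 0\<close>; values of \<open>D\<close> at negative times are irrelevant.\<close>

definition stable_subordinator :: "'b measure \<Rightarrow> real \<Rightarrow> (real \<Rightarrow> 'b \<Rightarrow> real) \<Rightarrow> bool" where
  "stable_subordinator N \<beta> D \<longleftrightarrow>
     prob_space N \<and>
     (\<forall>r\<ge>0. D r \<in> borel_measurable N) \<and>
     (AE \<omega> in N. D 0 \<omega> = 0 \<and> mono_on {0..} (\<lambda>r. D r \<omega>) \<and>
        (\<forall>r\<ge>0. continuous (at_right r) (\<lambda>r. D r \<omega>))) \<and>
     (\<forall>(n::nat) (r :: nat \<Rightarrow> real). 0 \<le> r 0 \<and> mono r \<longrightarrow>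
        prob_space.indep_vars N (\<lambda>_. borel) (\<lambda>i \<omega>. D (r (Suc i)) \<omega> - D (r i) \<omega>) {..<n}) \<and>
     (\<forall>r\<ge>0. \<forall>h\<ge>0. distr N borel (\<lambda>\<omega>. D (r + h) \<omega> - D r \<omega>) = distr N borel (D h)) \<and>
     (\<forall>r\<ge>0. \<forall>l\<ge>0. (LINT \<omega>|N. exp (- l * D r \<omega>)) = exp (- r * l powr \<beta>))"

definition first_passage_time :: "(real \<Rightarrow> 'b \<Rightarrow> real) \<Rightarrow> real \<Rightarrow> 'b \<Rightarrow> real" where
  "first_passage_time D t \<omega> = Inf {r. 0 \<le> r \<and> t < D r \<omega>}"

definition first_passage_density ::
    "'b measure \<Rightarrow> (real \<Rightarrow> 'b \<Rightarrow> real) \<Rightarrow> (real \<Rightarrow> real \<Rightarrow> real) \<Rightarrow> bool" where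
  "first_passage_density N D f \<longleftrightarrow>
     (\<forall>t>0. (\<forall>s. 0 \<le> f t s) \<and> distributed N lborel (first_passage_time D t) (\<lambda>s. ennreal (f t s)))"

definition time_changed_density ::
    "(real \<Rightarrow> 'a::euclidean_space \<Rightarrow> real) \<Rightarrow> (real \<Rightarrow> real \<Rightarrow> real) \<Rightarrow> real \<Rightarrow> 'a \<Rightarrow> real" where
  "time_changed_density p f t x = (LINT s:{0<..}|lborel. p s x * f t s)"


section \<open>Space-time white noise\<close>

text \<open>Point masses are degenerate Gaussians.\<close>

definition gaussian_rv :: "'o measure \<Rightarrow> ('o \<Rightarrow> real) \<Rightarrow> bool" where
  "gaussian_rv M X \<longleftrightarrow> X \<in> borel_measurable M \<and>
     ((\<exists>m s. s > 0 \<and> distributed M lborel X (\<lambda>z. ennreal (normal_density m s z))) \<or>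
      (\<exists>m. AE \<omega> in M. X \<omega> = m))"

definition noise_sets :: "(real \<times> 'a::euclidean_space) set set" where
  "noise_sets = {A \<in> sets borel. A \<subseteq> {0..} \<times> UNIV \<and> emeasure lborel A < \<infinity>}"

text \<open>\<open>W A\<close> is the integral of the noise over \<open>A\<close>, so the covariance
  \<open>\<delta>\<^sub>0 (t - s) \<delta>\<^sub>0 (x - y)\<close> becomes \<open>E (W A * W B) = |A \<inter> B|\<close>.\<close>

definition white_noise ::
    "'o measure \<Rightarrow> ((real \<times> 'a::euclidean_space) set \<Rightarrow> 'o \<Rightarrow> real) \<Rightarrow> bool" where
  "white_noise M W \<longleftrightarrow>
     (\<forall>\<A> c. finite \<A> \<and> \<A> \<subseteq> noise_sets \<longrightarrow> gaussian_rv M (\<lambda>\<omega>. \<Sum>A\<in>\<A>. c A * W A \<omega>)) \<and>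
     (\<forall>A\<in>noise_sets. (LINT \<omega>|M. W A \<omega>) = 0) \<and>
     (\<forall>A\<in>noise_sets. \<forall>B\<in>noise_sets. (LINT \<omega>|M. W A \<omega> * W B \<omega>) = measure lborel (A \<inter> B))"

text \<open>The filtration generated by the noise, augmented by the null sets.\<close>

definition noise_filtration ::
    "'o measure \<Rightarrow> ((real \<times> 'a::euclidean_space) set \<Rightarrow> 'o \<Rightarrow> real) \<Rightarrow> real \<Rightarrow> 'o measure" where
  "noise_filtration M W t = sigma (space M)
     ({W A -` B \<inter> space M | A B. A \<in> noise_sets \<and> A \<subseteq> {0..t} \<times> UNIV \<and> B \<in> sets borel}
      \<union> null_sets M)"


section \<open>The Walsh integral\<close>

text \<open>A list of quadruples \<open>(a, b, A, X)\<close> stands for the elementary process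
  \<open>\<Sum> X(\<omega>) 1\<^bsub>(a,b]\<^esub>(s) 1\<^bsub>A\<^esub>(y)\<close>, with \<open>X\<close> bounded and measurable at time \<open>a\<close>.\<close>

type_synonym ('a, 'o) elementary = "(real \<times> real \<times> 'a set \<times> ('o \<Rightarrow> real)) list"

definition elementary ::
    "'o measure \<Rightarrow> ((real \<times> 'a::euclidean_space) set \<Rightarrow> 'o \<Rightarrow> real) \<Rightarrow> ('a, 'o) elementary \<Rightarrow> bool" where
  "elementary M W es \<longleftrightarrow>
     (\<forall>(a, b, A, X) \<in> set es. 0 \<le> a \<and> a \<le> b \<and> A \<in> sets borel \<and> emeasure lborel A < \<infinity> \<and>
        X \<in> borel_measurable (noise_filtration M W a) \<and> (\<exists>C. \<forall>\<omega>\<in>space M. \<bar>X \<omega>\<bar> \<le> C))"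

definition elementary_process ::
    "('a::euclidean_space, 'o) elementary \<Rightarrow> real \<times> 'a \<Rightarrow> 'o \<Rightarrow> real" where
  "elementary_process es z \<omega> = (\<Sum>(a, b, A, X)\<leftarrow>es. X \<omega> * indicator ({a<..b} \<times> A) z)"

definition elementary_integral ::
    "((real \<times> 'a::euclidean_space) set \<Rightarrow> 'o \<Rightarrow> real) \<Rightarrow> ('a, 'o) elementary \<Rightarrow> 'o \<Rightarrow> real" where
  "elementary_integral W es \<omega> = (\<Sum>(a, b, A, X)\<leftarrow>es. X \<omega> * W ({a<..b} \<times> A) \<omega>)"

text \<open>\<open>walsh_integral M W \<Phi> Z\<close>: the random variable \<open>Z\<close> is the Walsh integral
  \<open>\<integral>\<integral> \<Phi>(s,y) W(ds dy)\<close>, i.e. a limit in probability of integrals of elementary processes that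
  converge to \<open>\<Phi>\<close> in \<open>L\<^sup>2(ds dy)\<close> in probability, and the Walsh isometry
  \<open>E |Z|\<^sup>2 = E \<integral>\<integral> |\<Phi>|\<^sup>2 ds dy\<close> holds in \<open>[0,\<infinity>]\<close>.

  If \<open>E \<integral>\<integral> |\<Phi>|\<^sup>2 < \<infinity>\<close>, this is Walsh's \<open>L\<^sup>2\<close> integral: the class of such \<open>\<Phi>\<close> is the closure
  of the elementary (equivalently, the predictable) processes, and the isometry is automatic.
  Integrands with \<open>E \<integral>\<integral> |\<Phi>|\<^sup>2 = \<infinity>\<close> are not excluded, so that a solution may have infinite
  second moments, but the isometry is then a condition: a localised integral can have a finite
  second moment in this case (e.g. when it is the terminal value of a strict local martingale).

  Integrands live on \<open>\<real> \<times> \<real>\<^sup>d\<close> and have to vanish at negative times.\<close>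

definition walsh_integral ::
    "'o measure \<Rightarrow> ((real \<times> 'a::euclidean_space) set \<Rightarrow> 'o \<Rightarrow> real) \<Rightarrow>
     (real \<times> 'a \<Rightarrow> 'o \<Rightarrow> real) \<Rightarrow> ('o \<Rightarrow> real) \<Rightarrow> bool" where
  "walsh_integral M W \<Phi> Z \<longleftrightarrow>
     (\<lambda>(z, \<omega>). \<Phi> z \<omega>) \<in> borel_measurable (lborel \<Otimes>\<^sub>M M) \<and>
     Z \<in> borel_measurable M \<and>
     (\<exists>es :: nat \<Rightarrow> ('a, 'o) elementary.
        (\<forall>n. elementary M W (es n)) \<and>
        (\<forall>\<epsilon>>0. (\<lambda>n. measure M {\<omega> \<in> space M.
            (\<integral>\<^sup>+z. ennreal ((elementary_process (es n) z \<omega> - \<Phi> z \<omega>)\<^sup>2) \<partial>lborel) > ennreal \<epsilon>})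
          \<longlonglongrightarrow> 0) \<and>
        (\<forall>\<epsilon>>0. (\<lambda>n. measure M {\<omega> \<in> space M. \<bar>elementary_integral W (es n) \<omega> - Z \<omega>\<bar> > \<epsilon>})
          \<longlonglongrightarrow> 0)) \<and>
     (\<integral>\<^sup>+\<omega>. ennreal ((Z \<omega>)\<^sup>2) \<partial>M) = (\<integral>\<^sup>+\<omega>. (\<integral>\<^sup>+z. ennreal ((\<Phi> z \<omega>)\<^sup>2) \<partial>lborel) \<partial>M)"


section \<open>Mild solutions\<close>

text \<open>Only \<open>u t x\<close> with \<open>t \<ge> 0\<close> matters.\<close>

definition mild_solution ::
    "'o measure \<Rightarrow> ((real \<times> 'a::euclidean_space) set \<Rightarrow> 'o \<Rightarrow> real) \<Rightarrow> (real \<Rightarrow> 'a \<Rightarrow> real) \<Rightarrow>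
     (real \<Rightarrow> real) \<Rightarrow> ('a \<Rightarrow> real) \<Rightarrow> (real \<Rightarrow> 'a \<Rightarrow> 'o \<Rightarrow> real) \<Rightarrow> bool" where
  "mild_solution M W G \<sigma> u0 u \<longleftrightarrow>
     (\<forall>t\<ge>0. \<forall>x. u t x \<in> borel_measurable (noise_filtration M W t)) \<and>
     (\<forall>x. AE \<omega> in M. u 0 x \<omega> = u0 x) \<and>
     (\<forall>t>0. \<forall>x. \<exists>Z.
        walsh_integral M W
          (\<lambda>(s, y) \<omega>. indicator {0<..<t} s * (G (t - s) (x - y) * \<sigma> (u s y \<omega>))) Z \<and>
        (AE \<omega> in M. u t x \<omega> = (LINT y|lborel. G t (x - y) * u0 y) + Z \<omega>))"

definition locally_lipschitz :: "(real \<Rightarrow> real) \<Rightarrow> bool" where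
  "locally_lipschitz \<sigma> \<longleftrightarrow> (\<forall>x. \<exists>r>0. \<exists>L. L-lipschitz_on (ball x r) \<sigma>)"

end

theory Submission
  imports Defs
begin

text \<open>Taking second moments in the mild formulation gives
  \<open>E |u\<^sub>t(x)|\<^sup>2 = (G\<^sub>t u\<^sub>0)(x)\<^sup>2 + \<integral>\<integral> G\<^bsub>t-s\<^esub>(x-y)\<^sup>2 E \<sigma>(u\<^sub>s(y))\<^sup>2 dy ds\<close>, where \<open>G\<^sub>t u\<^sub>0 \<ge> \<kappa>\<close> and, by convexity,
  \<open>E \<sigma>(u)\<^sup>2 \<ge> (E u\<^sup>2)\<^bsup>1+\<gamma>\<^esup>\<close>. Since \<open>X\<close> at time \<open>E\<^sub>r\<close> stays with probability at least \<open>1/4\<close> in a box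
  of side \<open>\<sim> r\<^bsup>\<beta>/\<alpha>\<^esup>\<close>, Cauchy-Schwarz yields \<open>\<integral> G\<^sub>r\<^sup>2 \<ge> c r\<^bsup>-\<eta>\<^esup>\<close> with \<open>\<eta> = \<beta>d/\<alpha> < 1\<close>. Hence on \<open>[0,T]\<close> the
  second moment dominates the solution of \<open>F(t) = \<kappa>\<^sup>2 + c T\<^bsup>-\<eta>\<^esup> \<integral>\<^sub>0\<^sup>t F\<^bsup>1+\<gamma>\<^esup>\<close>, which explodes before \<open>T\<close> for
  large \<open>T\<close>, because \<open>T\<^bsup>1-\<eta>\<^esup> \<rightarrow> \<infinity>\<close>.

  The probabilistic point is that a Walsh integral \<open>Z\<close> with \<open>E Z\<^sup>2 < \<infinity>\<close> has mean zero although its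
  approximations converge only in probability: the elementary integrals are stopped when their
  quadratic variation reaches a level \<open>K\<close>, which makes them centered with second moment at most \<open>K\<close>.
  That stopping preserves the mean rests on the independence of future increments of the noise from
  the past, which follows from the uniqueness of characteristic functions.\<close>

section \<open>Independence from characteristic functions\<close>

text \<open>The isometry is part of what it means to be a Walsh integral \<open>Z\<close>, so what
  has to be earned is that the cross term 2 c E Z with the deterministic part c vanishes. This
  matters only for finite E Z^2, since otherwise the second moment of c + Z is infinite anyway.
  Convergence in probability alone says nothing about means; it does so together with a uniform
  second moment bound, which stopping at level K provides. The price is an error on the event that
  the energy of \<Phi> exceeds K / 4, and K times the probability of this event tends to 0 because
  the energy is integrable.

  The second moment may be infinite anywhere, and no regularity in time is available. The comparison
  with an explosive equation therefore takes the form of an iteration of constant lower bounds in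
  [0,infinity], on intervals shrinking to T. The iteration is run afresh for every T \<ge> t0, with
  a constant depending on T; this gives infinity at all later times and not only at one explosion
  time. The condition d < \<alpha> / \<beta> enters as \<eta> < 1, which makes T * T^(-\<eta>)
  large.\<close>

lemma (in prob_space) integrable_square_imp_integrable:
  fixes X :: "'a \<Rightarrow> real"
  assumes [measurable]: "X \<in> borel_measurable M" and X2: "integrable M (\<lambda>\<omega>. (X \<omega>)\<^sup>2)"
  shows "integrable M X"
proof (rule Bochner_Integration.integrable_bound[where f="\<lambda>\<omega>. 1 + (X \<omega>)\<^sup>2"])
  show "AE \<omega> in M. norm (X \<omega>) \<le> norm (1 + (X \<omega>)\<^sup>2)"
  proof (intro AE_I2)
    fix \<omega>
    have "0 \<le> (\<bar>X \<omega>\<bar> - 1)\<^sup>2" by simp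
    then show "norm (X \<omega>) \<le> norm (1 + (X \<omega>)\<^sup>2)"
      by (simp add: power2_eq_square algebra_simps abs_if split: if_splits)
  qed
qed (use X2 in auto)

lemma (in prob_space) integrable_mult_of_squares:
  fixes X Y :: "'a \<Rightarrow> real"
  assumes [measurable]: "X \<in> borel_measurable M" "Y \<in> borel_measurable M"
    and X2: "integrable M (\<lambda>\<omega>. (X \<omega>)\<^sup>2)" and Y2: "integrable M (\<lambda>\<omega>. (Y \<omega>)\<^sup>2)"
  shows "integrable M (\<lambda>\<omega>. X \<omega> * Y \<omega>)"
proof (rule Bochner_Integration.integrable_bound[where f="\<lambda>\<omega>. (X \<omega>)\<^sup>2 + (Y \<omega>)\<^sup>2"])
  show "AE \<omega> in M. norm (X \<omega> * Y \<omega>) \<le> norm ((X \<omega>)\<^sup>2 + (Y \<omega>)\<^sup>2)"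
  proof (intro AE_I2)
    fix \<omega>
    have "0 \<le> (\<bar>X \<omega>\<bar> - \<bar>Y \<omega>\<bar>)\<^sup>2" by simp
    then have "2 * (\<bar>X \<omega>\<bar> * \<bar>Y \<omega>\<bar>) \<le> (X \<omega>)\<^sup>2 + (Y \<omega>)\<^sup>2"
      by (simp add: power2_diff)
    moreover have "0 \<le> \<bar>X \<omega>\<bar> * \<bar>Y \<omega>\<bar>" by simp
    moreover have "norm (X \<omega> * Y \<omega>) = \<bar>X \<omega>\<bar> * \<bar>Y \<omega>\<bar>" by (simp add: abs_mult)
    ultimately show "norm (X \<omega> * Y \<omega>) \<le> norm ((X \<omega>)\<^sup>2 + (Y \<omega>)\<^sup>2)"
      by (simp only: real_norm_def) linarith
  qed
qed (use X2 Y2 in auto)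

text \<open>Point masses and normal laws share one formula: mean zero forces the point mass to sit
  at 0, where variance and exponent vanish, and otherwise division by the standard deviation reduces
  everything to the standard normal law.\<close>

lemma (in prob_space) gaussian_rv_centered:
  assumes g: "gaussian_rv M X" and m0: "expectation X = 0"
  shows "integrable M (\<lambda>\<omega>. (X \<omega>)\<^sup>2)"
    and "(LINT \<omega>|M. iexp (X \<omega>)) = exp (- (expectation (\<lambda>\<omega>. (X \<omega>)\<^sup>2) / 2))"
proof -
  have [measurable]: "X \<in> borel_measurable M" using g by (simp add: gaussian_rv_def)
  have "integrable M (\<lambda>\<omega>. (X \<omega>)\<^sup>2) \<and>
    (LINT \<omega>|M. iexp (X \<omega>)) = exp (- (expectation (\<lambda>\<omega>. (X \<omega>)\<^sup>2) / 2))"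
  proof (cases "\<exists>m. AE \<omega> in M. X \<omega> = m")
    case True
    then obtain m where m: "AE \<omega> in M. X \<omega> = m" by blast
    have "expectation X = expectation (\<lambda>_. m)" by (rule integral_cong_AE) (use m in auto)
    then have "m = 0" using m0 by (simp add: prob_space)
    then have X0: "AE \<omega> in M. X \<omega> = 0" using m by simp
    have "integrable M (\<lambda>\<omega>. (X \<omega>)\<^sup>2) \<longleftrightarrow> integrable M (\<lambda>\<omega>. 0::real)"
      by (rule integrable_cong_AE) (use X0 in auto)
    moreover have "expectation (\<lambda>\<omega>. (X \<omega>)\<^sup>2) = expectation (\<lambda>\<omega>. 0)"
      by (rule integral_cong_AE) (use X0 in auto)
    moreover have "(LINT \<omega>|M. iexp (X \<omega>)) = (LINT \<omega>|M. 1)"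
      by (rule integral_cong_AE) (use X0 in auto)
    ultimately show ?thesis by (simp add: prob_space)
  next
    case False
    then obtain m s where s: "s > 0" and d: "distributed M lborel X (\<lambda>z. ennreal (normal_density m s z))"
      using g by (auto simp: gaussian_rv_def)
    have "m = 0" using normal_distributed_expectation[OF s d] m0 by simp
    let ?N = "\<lambda>\<omega>. X \<omega> / s"
    have dN: "distributed M lborel ?N (\<lambda>z. ennreal (std_normal_density z))"
      using normal_standard_normal_convert[OF s, of X m] d \<open>m = 0\<close> by simp
    have distr: "distr M borel ?N = std_normal_distribution"
      using distributed_distr_eq_density[OF dN] by (simp cong: distr_cong)
    have i2: "integrable M (\<lambda>\<omega>. (?N \<omega>)\<^sup>2)"
    proof -
      have "integrable (distr M borel ?N) (\<lambda>x. x\<^sup>2)"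
        unfolding distr by (rule integrable_std_normal_distribution_moment)
      then show ?thesis by (subst (asm) integrable_distr_eq) auto
    qed
    then have int: "integrable M (\<lambda>\<omega>. (X \<omega>)\<^sup>2)"
      using s integrable_mult_right[of "s\<^sup>2", OF i2] by (simp add: power_divide)
    have "variance X = s\<^sup>2" by (rule normal_distributed_variance[OF s d])
    then have v: "expectation (\<lambda>\<omega>. (X \<omega>)\<^sup>2) = s\<^sup>2" using m0 by simp
    have "(LINT \<omega>|M. iexp (X \<omega>)) = (LINT \<omega>|M. iexp (s * ?N \<omega>))"
      using s by simp
    also have "\<dots> = char (distr M borel ?N) s"
      unfolding char_def by (subst integral_distr) auto
    also have "\<dots> = exp (- (s\<^sup>2) / 2)"
      unfolding distr char_std_normal_distribution by (simp add: exp_of_real)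
    finally show ?thesis using int v by (simp add: exp_of_real)
  qed
  then show "integrable M (\<lambda>\<omega>. (X \<omega>)\<^sup>2)"
    and "(LINT \<omega>|M. iexp (X \<omega>)) = exp (- (expectation (\<lambda>\<omega>. (X \<omega>)\<^sup>2) / 2))" by auto
qed

text \<open>The real case splits \<open>Y\<close> into positive and negative part, which reduces it to the
  uniqueness theorem for characteristic functions, applied to the laws of \<open>V\<close> under the two densities.\<close>

lemma (in prob_space) fourier_zero_imp_indicator_zero_real:
  fixes Y V :: "'a \<Rightarrow> real"
  assumes Y: "integrable M Y" and V[measurable]: "V \<in> borel_measurable M"
    and zero: "\<And>t. (LINT \<omega>|M. complex_of_real (Y \<omega>) * iexp (t * V \<omega>)) = 0"
    and B[measurable]: "B \<in> sets borel"
  shows "(LINT \<omega>|M. Y \<omega> * indicator B (V \<omega>)) = 0"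
proof -
  have [measurable]: "Y \<in> borel_measurable M" using Y by auto
  define P where "P = (\<lambda>\<omega>. max 0 (Y \<omega>))"
  define Q where "Q = (\<lambda>\<omega>. max 0 (- Y \<omega>))"
  have Pm[measurable]: "P \<in> borel_measurable M" and Qm[measurable]: "Q \<in> borel_measurable M"
    by (auto simp: P_def Q_def)
  have P0: "0 \<le> P \<omega>" and Q0: "0 \<le> Q \<omega>" and YPQ: "Y \<omega> = P \<omega> - Q \<omega>" for \<omega>
    by (auto simp: P_def Q_def)
  have Pi: "integrable M P" and Qi: "integrable M Q"
    by (auto simp: P_def Q_def intro!: Bochner_Integration.integrable_bound[OF Y])
  define m where "m = expectation P"
  \<comment> \<open>Frequency 0 shows that the positive and the negative part have the same mass
    \<open>m\<close>, so that both can be normalised by the same constant.\<close>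
  have "complex_of_real (expectation Y) = 0"
    using zero[of 0] by simp
  then have EQ: "expectation Q = m" using Pi Qi by (simp add: YPQ[abs_def] m_def)
  show ?thesis
  proof (cases "m = 0")
    case True
    then have "expectation P = 0" "expectation Q = 0" using EQ by (simp_all add: m_def)
    then have "AE \<omega> in M. P \<omega> = 0" "AE \<omega> in M. Q \<omega> = 0"
      using P0 Q0 Pi Qi by (simp_all add: integral_nonneg_eq_0_iff_AE)
    then have "AE \<omega> in M. Y \<omega> * indicator B (V \<omega>) = 0" by eventually_elim (simp add: YPQ)
    then have "(LINT \<omega>|M. Y \<omega> * indicator B (V \<omega>)) = (LINT \<omega>|M. 0)"
      by (intro integral_cong_AE) auto
    then show ?thesis by simp
  next
    case False
    then have m: "m > 0" using P0 by (simp add: m_def less_le integral_nonneg)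
    define \<mu> where "\<mu> = (\<lambda>R. distr (density M (\<lambda>\<omega>. ennreal (R \<omega> / m))) borel V)"
    have rd: "real_distribution (\<mu> R)"
      and ch: "char (\<mu> R) t = (LINT \<omega>|M. complex_of_real (R \<omega>) * iexp (t * V \<omega>)) / m"
      and me: "m * measure (\<mu> R) B = (LINT \<omega>|M. R \<omega> * indicator B (V \<omega>))"
      if [measurable]: "R \<in> borel_measurable M" and R0: "\<And>\<omega>. 0 \<le> R \<omega>" and Ri: "integrable M R"
        and ER: "expectation R = m" for R t
    proof -
      have "(\<integral>\<^sup>+\<omega>. ennreal (R \<omega> / m) \<partial>M) = ennreal (expectation (\<lambda>\<omega>. R \<omega> / m))"
        using R0 m Ri by (intro nn_integral_eq_integral) auto
      also have "\<dots> = 1" using ER m by simp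
      finally have "prob_space (density M (\<lambda>\<omega>. ennreal (R \<omega> / m)))"
        by (intro prob_spaceI) (simp add: emeasure_density cong: nn_integral_cong)
      then interpret D: prob_space "density M (\<lambda>\<omega>. ennreal (R \<omega> / m))" .
      show rd: "real_distribution (\<mu> R)" unfolding \<mu>_def
        by (intro real_distribution.intro D.prob_space_distr real_distribution_axioms.intro) auto
      have "char (\<mu> R) t = (LINT \<omega>|density M (\<lambda>\<omega>. ennreal (R \<omega> / m)). iexp (t * V \<omega>))"
        unfolding char_def \<mu>_def by (subst integral_distr) auto
      also have "\<dots> = (LINT \<omega>|M. (R \<omega> / m) *\<^sub>R iexp (t * V \<omega>))"
        using R0 m by (subst integral_density) auto
      also have "\<dots> = (LINT \<omega>|M. complex_of_real (R \<omega>) * iexp (t * V \<omega>) / m)"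
        by (simp add: scaleR_conv_of_real)
      finally show "char (\<mu> R) t = (LINT \<omega>|M. complex_of_real (R \<omega>) * iexp (t * V \<omega>)) / m"
        by simp
      interpret R: real_distribution "\<mu> R" by (rule rd)
      have "measure (\<mu> R) B = (LINT x|\<mu> R. indicator B x)" by simp
      also have "\<dots> = (LINT \<omega>|density M (\<lambda>\<omega>. ennreal (R \<omega> / m)). indicator B (V \<omega>))"
        unfolding \<mu>_def by (subst integral_distr) auto
      also have "\<dots> = (LINT \<omega>|M. (R \<omega> / m) *\<^sub>R indicator B (V \<omega>))"
        using R0 m by (subst integral_density) auto
      also have "\<dots> = (LINT \<omega>|M. R \<omega> * indicator B (V \<omega>)) / m" by simp
      finally show "m * measure (\<mu> R) B = (LINT \<omega>|M. R \<omega> * indicator B (V \<omega>))"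
        using m by simp
    qed
    have "char (\<mu> P) = char (\<mu> Q)"
    proof
      fix t
      have ii: "integrable M (\<lambda>\<omega>. complex_of_real (R \<omega>) * iexp (t * V \<omega>))"
        if R: "integrable M R" for R :: "'a \<Rightarrow> real"
      proof (rule Bochner_Integration.integrable_bound[OF R])
        have [measurable]: "R \<in> borel_measurable M" using R by auto
        show "(\<lambda>\<omega>. complex_of_real (R \<omega>) * iexp (t * V \<omega>)) \<in> borel_measurable M" by measurable
      qed (simp add: norm_mult)
      have "0 = (LINT \<omega>|M. complex_of_real (P \<omega>) * iexp (t * V \<omega>) - complex_of_real (Q \<omega>) * iexp (t * V \<omega>))"
        using zero[of t] by (simp add: YPQ left_diff_distrib)
      also have "\<dots> = (LINT \<omega>|M. complex_of_real (P \<omega>) * iexp (t * V \<omega>)) -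
          (LINT \<omega>|M. complex_of_real (Q \<omega>) * iexp (t * V \<omega>))"
        by (rule Bochner_Integration.integral_diff[OF ii[OF Pi] ii[OF Qi]])
      finally show "char (\<mu> P) t = char (\<mu> Q) t"
        using ch[OF Pm P0 Pi m_def[symmetric]] ch[OF Qm Q0 Qi EQ] by simp
    qed
    then have "\<mu> P = \<mu> Q"
      by (intro Levy_uniqueness rd P0 Q0 Pi Qi EQ m_def[symmetric] Pm Qm)
    then have "(LINT \<omega>|M. P \<omega> * indicator B (V \<omega>)) = (LINT \<omega>|M. Q \<omega> * indicator B (V \<omega>))"
      using me[OF Pm P0 Pi m_def[symmetric]] me[OF Qm Q0 Qi EQ] by simp
    moreover have "(LINT \<omega>|M. Y \<omega> * indicator B (V \<omega>)) =
        (LINT \<omega>|M. P \<omega> * indicator B (V \<omega>)) - (LINT \<omega>|M. Q \<omega> * indicator B (V \<omega>))"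
    proof -
      have ii: "integrable M (\<lambda>\<omega>. R \<omega> * indicator B (V \<omega>))"
        if R: "integrable M R" for R :: "'a \<Rightarrow> real"
      proof (rule Bochner_Integration.integrable_bound[OF R])
        have [measurable]: "R \<in> borel_measurable M" using R by auto
        show "(\<lambda>\<omega>. R \<omega> * indicator B (V \<omega>)) \<in> borel_measurable M" by measurable
      qed (simp add: norm_mult indicator_def)
      show ?thesis
        by (subst Bochner_Integration.integral_diff[OF ii[OF Pi] ii[OF Qi], symmetric])
          (simp add: YPQ left_diff_distrib)
    qed
    ultimately show ?thesis by simp
  qed
qed

text \<open>Since the frequency may be replaced by its negative, the conjugate of \<open>Y\<close>
  satisfies the same hypothesis. Hence so do the real and the imaginary part, to which the real case
  applies.\<close>

lemma (in prob_space) fourier_zero_imp_indicator_zero: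
  fixes Y :: "'a \<Rightarrow> complex" and V :: "'a \<Rightarrow> real"
  assumes Y: "integrable M Y" and V[measurable]: "V \<in> borel_measurable M"
    and zero: "\<And>t. (LINT \<omega>|M. Y \<omega> * iexp (t * V \<omega>)) = 0"
    and B[measurable]: "B \<in> sets borel"
  shows "(LINT \<omega>|M. Y \<omega> * indicator B (V \<omega>)) = 0"
proof -
  have [measurable]: "Y \<in> borel_measurable M" using Y by auto
  have ie[measurable]: "(\<lambda>\<omega>. iexp (t * V \<omega>)) \<in> borel_measurable M" for t by measurable
  have ii: "integrable M (\<lambda>\<omega>. Z \<omega> * iexp (t * V \<omega>))" if Z: "integrable M Z" for t and Z :: "'a \<Rightarrow> complex"
  proof (rule Bochner_Integration.integrable_bound[OF Z])
    have [measurable]: "Z \<in> borel_measurable M" using Z by auto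
    show "(\<lambda>\<omega>. Z \<omega> * iexp (t * V \<omega>)) \<in> borel_measurable M" by measurable
  qed (simp add: norm_mult)
  have Yc: "integrable M (\<lambda>\<omega>. cnj (Y \<omega>))" using Y by simp
  have zc: "(LINT \<omega>|M. cnj (Y \<omega>) * iexp (t * V \<omega>)) = 0" for t
  proof -
    have "(LINT \<omega>|M. cnj (Y \<omega>) * iexp (t * V \<omega>)) = (LINT \<omega>|M. cnj (Y \<omega> * iexp (- t * V \<omega>)))"
      by (simp add: exp_cnj)
    also have "\<dots> = cnj (LINT \<omega>|M. Y \<omega> * iexp (- t * V \<omega>))"
      by (rule Bochner_Integration.integral_cnj)
    finally show ?thesis using zero[of "- t"] by simp
  qed
  have re: "(LINT \<omega>|M. complex_of_real (Re (Y \<omega>)) * iexp (t * V \<omega>)) = 0" for t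
  proof -
    have "(LINT \<omega>|M. complex_of_real (Re (Y \<omega>)) * iexp (t * V \<omega>)) =
        (LINT \<omega>|M. (Y \<omega> * iexp (t * V \<omega>) + cnj (Y \<omega>) * iexp (t * V \<omega>)) / 2)"
      by (intro Bochner_Integration.integral_cong refl) (simp add: complex_eq_iff)
    also have "\<dots> = 0" using zero[of t] zc[of t] ii[OF Y, of t] ii[OF Yc, of t] by simp
    finally show ?thesis .
  qed
  have im: "(LINT \<omega>|M. complex_of_real (Im (Y \<omega>)) * iexp (t * V \<omega>)) = 0" for t
  proof -
    have "(LINT \<omega>|M. complex_of_real (Im (Y \<omega>)) * iexp (t * V \<omega>)) =
        (LINT \<omega>|M. (Y \<omega> * iexp (t * V \<omega>) - cnj (Y \<omega>) * iexp (t * V \<omega>)) / (2 * \<i>))"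
      by (intro Bochner_Integration.integral_cong refl) (simp add: complex_eq_iff)
    also have "\<dots> = 0" using zero[of t] zc[of t] ii[OF Y, of t] ii[OF Yc, of t] by simp
    finally show ?thesis .
  qed
  have R: "(LINT \<omega>|M. Re (Y \<omega>) * indicator B (V \<omega>)) = 0"
    using Y by (intro fourier_zero_imp_indicator_zero_real[OF _ V re B]) auto
  have I: "(LINT \<omega>|M. Im (Y \<omega>) * indicator B (V \<omega>)) = 0"
    using Y by (intro fourier_zero_imp_indicator_zero_real[OF _ V im B]) auto
  have YI: "integrable M (\<lambda>\<omega>. Y \<omega> * indicator B (V \<omega>))"
    by (rule Bochner_Integration.integrable_bound[OF Y]) (auto simp: norm_mult indicator_def)
  show ?thesis
  proof (rule complex_eqI)
    have "Re (LINT \<omega>|M. Y \<omega> * indicator B (V \<omega>)) = (LINT \<omega>|M. Re (Y \<omega> * indicator B (V \<omega>)))"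
      using integral_Re[OF YI] by simp
    also have "\<dots> = (LINT \<omega>|M. Re (Y \<omega>) * indicator B (V \<omega>))"
      by (intro Bochner_Integration.integral_cong refl) (simp add: indicator_def)
    finally show "Re (LINT \<omega>|M. Y \<omega> * indicator B (V \<omega>)) = Re 0" using R by simp
    have "Im (LINT \<omega>|M. Y \<omega> * indicator B (V \<omega>)) = (LINT \<omega>|M. Im (Y \<omega> * indicator B (V \<omega>)))"
      using integral_Im[OF YI] by simp
    also have "\<dots> = (LINT \<omega>|M. Im (Y \<omega>) * indicator B (V \<omega>))"
      by (intro Bochner_Integration.integral_cong refl) (simp add: indicator_def)
    finally show "Im (LINT \<omega>|M. Y \<omega> * indicator B (V \<omega>)) = Im 0" using I by simp
  qed
qed

text \<open>Exponentials are traded for indicators one variable at a time, the remaining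
  exponentials being absorbed into the factor \<open>Y\<close>. This absorption produces complex
  factors even from a real \<open>Y\<close>, which is the reason for the complex version of the
  one-variable lemma.\<close>

lemma (in prob_space) fourier_zero_imp_indicator_zero_finite:
  fixes Y :: "'a \<Rightarrow> complex" and V :: "'i \<Rightarrow> 'a \<Rightarrow> real"
  assumes "finite I" and "integrable M Y" and "\<And>i. i \<in> I \<Longrightarrow> V i \<in> borel_measurable M"
    and "\<And>t. (LINT \<omega>|M. Y \<omega> * iexp (\<Sum>i\<in>I. t i * V i \<omega>)) = 0"
    and "\<And>i. i \<in> I \<Longrightarrow> B i \<in> sets borel"
  shows "(LINT \<omega>|M. Y \<omega> * (\<Prod>i\<in>I. indicator (B i) (V i \<omega>))) = 0"
  using assms
proof (induction I arbitrary: Y rule: finite_induct)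
  case empty
  then show ?case by simp
next
  case (insert i I)
  have [measurable]: "V j \<in> borel_measurable M" if "j \<in> insert i I" for j by (rule insert.prems(2)[OF that])
  have [measurable]: "V i \<in> borel_measurable M" "Y \<in> borel_measurable M" "B i \<in> sets borel"
    using insert.prems(1) insert.prems by auto
  define Y' where "Y' = (\<lambda>\<omega>. Y \<omega> * indicator (B i) (V i \<omega>))"
  have Y'i: "integrable M Y'" unfolding Y'_def
    by (rule Bochner_Integration.integrable_bound[OF insert.prems(1)]) (auto simp: norm_mult indicator_def)
  have z: "(LINT \<omega>|M. Y' \<omega> * iexp (\<Sum>j\<in>I. t j * V j \<omega>)) = 0" for t
  proof -
    \<comment> \<open>For fixed frequencies \<open>t\<close> of the remaining variables,
      \<open>Z\<close> is the factor against which the single variable \<open>V i\<close> is tested;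
      its frequency \<open>s\<close> is put back by the update \<open>t(i := s)\<close>.\<close>
    define Z where "Z = (\<lambda>\<omega>. Y \<omega> * iexp (\<Sum>j\<in>I. t j * V j \<omega>))"
    have Zi: "integrable M Z" unfolding Z_def
      by (rule Bochner_Integration.integrable_bound[OF insert.prems(1)]) (auto simp: norm_mult)
    have "(LINT \<omega>|M. Z \<omega> * indicator (B i) (V i \<omega>)) = 0"
    proof (rule fourier_zero_imp_indicator_zero[OF Zi])
      fix s
      have "Z \<omega> * iexp (s * V i \<omega>) = Y \<omega> * iexp (\<Sum>j\<in>insert i I. (t(i := s)) j * V j \<omega>)" for \<omega>
      proof -
        have "(\<Sum>j\<in>insert i I. (t(i := s)) j * V j \<omega>) = s * V i \<omega> + (\<Sum>j\<in>I. t j * V j \<omega>)"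
          using insert.hyps by (subst sum.insert) (auto intro!: sum.cong)
        then show ?thesis by (simp only: Z_def) (simp add: exp_add distrib_left algebra_simps)
      qed
      then show "(LINT \<omega>|M. Z \<omega> * iexp (s * V i \<omega>)) = 0"
        using insert.prems(3)[of "t(i := s)"] by simp
    qed auto
    then show ?thesis by (simp add: Z_def Y'_def mult_ac)
  qed
  have "(LINT \<omega>|M. Y' \<omega> * (\<Prod>j\<in>I. indicator (B j) (V j \<omega>))) = 0"
    by (rule insert.IH[OF Y'i _ z]) (use insert.prems in auto)
  then show ?case using insert.hyps by (simp add: Y'_def mult_ac)
qed

section \<open>The noise\<close>

locale noise_space = prob_space M
  for M :: "'o measure" and W :: "(real \<times> 'a::euclidean_space) set \<Rightarrow> 'o \<Rightarrow> real" +
  assumes white_noise: "white_noise M W"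
begin

lemma gaussian_sum: "finite \<A> \<Longrightarrow> \<A> \<subseteq> noise_sets \<Longrightarrow> gaussian_rv M (\<lambda>\<omega>. \<Sum>A\<in>\<A>. c A * W A \<omega>)"
  using white_noise unfolding white_noise_def by blast

lemma gaussian_W: "A \<in> noise_sets \<Longrightarrow> gaussian_rv M (W A)"
  using gaussian_sum[of "{A}" "\<lambda>_. 1"] by simp

lemma measurable_W[measurable]: "A \<in> noise_sets \<Longrightarrow> W A \<in> borel_measurable M"
  using gaussian_W by (auto simp: gaussian_rv_def)

lemma expectation_W: "A \<in> noise_sets \<Longrightarrow> expectation (W A) = 0"
  using white_noise unfolding white_noise_def by blast

lemma covariance_W:
  "A \<in> noise_sets \<Longrightarrow> B \<in> noise_sets \<Longrightarrow> expectation (\<lambda>\<omega>. W A \<omega> * W B \<omega>) = measure lborel (A \<inter> B)"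
  using white_noise unfolding white_noise_def by blast

lemma integrable_W_square: "A \<in> noise_sets \<Longrightarrow> integrable M (\<lambda>\<omega>. (W A \<omega>)\<^sup>2)"
  using gaussian_rv_centered(1)[OF gaussian_W expectation_W] .

lemma integrable_W: "A \<in> noise_sets \<Longrightarrow> integrable M (W A)"
  using integrable_square_imp_integrable[OF measurable_W integrable_W_square] .

lemma integrable_W_mult:
  "A \<in> noise_sets \<Longrightarrow> B \<in> noise_sets \<Longrightarrow> integrable M (\<lambda>\<omega>. W A \<omega> * W B \<omega>)"
  by (intro integrable_mult_of_squares integrable_W_square measurable_W)

text \<open>These are the variables whose law the white noise axiom provides. A joint characteristic
  function of noise values is a mean of \<open>iexp\<close> of such a combination, and the parameter
  allows a restriction to sets before or after a given time.\<close>

definition noise_span :: "(real \<times> 'a) set set \<Rightarrow> ('o \<Rightarrow> real) set" where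
  "noise_span \<S> = {(\<lambda>\<omega>. \<Sum>A\<in>\<A>. c A * W A \<omega>) | \<A> c. finite \<A> \<and> \<A> \<subseteq> \<S>}"

lemma noise_spanE:
  assumes "U \<in> noise_span \<S>"
  obtains \<A> c where "finite \<A>" "\<A> \<subseteq> \<S>" "U = (\<lambda>\<omega>. \<Sum>A\<in>\<A>. c A * W A \<omega>)"
  using assms by (auto simp: noise_span_def)

lemma noise_spanI:
  "finite \<A> \<Longrightarrow> \<A> \<subseteq> \<S> \<Longrightarrow> (\<lambda>\<omega>. \<Sum>A\<in>\<A>. c A * W A \<omega>) \<in> noise_span \<S>"
  by (auto simp: noise_span_def)

lemma noise_span_scale:
  assumes "U \<in> noise_span \<S>" shows "(\<lambda>\<omega>. r * U \<omega>) \<in> noise_span \<S>"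
proof -
  obtain \<A> c where *: "finite \<A>" "\<A> \<subseteq> \<S>" "U = (\<lambda>\<omega>. \<Sum>A\<in>\<A>. c A * W A \<omega>)"
    using assms by (rule noise_spanE)
  then have "(\<lambda>\<omega>. r * U \<omega>) = (\<lambda>\<omega>. \<Sum>A\<in>\<A>. (r * c A) * W A \<omega>)"
    by (simp add: sum_distrib_left mult.assoc)
  then show ?thesis using *(1,2) by (auto simp only: intro!: noise_spanI)
qed

lemma noise_span_add:
  assumes "U \<in> noise_span \<S>" "V \<in> noise_span \<S>" shows "(\<lambda>\<omega>. U \<omega> + V \<omega>) \<in> noise_span \<S>"
proof -
  obtain \<A> c where A: "finite \<A>" "\<A> \<subseteq> \<S>" "U = (\<lambda>\<omega>. \<Sum>A\<in>\<A>. c A * W A \<omega>)"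
    using assms(1) by (rule noise_spanE)
  obtain \<B> d where B: "finite \<B>" "\<B> \<subseteq> \<S>" "V = (\<lambda>\<omega>. \<Sum>A\<in>\<B>. d A * W A \<omega>)"
    using assms(2) by (rule noise_spanE)
  have "(\<Sum>A\<in>\<A>. c A * W A \<omega>) = (\<Sum>A\<in>\<A> \<union> \<B>. (if A \<in> \<A> then c A else 0) * W A \<omega>)" for \<omega>
    using A B by (intro sum.mono_neutral_cong_left) auto
  moreover have "(\<Sum>A\<in>\<B>. d A * W A \<omega>) = (\<Sum>A\<in>\<A> \<union> \<B>. (if A \<in> \<B> then d A else 0) * W A \<omega>)" for \<omega>
    using A B by (intro sum.mono_neutral_cong_left) auto
  ultimately have "(\<lambda>\<omega>. U \<omega> + V \<omega>) =
      (\<lambda>\<omega>. \<Sum>A\<in>\<A> \<union> \<B>. ((if A \<in> \<A> then c A else 0) + (if A \<in> \<B> then d A else 0)) * W A \<omega>)"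
    using A B by (simp add: distrib_right sum.distrib)
  then show ?thesis using A(1,2) B(1,2) by (auto simp only: intro!: noise_spanI)
qed

lemma noise_span_mono: "\<S> \<subseteq> \<T> \<Longrightarrow> noise_span \<S> \<subseteq> noise_span \<T>"
  by (fastforce simp: noise_span_def)

lemma W_in_noise_span: "A \<in> \<S> \<Longrightarrow> W A \<in> noise_span \<S>"
  using noise_spanI[of "{A}" \<S> "\<lambda>_. 1"] by simp

lemma zero_in_noise_span: "(\<lambda>\<omega>. 0) \<in> noise_span \<S>"
  using noise_spanI[of "{}" \<S>] by simp

lemma noise_span_sum:
  "finite I \<Longrightarrow> (\<And>i. i \<in> I \<Longrightarrow> U i \<in> noise_span \<S>) \<Longrightarrow> (\<lambda>\<omega>. \<Sum>i\<in>I. U i \<omega>) \<in> noise_span \<S>"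
  by (induction I rule: finite_induct) (auto intro: zero_in_noise_span noise_span_add)

context
  fixes U assumes U: "U \<in> noise_span noise_sets"
begin

lemma noise_span_gaussian: "gaussian_rv M U"
  using U by (auto simp: noise_span_def intro!: gaussian_sum)

lemma noise_span_measurable[measurable]: "U \<in> borel_measurable M"
  using noise_span_gaussian by (simp add: gaussian_rv_def)

lemma noise_span_expectation: "expectation U = 0"
proof -
  obtain \<A> c where A: "finite \<A>" "\<A> \<subseteq> noise_sets" "U = (\<lambda>\<omega>. \<Sum>A\<in>\<A>. c A * W A \<omega>)"
    using U by (rule noise_spanE)
  have "expectation U = (\<Sum>A\<in>\<A>. expectation (\<lambda>\<omega>. c A * W A \<omega>))"
    unfolding A(3) using A by (intro Bochner_Integration.integral_sum) (auto intro!: integrable_W)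
  also have "\<dots> = 0" using A by (intro sum.neutral) (auto simp: expectation_W)
  finally show ?thesis .
qed

lemma noise_span_integrable_square: "integrable M (\<lambda>\<omega>. (U \<omega>)\<^sup>2)"
  using gaussian_rv_centered(1)[OF noise_span_gaussian noise_span_expectation] .

lemma noise_span_integrable: "integrable M U"
  using integrable_square_imp_integrable[OF noise_span_measurable noise_span_integrable_square] .

lemma noise_span_char:
  "(LINT \<omega>|M. iexp (U \<omega>)) = exp (- (expectation (\<lambda>\<omega>. (U \<omega>)\<^sup>2) / 2))"
  using gaussian_rv_centered(2)[OF noise_span_gaussian noise_span_expectation] .

end

lemma noise_span_orthogonal:
  assumes U: "U \<in> noise_span \<S>" and V: "V \<in> noise_span \<T>"
    and "\<S> \<subseteq> noise_sets" "\<T> \<subseteq> noise_sets"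
    and disj: "\<And>A B. A \<in> \<S> \<Longrightarrow> B \<in> \<T> \<Longrightarrow> A \<inter> B = {}"
  shows "expectation (\<lambda>\<omega>. U \<omega> * V \<omega>) = 0"
proof -
  obtain \<A> c where A: "finite \<A>" "\<A> \<subseteq> \<S>" "U = (\<lambda>\<omega>. \<Sum>A\<in>\<A>. c A * W A \<omega>)"
    using U by (rule noise_spanE)
  obtain \<B> d where B: "finite \<B>" "\<B> \<subseteq> \<T>" "V = (\<lambda>\<omega>. \<Sum>A\<in>\<B>. d A * W A \<omega>)"
    using V by (rule noise_spanE)
  have UV: "U \<omega> * V \<omega> = (\<Sum>A\<in>\<A>. \<Sum>B\<in>\<B>. (c A * d B) * (W A \<omega> * W B \<omega>))" for \<omega>
    by (simp add: A(3) B(3) sum_product mult_ac)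
  have "expectation (\<lambda>\<omega>. U \<omega> * V \<omega>) =
      (\<Sum>A\<in>\<A>. \<Sum>B\<in>\<B>. expectation (\<lambda>\<omega>. (c A * d B) * (W A \<omega> * W B \<omega>)))"
    unfolding UV using A B assms(3,4)
    by (subst Bochner_Integration.integral_sum, fastforce intro!: Bochner_Integration.integrable_sum integrable_mult_right integrable_W_mult)
      (intro sum.cong refl Bochner_Integration.integral_sum integrable_mult_right integrable_W_mult; auto)
  also have "\<dots> = 0"
  proof (intro sum.neutral ballI)
    fix A' B' assume "A' \<in> \<A>" "B' \<in> \<B>"
    then have "A' \<inter> B' = {}" "A' \<in> noise_sets" "B' \<in> noise_sets" using A B assms(3,4) disj by blast+
    then show "expectation (\<lambda>\<omega>. (c A' * d B') * (W A' \<omega> * W B' \<omega>)) = 0"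
      by (simp add: covariance_W)
  qed
  finally show ?thesis .
qed

text \<open>Closed at \<open>a\<close> for the past and open for the future, so that sets of the two
  families are disjoint and the half-open slabs of elementary processes that start at
  \<open>a\<close> belong to the future.\<close>

abbreviation past :: "real \<Rightarrow> (real \<times> 'a) set set" where
  "past a \<equiv> {A \<in> noise_sets. A \<subseteq> {0..a} \<times> UNIV}"

abbreviation future :: "real \<Rightarrow> (real \<times> 'a) set set" where
  "future a \<equiv> {A \<in> noise_sets. A \<subseteq> {a<..} \<times> UNIV}"

text \<open>The sum of the two variables is again centered Gaussian, and disjointness of past and
  future sets makes its variance additive. The exponent of the characteristic function therefore
  splits.\<close>

lemma past_future_char:
  assumes U: "U \<in> noise_span (past a)" and V: "V \<in> noise_span (future a)"
  shows "(LINT \<omega>|M. iexp (V \<omega>) * iexp (U \<omega>)) = (LINT \<omega>|M. iexp (V \<omega>)) * (LINT \<omega>|M. iexp (U \<omega>))"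
proof -
  have U': "U \<in> noise_span noise_sets" and V': "V \<in> noise_span noise_sets"
    using U V noise_span_mono[of "past a" noise_sets] noise_span_mono[of "future a" noise_sets] by auto
  have UV': "(\<lambda>\<omega>. V \<omega> + U \<omega>) \<in> noise_span noise_sets" by (rule noise_span_add[OF V' U'])
  have orth: "expectation (\<lambda>\<omega>. U \<omega> * V \<omega>) = 0"
    by (rule noise_span_orthogonal[OF U V]) fastforce+
  have "(V \<omega> + U \<omega>)\<^sup>2 = (V \<omega>)\<^sup>2 + (U \<omega>)\<^sup>2 + 2 * (U \<omega> * V \<omega>)" for \<omega>
    by (simp add: power2_sum)
  then have sq: "expectation (\<lambda>\<omega>. (V \<omega> + U \<omega>)\<^sup>2) = expectation (\<lambda>\<omega>. (V \<omega>)\<^sup>2) + expectation (\<lambda>\<omega>. (U \<omega>)\<^sup>2)"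
    using orth noise_span_integrable_square[OF U'] noise_span_integrable_square[OF V']
      integrable_mult_of_squares[OF noise_span_measurable[OF U'] noise_span_measurable[OF V']]
    by simp
  have "(LINT \<omega>|M. iexp (V \<omega>) * iexp (U \<omega>)) = (LINT \<omega>|M. iexp (V \<omega> + U \<omega>))"
    by (simp add: distrib_left exp_add)
  also have "\<dots> = exp (- ((expectation (\<lambda>\<omega>. (V \<omega>)\<^sup>2) + expectation (\<lambda>\<omega>. (U \<omega>)\<^sup>2)) / 2))"
    using noise_span_char[OF UV'] sq by simp
  also have "\<dots> = (LINT \<omega>|M. iexp (V \<omega>)) * (LINT \<omega>|M. iexp (U \<omega>))"
    unfolding noise_span_char[OF U'] noise_span_char[OF V']
    by (simp only: of_real_mult[symmetric] exp_add[symmetric]) (simp add: add_divide_distrib)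
  finally show ?thesis .
qed

text \<open>Fourier uniqueness is used twice. For fixed \<open>s\<close>, the variable iexp(s V)
  minus its mean is orthogonal to all exponentials of the past values, hence to the indicator of the
  past event \<open>S\<close>. Reading this as a statement about all \<open>s\<close>, the variable
  1_S - P(S) is orthogonal to all exponentials of \<open>V\<close>, hence to the indicator of V
  \<in> C.\<close>

lemma prob_past_future:
  assumes fin: "finite I" and A: "\<And>i. i \<in> I \<Longrightarrow> A i \<in> past a" and B: "\<And>i. i \<in> I \<Longrightarrow> B i \<in> sets borel"
    and V: "V \<in> noise_span (future a)" and C[measurable]: "C \<in> sets borel"
  shows "prob {\<omega> \<in> space M. (\<forall>i\<in>I. W (A i) \<omega> \<in> B i) \<and> V \<omega> \<in> C} =
    prob {\<omega> \<in> space M. \<forall>i\<in>I. W (A i) \<omega> \<in> B i} * prob {\<omega> \<in> space M. V \<omega> \<in> C}"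
proof -
  note [measurable] = fin
  have [measurable]: "W (A i) \<in> borel_measurable M" "B i \<in> sets borel" if "i \<in> I" for i
    using A[OF that] B[OF that] by auto
  have V': "V \<in> noise_span noise_sets" using V noise_span_mono[of "future a" noise_sets] by auto
  have [measurable]: "V \<in> borel_measurable M" by (rule noise_span_measurable[OF V'])
  define S where "S = {\<omega> \<in> space M. \<forall>i\<in>I. W (A i) \<omega> \<in> B i}"
  have [measurable]: "S \<in> sets M" unfolding S_def using fin by measurable
  have ie: "integrable M (\<lambda>\<omega>. iexp (X \<omega>))" if [measurable]: "X \<in> borel_measurable M" for X :: "'o \<Rightarrow> real"
    by (rule integrable_const_bound[where B=1]) auto
  have step: "(LINT \<omega>|M. complex_of_real (indicator S \<omega> - prob S) * iexp (s * V \<omega>)) = 0" for s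
  proof -
    define ch where "ch = (LINT \<omega>|M. iexp (s * V \<omega>))"
    have sV: "(\<lambda>\<omega>. s * V \<omega>) \<in> noise_span (future a)" by (rule noise_span_scale[OF V])
    define Y where "Y = (\<lambda>\<omega>. iexp (s * V \<omega>) - ch)"
    \<comment> \<open>Complex integrability is all that the finite-dimensional uniqueness lemma asks
      of the centered exponential.\<close>
    have Yi: "integrable M Y" unfolding Y_def by (intro Bochner_Integration.integrable_diff ie integrable_const) measurable
    have "(LINT \<omega>|M. Y \<omega> * (\<Prod>i\<in>I. indicator (B i) (W (A i) \<omega>))) = 0"
    proof (rule fourier_zero_imp_indicator_zero_finite[OF fin Yi])
      fix t :: "'b \<Rightarrow> real"
      define U where "U = (\<lambda>\<omega>. \<Sum>i\<in>I. t i * W (A i) \<omega>)"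
      have U: "U \<in> noise_span (past a)" unfolding U_def using A
        by (intro noise_span_sum[OF fin] noise_span_scale W_in_noise_span) auto
      then have [measurable]: "U \<in> borel_measurable M"
        using noise_span_mono[of "past a" noise_sets] by (intro noise_span_measurable) auto
      have "integrable M (\<lambda>\<omega>. iexp (s * V \<omega> + U \<omega>))" by (rule ie) measurable
      then have i1: "integrable M (\<lambda>\<omega>. iexp (s * V \<omega>) * iexp (U \<omega>))"
        by (simp add: distrib_left exp_add)
      have "(LINT \<omega>|M. Y \<omega> * iexp (U \<omega>)) = (LINT \<omega>|M. iexp (s * V \<omega>) * iexp (U \<omega>) - ch * iexp (U \<omega>))"
        by (simp add: Y_def left_diff_distrib)
      also have "\<dots> = (LINT \<omega>|M. iexp (s * V \<omega>) * iexp (U \<omega>)) - (LINT \<omega>|M. ch * iexp (U \<omega>))"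
        by (intro Bochner_Integration.integral_diff i1 integrable_mult_right ie) measurable
      also have "\<dots> = 0" using past_future_char[OF U sV] by (simp add: ch_def)
      finally show "(LINT \<omega>|M. Y \<omega> * iexp (\<Sum>i\<in>I. t i * W (A i) \<omega>)) = 0" by (simp add: U_def)
    qed auto
    moreover have "(\<Prod>i\<in>I. indicator (B i) (W (A i) \<omega>)) = (indicator S \<omega> :: complex)"
      if \<omega>: "\<omega> \<in> space M" for \<omega>
    proof (cases "\<omega> \<in> S")
      case True
      then show ?thesis by (auto simp: S_def intro!: prod.neutral)
    next
      case False
      then obtain i where "i \<in> I" "W (A i) \<omega> \<notin> B i" using \<omega> by (auto simp: S_def)
      then show ?thesis using False fin by (auto simp: indicator_def intro!: prod_zero)
    qed
    ultimately have 0: "(LINT \<omega>|M. Y \<omega> * indicator S \<omega>) = 0"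
      by (simp cong: Bochner_Integration.integral_cong)
    have i1: "integrable M (\<lambda>\<omega>. iexp (s * V \<omega>) * indicator S \<omega>)"
      by (rule Bochner_Integration.integrable_bound[OF ie[of "\<lambda>\<omega>. s * V \<omega>"]]) (auto simp: norm_mult indicator_def)
    have "(LINT \<omega>|M. Y \<omega> * indicator S \<omega>) = (LINT \<omega>|M. iexp (s * V \<omega>) * indicator S \<omega> - ch * indicator S \<omega>)"
      by (simp add: Y_def left_diff_distrib)
    also have "\<dots> = (LINT \<omega>|M. iexp (s * V \<omega>) * indicator S \<omega>) - (LINT \<omega>|M. ch * indicator S \<omega>)"
      by (intro Bochner_Integration.integral_diff i1 integrable_mult_right integrable_const_bound[where B=1])
        (auto simp: indicator_def)
    finally have 2: "(LINT \<omega>|M. iexp (s * V \<omega>) * indicator S \<omega>) = (LINT \<omega>|M. ch * indicator S \<omega>)"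
      using 0 by (metis eq_iff_diff_eq_0)
    have ind: "(\<lambda>\<omega>. complex_of_real (indicator S \<omega>)) = indicator S" by (simp add: indicator_def fun_eq_iff)
    have "(LINT \<omega>|M. complex_of_real (indicator S \<omega>)) = complex_of_real (LINT \<omega>|M. indicator S \<omega>)"
      by (rule integral_complex_of_real)
    then have "(LINT \<omega>|M. indicator S \<omega>) = complex_of_real (prob S)" by (simp add: ind)
    then have 1: "(LINT \<omega>|M. iexp (s * V \<omega>) * indicator S \<omega>) = ch * prob S"
      unfolding 2 integral_mult_right_zero by (rule arg_cong)
    have "(LINT \<omega>|M. complex_of_real (indicator S \<omega> - prob S) * iexp (s * V \<omega>)) =
        (LINT \<omega>|M. iexp (s * V \<omega>) * indicator S \<omega> - prob S * iexp (s * V \<omega>))"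
      by (intro Bochner_Integration.integral_cong refl) (simp add: left_diff_distrib indicator_def)
    also have "\<dots> = (LINT \<omega>|M. iexp (s * V \<omega>) * indicator S \<omega>) - (LINT \<omega>|M. prob S * iexp (s * V \<omega>))"
      by (intro Bochner_Integration.integral_diff i1 integrable_mult_right ie) measurable
    also have "\<dots> = 0" using 1 by (simp add: ch_def)
    finally show ?thesis .
  qed
  have Si: "integrable M (\<lambda>\<omega>. indicator S \<omega> - prob S)"
    by (simp add: emeasure_eq_measure)
  have "(LINT \<omega>|M. (indicator S \<omega> - prob S) * indicator C (V \<omega>)) = 0"
    by (rule fourier_zero_imp_indicator_zero_real[OF Si _ step C]) measurable
  moreover have "(LINT \<omega>|M. (indicator S \<omega> - prob S) * indicator C (V \<omega>)) =
      prob {\<omega> \<in> space M. (\<forall>i\<in>I. W (A i) \<omega> \<in> B i) \<and> V \<omega> \<in> C} - prob S * prob {\<omega> \<in> space M. V \<omega> \<in> C}"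
  proof -
    let ?VC = "{\<omega> \<in> space M. V \<omega> \<in> C}"
    have [measurable]: "?VC \<in> sets M" by measurable
    have "(LINT \<omega>|M. (indicator S \<omega> - prob S) * indicator C (V \<omega>)) =
       (LINT \<omega>|M. indicator (S \<inter> ?VC) \<omega> - prob S * indicator ?VC \<omega>)"
      by (intro Bochner_Integration.integral_cong refl) (auto simp: indicator_def)
    also have "\<dots> = prob (S \<inter> ?VC) - prob S * prob ?VC"
      by (subst Bochner_Integration.integral_diff) (auto simp: emeasure_eq_measure)
    also have "S \<inter> ?VC = {\<omega> \<in> space M. (\<forall>i\<in>I. W (A i) \<omega> \<in> B i) \<and> V \<omega> \<in> C}"
      by (auto simp: S_def)
    finally show ?thesis .
  qed
  ultimately show ?thesis by (simp add: S_def)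
qed

section \<open>The filtration and the independence of the future from the past\<close>

lemma space_noise_filtration[simp]: "space (noise_filtration M W a) = space M"
  by (auto simp: noise_filtration_def intro!: space_measure_of dest: sets.sets_into_space)

lemma noise_filtration_generator_subset:
  "{W A -` B \<inter> space M | A B. A \<in> noise_sets \<and> A \<subseteq> {0..a} \<times> UNIV \<and> B \<in> sets borel} \<union> null_sets M
    \<subseteq> sets M"
  by auto

lemma sets_noise_filtration:
  "sets (noise_filtration M W a) = sigma_sets (space M)
    ({W A -` B \<inter> space M | A B. A \<in> noise_sets \<and> A \<subseteq> {0..a} \<times> UNIV \<and> B \<in> sets borel} \<union> null_sets M)"
  unfolding noise_filtration_def
  by (rule sets_measure_of) (use noise_filtration_generator_subset sets.sets_into_space in blast)

lemma noise_filtration_measurable_imp: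
  assumes "X \<in> borel_measurable (noise_filtration M W a)" shows "X \<in> borel_measurable M"
proof -
  have "sets (noise_filtration M W a) \<subseteq> sets M"
    unfolding sets_noise_filtration by (rule sets.sigma_sets_subset[OF noise_filtration_generator_subset])
  then show ?thesis by (intro measurable_from_subalg[OF _ assms]) (simp add: subalgebra_def)
qed

lemma noise_filtration_mono:
  assumes "X \<in> borel_measurable (noise_filtration M W a)" "a \<le> b"
  shows "X \<in> borel_measurable (noise_filtration M W b)"
proof -
  have "sets (noise_filtration M W a) \<subseteq> sets (noise_filtration M W b)"
    unfolding sets_noise_filtration
  proof (rule sigma_sets_mono', rule Un_mono[OF _ subset_refl], safe)
    fix A :: "(real \<times> 'a) set" and B :: "real set"
    assume "A \<in> noise_sets" "A \<subseteq> {0..a} \<times> UNIV" "B \<in> sets borel"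
    moreover have "{0..a} \<times> UNIV \<subseteq> {0..b} \<times> (UNIV::'a set)" using \<open>a \<le> b\<close> by auto
    ultimately show "\<exists>A' B'. W A -` B \<inter> space M = W A' -` B' \<inter> space M \<and>
        A' \<in> noise_sets \<and> A' \<subseteq> {0..b} \<times> UNIV \<and> B' \<in> sets borel" by blast
  qed
  then show ?thesis by (intro measurable_from_subalg[OF _ assms(1)]) (simp add: subalgebra_def)
qed

lemma W_measurable_noise_filtration:
  assumes "A \<in> past a" shows "W A \<in> borel_measurable (noise_filtration M W a)"
proof (rule measurableI)
  fix B :: "real set" assume "B \<in> sets borel"
  then show "W A -` B \<inter> space (noise_filtration M W a) \<in> sets (noise_filtration M W a)"
    unfolding sets_noise_filtration space_noise_filtration using assms by (intro sigma_sets.Basic) blast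
qed auto

text \<open>The product formula extends from finite intersections of generators to the generated
  sigma-algebras, because these intersections form a class stable under intersection. The null sets
  among the generators do no harm: an intersection that involves one of them is null, and both sides
  of the product formula vanish.\<close>

lemma indep_past_future:
  assumes X: "X \<in> borel_measurable (noise_filtration M W a)" and V: "V \<in> noise_span (future a)"
  shows "indep_var borel X borel V"
proof -
  have V': "V \<in> noise_span noise_sets" using V noise_span_mono[of "future a" noise_sets] by auto
  have [measurable]: "V \<in> borel_measurable M" by (rule noise_span_measurable[OF V'])
  have [measurable]: "X \<in> borel_measurable M" by (rule noise_filtration_measurable_imp[OF X])
  define \<G> where "\<G> = {W A -` B \<inter> space M | A B. A \<in> noise_sets \<and> A \<subseteq> {0..a} \<times> UNIV \<and> B \<in> sets borel}"
  \<comment> \<open>The intersection with \<open>space M\<close> makes the empty family yield the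
    whole space instead of \<open>UNIV\<close>.\<close>
  define \<P> where "\<P> = {space M \<inter> \<Inter>\<S> | \<S>. finite \<S> \<and> \<S> \<subseteq> \<G> \<union> null_sets M}"
  define \<Q> where "\<Q> = {V -` B \<inter> space M | B. B \<in> sets borel}"
  have G: "\<G> \<union> null_sets M \<subseteq> sets M" unfolding \<G>_def by (rule noise_filtration_generator_subset)
  have P_sets: "\<P> \<subseteq> sets M"
  proof
    fix S assume "S \<in> \<P>"
    then obtain \<S> where \<S>: "finite \<S>" "\<S> \<subseteq> \<G> \<union> null_sets M" "S = space M \<inter> \<Inter>\<S>"
      by (auto simp: \<P>_def)
    then have "S = (\<Inter>T\<in>insert (space M) \<S>. T)" by simp
    also have "\<dots> \<in> sets M" using \<S> G by (intro sets.finite_INT) auto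
    finally show "S \<in> sets M" .
  qed
  have "indep_set \<P> \<Q>"
  proof (rule indep_setI)
    show "\<P> \<subseteq> events" by (rule P_sets)
    show "\<Q> \<subseteq> events" by (auto simp: \<Q>_def)
    fix S T assume "S \<in> \<P>" "T \<in> \<Q>"
    then obtain \<S> C where \<S>: "finite \<S>" "\<S> \<subseteq> \<G> \<union> null_sets M" "S = space M \<inter> \<Inter>\<S>"
      and C: "C \<in> sets borel" "T = V -` C \<inter> space M"
      by (auto simp: \<P>_def \<Q>_def)
    show "prob (S \<inter> T) = prob S * prob T"
    proof (cases "\<S> \<subseteq> \<G>")
      case False
      then obtain N where N: "N \<in> \<S>" "N \<in> null_sets M" using \<S> by blast
      have "S \<in> sets M" using P_sets \<open>S \<in> \<P>\<close> by (rule subsetD)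
      moreover have "N \<inter> S = S" using N(1) unfolding \<S>(3) by blast
      ultimately have S0: "S \<in> null_sets M" using null_set_Int2[OF N(2), of S] by simp
      have "T \<in> sets M" unfolding C(2) using C(1) by measurable
      then have "S \<inter> T \<in> null_sets M" by (rule null_set_Int2[OF S0])
      from measure_eq_0_null_sets[OF this] measure_eq_0_null_sets[OF S0]
      show ?thesis by (simp only: mult_zero_left)
    next
      case True
      have "\<exists>A B. A \<in> past a \<and> B \<in> sets borel \<and> g = {\<omega> \<in> space M. W A \<omega> \<in> B}" if "g \<in> \<S>" for g
      proof -
        obtain A B where *: "A \<in> noise_sets" "A \<subseteq> {0..a} \<times> UNIV" "B \<in> sets borel" "g = W A -` B \<inter> space M"
          using subsetD[OF True \<open>g \<in> \<S>\<close>] unfolding \<G>_def mem_Collect_eq by (elim exE conjE)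
        moreover have "W A -` B \<inter> space M = {\<omega> \<in> space M. W A \<omega> \<in> B}" by blast
        ultimately show ?thesis by (intro exI[of _ A] exI[of _ B]) simp
      qed
      then have ex: "\<forall>g\<in>\<S>. \<exists>A B. A \<in> past a \<and> B \<in> sets borel \<and> g = {\<omega> \<in> space M. W A \<omega> \<in> B}"
        by (intro ballI)
      from bchoice[OF ex] obtain A where
        ex': "\<forall>g\<in>\<S>. \<exists>B. A g \<in> past a \<and> B \<in> sets borel \<and> g = {\<omega> \<in> space M. W (A g) \<omega> \<in> B}" ..
      from bchoice[OF ex'] obtain B where
        "\<forall>g\<in>\<S>. A g \<in> past a \<and> B g \<in> sets borel \<and> g = {\<omega> \<in> space M. W (A g) \<omega> \<in> B g}" ..
      then have AB: "\<And>g. g \<in> \<S> \<Longrightarrow> A g \<in> past a" "\<And>g. g \<in> \<S> \<Longrightarrow> B g \<in> sets borel"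
        "\<And>g. g \<in> \<S> \<Longrightarrow> g = {\<omega> \<in> space M. W (A g) \<omega> \<in> B g}"
        by (simp_all only: Ball_def)
      have mem: "\<omega> \<in> g \<longleftrightarrow> W (A g) \<omega> \<in> B g" if "g \<in> \<S>" "\<omega> \<in> space M" for g \<omega>
        by (subst AB(3)[OF that(1)]) (simp add: that(2))
      have "S = {\<omega> \<in> space M. \<forall>g\<in>\<S>. W (A g) \<omega> \<in> B g}"
        unfolding \<S>(3) by (rule set_eqI) (simp add: mem cong: conj_cong)
      moreover have "T = {\<omega> \<in> space M. V \<omega> \<in> C}" unfolding C(2) by blast
      ultimately have "S \<inter> T = {\<omega> \<in> space M. (\<forall>g\<in>\<S>. W (A g) \<omega> \<in> B g) \<and> V \<omega> \<in> C}"
        and "S = {\<omega> \<in> space M. \<forall>g\<in>\<S>. W (A g) \<omega> \<in> B g}" and "T = {\<omega> \<in> space M. V \<omega> \<in> C}"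
        by blast+
      then show ?thesis
        using prob_past_future[OF \<S>(1) AB(1,2) V C(1)] by (simp only:)
    qed
  qed
  moreover have "Int_stable \<P>"
  proof (rule Int_stableI)
    fix S T assume "S \<in> \<P>" "T \<in> \<P>"
    then obtain \<S> \<T> where "finite \<S>" "\<S> \<subseteq> \<G> \<union> null_sets M" "S = space M \<inter> \<Inter>\<S>"
      "finite \<T>" "\<T> \<subseteq> \<G> \<union> null_sets M" "T = space M \<inter> \<Inter>\<T>"
      by (auto simp: \<P>_def)
    then have "finite (\<S> \<union> \<T>)" "\<S> \<union> \<T> \<subseteq> \<G> \<union> null_sets M" "S \<inter> T = space M \<inter> \<Inter>(\<S> \<union> \<T>)" by auto
    then show "S \<inter> T \<in> \<P>" unfolding \<P>_def by blast
  qed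
  moreover have "Int_stable \<Q>"
  proof (rule Int_stableI)
    fix S T assume "S \<in> \<Q>" "T \<in> \<Q>"
    then obtain B C where "B \<in> sets borel" "C \<in> sets borel" "S = V -` B \<inter> space M" "T = V -` C \<inter> space M"
      by (auto simp: \<Q>_def)
    then have "B \<inter> C \<in> sets borel" "S \<inter> T = V -` (B \<inter> C) \<inter> space M" by auto
    then show "S \<inter> T \<in> \<Q>" unfolding \<Q>_def by blast
  qed
  ultimately have ind: "indep_set (sigma_sets (space M) \<P>) (sigma_sets (space M) \<Q>)"
    by (rule indep_set_sigma_sets)
  have GP: "\<G> \<union> null_sets M \<subseteq> \<P>"
  proof
    fix g assume g: "g \<in> \<G> \<union> null_sets M"
    then have "g = space M \<inter> \<Inter>{g}" using G sets.sets_into_space by auto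
    moreover have "finite {g}" "{g} \<subseteq> \<G> \<union> null_sets M" using g by auto
    ultimately show "g \<in> \<P>" unfolding \<P>_def by blast
  qed
  have XP: "sigma_sets (space M) {X -` B \<inter> space M | B. B \<in> sets borel} \<subseteq> sigma_sets (space M) \<P>"
  proof (rule sigma_sets_mono, safe)
    fix B :: "real set" assume "B \<in> sets borel"
    then have "X -` B \<inter> space M \<in> sets (noise_filtration M W a)"
      using measurable_sets[OF X] by simp
    also have "\<dots> = sigma_sets (space M) (\<G> \<union> null_sets M)"
      unfolding sets_noise_filtration \<G>_def ..
    also have "\<dots> \<subseteq> sigma_sets (space M) \<P>" by (rule sigma_sets_mono'[OF GP])
    finally show "X -` B \<inter> space M \<in> sigma_sets (space M) \<P>" .
  qed
  show ?thesis unfolding indep_var_eq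
  proof (intro conjI indep_setI)
    show "sigma_sets (space M) {X -` A \<inter> space M |A. A \<in> sets borel} \<subseteq> events"
      by (rule sets.sigma_sets_subset) auto
    show "sigma_sets (space M) {V -` A \<inter> space M |A. A \<in> sets borel} \<subseteq> events"
      by (rule sets.sigma_sets_subset) auto
    show "prob (x \<inter> y) = prob x * prob y" if "x \<in> sigma_sets (space M) {X -` A \<inter> space M |A. A \<in> sets borel}"
      "y \<in> sigma_sets (space M) {V -` A \<inter> space M |A. A \<in> sets borel}" for x y
    using that XP by (intro indep_setD[OF ind]) (auto simp only: \<Q>_def)
  qed measurable
qed

end

section \<open>Mean and second moment of Walsh integrals\<close>

context noise_space
begin

text \<open>Independence is known for \<open>X\<close> and one element of the future span at a time,
  which settles squares. The product V V' then follows by polarization, since the span contains V +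
  V' and V - V'.\<close>

lemma integrable_mult_past_future:
  assumes X: "X \<in> borel_measurable (noise_filtration M W a)" and Xi: "integrable M X"
    and V: "V \<in> noise_span (future a)" and V': "V' \<in> noise_span (future a)"
  shows "integrable M (\<lambda>\<omega>. X \<omega> * V \<omega>)" and "expectation (\<lambda>\<omega>. X \<omega> * V \<omega>) = 0"
    and "integrable M (\<lambda>\<omega>. X \<omega> * (V \<omega> * V' \<omega>))"
    and "expectation (\<lambda>\<omega>. X \<omega> * (V \<omega> * V' \<omega>)) = expectation X * expectation (\<lambda>\<omega>. V \<omega> * V' \<omega>)"
proof -
  have sub: "noise_span (future a) \<subseteq> noise_span noise_sets" by (rule noise_span_mono) auto
  have sq: "integrable M (\<lambda>\<omega>. X \<omega> * (U \<omega>)\<^sup>2)"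
      "expectation (\<lambda>\<omega>. X \<omega> * (U \<omega>)\<^sup>2) = expectation X * expectation (\<lambda>\<omega>. (U \<omega>)\<^sup>2)"
    if U: "U \<in> noise_span (future a)" for U
  proof -
    have "indep_var borel (id \<circ> X) borel ((\<lambda>x. x\<^sup>2) \<circ> U)"
      by (rule indep_var_compose[OF indep_past_future[OF X U]]) auto
    then have ind: "indep_var borel X borel (\<lambda>\<omega>. (U \<omega>)\<^sup>2)" by (simp add: comp_def)
    have U2: "integrable M (\<lambda>\<omega>. (U \<omega>)\<^sup>2)" using U sub by (intro noise_span_integrable_square) auto
    show "integrable M (\<lambda>\<omega>. X \<omega> * (U \<omega>)\<^sup>2)" by (rule indep_var_integrable[OF ind Xi U2])
    show "expectation (\<lambda>\<omega>. X \<omega> * (U \<omega>)\<^sup>2) = expectation X * expectation (\<lambda>\<omega>. (U \<omega>)\<^sup>2)"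
      by (rule indep_var_lebesgue_integral[OF ind Xi U2])
  qed
  note ind = indep_past_future[OF X V]
  have Vi: "integrable M V" "expectation V = 0"
    using V sub by (auto intro: noise_span_integrable noise_span_expectation)
  show "integrable M (\<lambda>\<omega>. X \<omega> * V \<omega>)" by (rule indep_var_integrable[OF ind Xi Vi(1)])
  show "expectation (\<lambda>\<omega>. X \<omega> * V \<omega>) = 0"
    using indep_var_lebesgue_integral[OF ind Xi Vi(1)] Vi(2) by simp
  define P where "P = (\<lambda>\<omega>. V \<omega> + V' \<omega>)"
  define Q where "Q = (\<lambda>\<omega>. V \<omega> + (-1) * V' \<omega>)"
  have PQ: "P \<in> noise_span (future a)" "Q \<in> noise_span (future a)"
    unfolding P_def Q_def by (intro noise_span_add noise_span_scale V V')+
  have pol: "V \<omega> * V' \<omega> = ((P \<omega>)\<^sup>2 - (Q \<omega>)\<^sup>2) / 4" for \<omega>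
    by (simp add: P_def Q_def power2_eq_square algebra_simps)
  have pol': "X \<omega> * (V \<omega> * V' \<omega>) = (X \<omega> * (P \<omega>)\<^sup>2 - X \<omega> * (Q \<omega>)\<^sup>2) / 4" for \<omega>
    unfolding pol by (simp add: algebra_simps)
  have i: "integrable M (\<lambda>\<omega>. (P \<omega>)\<^sup>2)" "integrable M (\<lambda>\<omega>. (Q \<omega>)\<^sup>2)"
    using PQ sub by (auto intro!: noise_span_integrable_square)
  show "integrable M (\<lambda>\<omega>. X \<omega> * (V \<omega> * V' \<omega>))"
    unfolding pol' using sq(1)[OF PQ(1)] sq(1)[OF PQ(2)] by auto
  show "expectation (\<lambda>\<omega>. X \<omega> * (V \<omega> * V' \<omega>)) = expectation X * expectation (\<lambda>\<omega>. V \<omega> * V' \<omega>)"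
    unfolding pol' unfolding pol using sq[OF PQ(1)] sq[OF PQ(2)] i by (simp add: algebra_simps)
qed

text \<open>One time step of a discrete stochastic integral: the coefficients \<open>Y i\<close> are
  known at time \<open>a\<close>, the noise comes later, and \<open>R\<close> stands for what was
  accumulated before. The sets \<open>C i\<close> may overlap, so the quadratic variation is a
  double sum over their intersections.\<close>

lemma martingale_increment:
  fixes Y :: "nat \<Rightarrow> 'o \<Rightarrow> real" and C :: "nat \<Rightarrow> (real \<times> 'a) set" and n :: nat
  assumes Y: "\<And>i. i < n \<Longrightarrow> Y i \<in> borel_measurable (noise_filtration M W a)"
    and bd: "\<And>i. i < n \<Longrightarrow> \<exists>c. \<forall>\<omega>\<in>space M. \<bar>Y i \<omega>\<bar> \<le> c"
    and C: "\<And>i. i < n \<Longrightarrow> C i \<in> future a"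
    and R: "R \<in> borel_measurable (noise_filtration M W a)" and R2: "integrable M (\<lambda>\<omega>. (R \<omega>)\<^sup>2)"
  defines "\<Delta> \<equiv> \<lambda>\<omega>. \<Sum>i<n. Y i \<omega> * W (C i) \<omega>"
  shows "integrable M (\<lambda>\<omega>. (\<Delta> \<omega>)\<^sup>2)"
    and "integrable M (\<lambda>\<omega>. R \<omega> * \<Delta> \<omega>)" and "expectation (\<lambda>\<omega>. R \<omega> * \<Delta> \<omega>) = 0"
    and "expectation (\<lambda>\<omega>. (\<Delta> \<omega>)\<^sup>2) =
      expectation (\<lambda>\<omega>. \<Sum>i<n. \<Sum>k<n. Y i \<omega> * Y k \<omega> * measure lborel (C i \<inter> C k))"
proof -
  have Ri: "integrable M R"
    by (rule integrable_square_imp_integrable[OF noise_filtration_measurable_imp[OF R] R2])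
  have WC: "W (C i) \<in> noise_span (future a)" if "i < n" for i
    using C[OF that] by (rule W_in_noise_span)
  have Cn: "C i \<in> noise_sets" if "i < n" for i using C[OF that] by auto
  have Ym: "Y i \<in> borel_measurable M" if "i < n" for i
    by (rule noise_filtration_measurable_imp[OF Y[OF that]])
  have YY: "integrable M (\<lambda>\<omega>. Y i \<omega> * Y k \<omega>)" if ik: "i < n" "k < n" for i k
  proof -
    obtain c d where cd: "\<forall>\<omega>\<in>space M. \<bar>Y i \<omega>\<bar> \<le> c" "\<forall>\<omega>\<in>space M. \<bar>Y k \<omega>\<bar> \<le> d"
      using bd[OF ik(1)] bd[OF ik(2)] by blast
    show ?thesis
    proof (rule integrable_const_bound[where B="c * d"])
      show "AE \<omega> in M. norm (Y i \<omega> * Y k \<omega>) \<le> c * d"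
      proof (rule AE_I2)
        fix \<omega> assume "\<omega> \<in> space M"
        then have "\<bar>Y i \<omega>\<bar> \<le> c" "\<bar>Y k \<omega>\<bar> \<le> d" using cd by auto
        then show "norm (Y i \<omega> * Y k \<omega>) \<le> c * d"
          unfolding real_norm_def abs_mult by (intro mult_mono) auto
      qed
    qed (use Ym ik in measurable)
  qed
  have RY: "integrable M (\<lambda>\<omega>. R \<omega> * Y i \<omega>)" if i: "i < n" for i
  proof -
    obtain c where c: "\<forall>\<omega>\<in>space M. \<bar>Y i \<omega>\<bar> \<le> c" using bd[OF i] by blast
    show ?thesis
    proof (rule Bochner_Integration.integrable_bound[OF integrable_mult_right[OF Ri, of c]])
      show "AE \<omega> in M. norm (R \<omega> * Y i \<omega>) \<le> norm (c * R \<omega>)"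
      proof (rule AE_I2)
        fix \<omega> assume "\<omega> \<in> space M"
        then have "\<bar>Y i \<omega>\<bar> \<le> \<bar>c\<bar>" using c by fastforce
        then show "norm (R \<omega> * Y i \<omega>) \<le> norm (c * R \<omega>)"
          unfolding real_norm_def abs_mult by (subst mult.commute) (intro mult_right_mono, auto)
      qed
    qed (use Ym i noise_filtration_measurable_imp[OF R] in measurable)
  qed
  have YYm: "(\<lambda>\<omega>. Y i \<omega> * Y k \<omega>) \<in> borel_measurable (noise_filtration M W a)" if "i < n" "k < n" for i k
    using Y that by (intro borel_measurable_times) auto
  have RYm: "(\<lambda>\<omega>. R \<omega> * Y i \<omega>) \<in> borel_measurable (noise_filtration M W a)" if "i < n" for i
    using Y R that by (intro borel_measurable_times) auto
  have sq: "(\<Delta> \<omega>)\<^sup>2 = (\<Sum>i<n. \<Sum>k<n. (Y i \<omega> * Y k \<omega>) * (W (C i) \<omega> * W (C k) \<omega>))" for \<omega>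
    by (simp add: \<Delta>_def power2_eq_square sum_product mult_ac)
  have R\<Delta>: "R \<omega> * \<Delta> \<omega> = (\<Sum>i<n. (R \<omega> * Y i \<omega>) * W (C i) \<omega>)" for \<omega>
    by (simp add: \<Delta>_def sum_distrib_left mult_ac)
  note ip = integrable_mult_past_future
  show "integrable M (\<lambda>\<omega>. (\<Delta> \<omega>)\<^sup>2)"
    unfolding sq by (intro Bochner_Integration.integrable_sum ip(3)[OF YYm YY]) (auto intro!: WC)
  show "integrable M (\<lambda>\<omega>. R \<omega> * \<Delta> \<omega>)"
    unfolding R\<Delta> by (intro Bochner_Integration.integrable_sum ip(1)[OF RYm RY]) (auto intro!: WC)
  have "expectation (\<lambda>\<omega>. R \<omega> * \<Delta> \<omega>) = (\<Sum>i<n. expectation (\<lambda>\<omega>. (R \<omega> * Y i \<omega>) * W (C i) \<omega>))"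
    unfolding R\<Delta> by (intro Bochner_Integration.integral_sum ip(1)[OF RYm RY]) (auto intro!: WC)
  also have "\<dots> = 0"
    by (intro sum.neutral ballI ip(2)[OF RYm RY]) (auto intro!: WC)
  finally show "expectation (\<lambda>\<omega>. R \<omega> * \<Delta> \<omega>) = 0" .
  have "expectation (\<lambda>\<omega>. (\<Delta> \<omega>)\<^sup>2) =
      (\<Sum>i<n. expectation (\<lambda>\<omega>. \<Sum>k<n. (Y i \<omega> * Y k \<omega>) * (W (C i) \<omega> * W (C k) \<omega>)))"
    unfolding sq by (intro Bochner_Integration.integral_sum Bochner_Integration.integrable_sum ip(3)[OF YYm YY])
      (auto intro!: WC)
  also have "\<dots> = (\<Sum>i<n. \<Sum>k<n. expectation (\<lambda>\<omega>. (Y i \<omega> * Y k \<omega>) * (W (C i) \<omega> * W (C k) \<omega>)))"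
    by (intro sum.cong refl Bochner_Integration.integral_sum ip(3)[OF YYm YY]) (auto intro!: WC)
  also have "\<dots> = (\<Sum>i<n. \<Sum>k<n. expectation (\<lambda>\<omega>. Y i \<omega> * Y k \<omega>) * measure lborel (C i \<inter> C k))"
  proof (intro sum.cong refl)
    fix i k assume "i \<in> {..<n}" "k \<in> {..<n}"
    then have ik: "i < n" "k < n" by auto
    show "expectation (\<lambda>\<omega>. (Y i \<omega> * Y k \<omega>) * (W (C i) \<omega> * W (C k) \<omega>)) =
        expectation (\<lambda>\<omega>. Y i \<omega> * Y k \<omega>) * measure lborel (C i \<inter> C k)"
      using ip(4)[OF YYm YY WC WC, OF ik ik ik] covariance_W[OF Cn Cn, OF ik] by simp
  qed
  also have "\<dots> = (\<Sum>i<n. expectation (\<lambda>\<omega>. \<Sum>k<n. Y i \<omega> * Y k \<omega> * measure lborel (C i \<inter> C k)))"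
    by (intro sum.cong refl) (subst Bochner_Integration.integral_sum, auto intro!: YY)
  also have "\<dots> = expectation (\<lambda>\<omega>. \<Sum>i<n. \<Sum>k<n. Y i \<omega> * Y k \<omega> * measure lborel (C i \<inter> C k))"
    by (subst Bochner_Integration.integral_sum) (auto intro!: YY Bochner_Integration.integrable_sum integrable_mult_left)
  finally show "expectation (\<lambda>\<omega>. (\<Delta> \<omega>)\<^sup>2) =
      expectation (\<lambda>\<omega>. \<Sum>i<n. \<Sum>k<n. Y i \<omega> * Y k \<omega> * measure lborel (C i \<inter> C k))" .
qed

text \<open>Each increment is centered and orthogonal to the sum of the preceding ones, so second
  moments add up over the time steps; \<open>q j\<close> is the quadratic variation contributed by
  step j.\<close>

lemma martingale_transform:
  fixes Y :: "nat \<Rightarrow> nat \<Rightarrow> 'o \<Rightarrow> real" and C :: "nat \<Rightarrow> nat \<Rightarrow> (real \<times> 'a) set"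
    and t :: "nat \<Rightarrow> real" and n m :: nat
  assumes "\<And>j. j < m \<Longrightarrow> t j \<le> t (Suc j)"
    and "\<And>i j. j < m \<Longrightarrow> i < n \<Longrightarrow> Y i j \<in> borel_measurable (noise_filtration M W (t j))"
    and "\<And>i j. j < m \<Longrightarrow> i < n \<Longrightarrow> \<exists>c. \<forall>\<omega>\<in>space M. \<bar>Y i j \<omega>\<bar> \<le> c"
    and "\<And>i j. j < m \<Longrightarrow> i < n \<Longrightarrow> C i j \<in> noise_sets"
    and "\<And>i j. j < m \<Longrightarrow> i < n \<Longrightarrow> C i j \<subseteq> {t j<..t (Suc j)} \<times> UNIV"
  defines "N \<equiv> \<lambda>m \<omega>. \<Sum>j<m. \<Sum>i<n. Y i j \<omega> * W (C i j) \<omega>"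
    and "q \<equiv> \<lambda>j \<omega>. \<Sum>i<n. \<Sum>k<n. Y i j \<omega> * Y k j \<omega> * measure lborel (C i j \<inter> C k j)"
  shows "N m \<in> borel_measurable (noise_filtration M W (t m))"
    and "integrable M (\<lambda>\<omega>. (N m \<omega>)\<^sup>2)" and "expectation (N m) = 0"
    and "expectation (\<lambda>\<omega>. (N m \<omega>)\<^sup>2) = (\<Sum>j<m. expectation (q j))"
proof -
  have "N m \<in> borel_measurable (noise_filtration M W (t m)) \<and> integrable M (\<lambda>\<omega>. (N m \<omega>)\<^sup>2) \<and>
    expectation (N m) = 0 \<and> expectation (\<lambda>\<omega>. (N m \<omega>)\<^sup>2) = (\<Sum>j<m. expectation (q j))"
    using assms(1-5)
  proof (induction m)
    case 0
    then show ?case by (simp add: N_def)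
  next
    case (Suc m)
    have IH: "N m \<in> borel_measurable (noise_filtration M W (t m))" "integrable M (\<lambda>\<omega>. (N m \<omega>)\<^sup>2)"
      "expectation (N m) = 0" "expectation (\<lambda>\<omega>. (N m \<omega>)\<^sup>2) = (\<Sum>j<m. expectation (q j))"
      using Suc.IH Suc.prems by auto
    define \<Delta> where "\<Delta> = (\<lambda>\<omega>. \<Sum>i<n. Y i m \<omega> * W (C i m) \<omega>)"
    have NS: "N (Suc m) \<omega> = N m \<omega> + \<Delta> \<omega>" for \<omega> by (simp add: N_def \<Delta>_def)
    have tm: "t m \<le> t (Suc m)" using Suc.prems(1) by simp
    have Cf: "C i m \<in> future (t m)" if "i < n" for i
      using Suc.prems(4)[of m i] Suc.prems(5)[of m i] that by fastforce
    have Cp: "C i m \<in> past (t (Suc m))" if i: "i < n" for i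
    proof -
      have "C i m \<subseteq> {0..} \<times> UNIV" using Suc.prems(4)[of m i] i by (auto simp: noise_sets_def)
      then show ?thesis using Suc.prems(4)[of m i] Suc.prems(5)[of m i] i by fastforce
    qed
    note inc = martingale_increment[of n "\<lambda>i. Y i m" "t m" "\<lambda>i. C i m",
        OF Suc.prems(2) Suc.prems(3) Cf, simplified]
    note incN = inc[OF IH(1,2)]
    have D2: "integrable M (\<lambda>\<omega>. (\<Delta> \<omega>)\<^sup>2)" and ND: "integrable M (\<lambda>\<omega>. N m \<omega> * \<Delta> \<omega>)"
      and ND0: "expectation (\<lambda>\<omega>. N m \<omega> * \<Delta> \<omega>) = 0"
      and Dq: "expectation (\<lambda>\<omega>. (\<Delta> \<omega>)\<^sup>2) = expectation (q m)"
      using incN by (auto simp: q_def \<Delta>_def)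
    \<comment> \<open>The constant 1 in place of the accumulated sum turns orthogonality into mean
      zero.\<close>
    have D0: "integrable M \<Delta>" "expectation \<Delta> = 0"
      using inc(2,3)[of "\<lambda>_. 1"] by (auto simp: \<Delta>_def)
    have Nm: "integrable M (N m)"
      by (rule integrable_square_imp_integrable[OF noise_filtration_measurable_imp[OF IH(1)] IH(2)])
    have "\<Delta> \<in> borel_measurable (noise_filtration M W (t (Suc m)))"
      unfolding \<Delta>_def
      by (intro borel_measurable_sum borel_measurable_times W_measurable_noise_filtration
          noise_filtration_mono[OF Suc.prems(2) tm]) (use Cp in auto)
    then have meas: "N (Suc m) \<in> borel_measurable (noise_filtration M W (t (Suc m)))"
      using noise_filtration_mono[OF IH(1) tm] unfolding NS[abs_def] by (intro borel_measurable_add)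
    have sq: "(N (Suc m) \<omega>)\<^sup>2 = (N m \<omega>)\<^sup>2 + (\<Delta> \<omega>)\<^sup>2 + 2 * (N m \<omega> * \<Delta> \<omega>)" for \<omega>
      by (simp add: NS power2_sum)
    have "expectation (N (Suc m)) = 0" using Nm D0 IH(3) by (simp add: NS[abs_def])
    moreover have "integrable M (\<lambda>\<omega>. (N (Suc m) \<omega>)\<^sup>2)" unfolding sq using IH(2) D2 ND by auto
    moreover have "expectation (\<lambda>\<omega>. (N (Suc m) \<omega>)\<^sup>2) = (\<Sum>j<Suc m. expectation (q j))"
      unfolding sq using IH(2,4) D2 ND ND0 Dq by simp
    ultimately show ?case using meas by simp
  qed
  then show "N m \<in> borel_measurable (noise_filtration M W (t m))"
    and "integrable M (\<lambda>\<omega>. (N m \<omega>)\<^sup>2)" and "expectation (N m) = 0"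
    and "expectation (\<lambda>\<omega>. (N m \<omega>)\<^sup>2) = (\<Sum>j<m. expectation (q j))" by auto
qed

end

text \<open>Bounds the quadratic variation of a stopped integral. The test for term j counts this
  term itself, so a term that would overshoot \<open>K\<close> is dropped entirely; as soon as the
  partial sum passes K, later terms contribute nothing.\<close>

lemma sum_truncated_le:
  fixes q :: "nat \<Rightarrow> real"
  assumes "\<And>j. 0 \<le> q j" "0 \<le> K"
  shows "(\<Sum>j<m. if (\<Sum>r\<le>j. q r) \<le> K then q j else 0) \<le> K"
proof (induction m)
  case 0
  then show ?case using assms by simp
next
  case (Suc m)
  show ?case
  proof (cases "(\<Sum>r\<le>m. q r) \<le> K")
    case True
    have "(\<Sum>j<Suc m. if (\<Sum>r\<le>j. q r) \<le> K then q j else 0) \<le> (\<Sum>j<Suc m. q j)"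
      using assms by (intro sum_mono) auto
    also have "\<dots> = (\<Sum>r\<le>m. q r)" by (simp add: lessThan_Suc_atMost)
    finally show ?thesis using True by simp
  next
    case False
    then show ?thesis using Suc by simp
  qed
qed

section \<open>Additivity of the noise and stopped elementary integrals\<close>

context noise_space
begin

lemma noise_sets_emeasure: "A \<in> noise_sets \<Longrightarrow> A \<in> sets lborel \<and> emeasure lborel A \<noteq> \<infinity>"
  by (auto simp: noise_sets_def)

lemma W_empty: "AE \<omega> in M. W {} \<omega> = 0"
proof -
  have e: "{} \<in> noise_sets" by (simp add: noise_sets_def)
  have "expectation (\<lambda>\<omega>. (W {} \<omega>)\<^sup>2) = 0" using covariance_W[OF e e] by (simp add: power2_eq_square)
  then have "AE \<omega> in M. (W {} \<omega>)\<^sup>2 = 0"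
    using integral_nonneg_eq_0_iff_AE[OF integrable_W_square[OF e]] by simp
  then show ?thesis by simp
qed

text \<open>The white noise axioms prescribe only laws and covariances. Expanding the square shows
  that the second moment of the defect is |A \<union> B| - |A| - |B|, which is 0 for disjoint
  sets.\<close>

lemma W_Un:
  assumes A: "A \<in> noise_sets" and B: "B \<in> noise_sets" and "A \<inter> B = {}"
  shows "AE \<omega> in M. W (A \<union> B) \<omega> = W A \<omega> + W B \<omega>"
proof -
  have e: "emeasure lborel A \<noteq> \<infinity>" "emeasure lborel B \<noteq> \<infinity>" "A \<in> sets lborel" "B \<in> sets lborel"
    using A B noise_sets_emeasure by auto
  have m: "measure lborel (A \<union> B) = measure lborel A + measure lborel B"
    by (rule measure_Union) (use e assms in auto)
  have "emeasure lborel (A \<union> B) = emeasure lborel A + emeasure lborel B"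
    by (rule plus_emeasure[symmetric]) (use e assms in auto)
  then have C: "A \<union> B \<in> noise_sets" using A B by (auto simp: noise_sets_def)
  have sq: "(W (A \<union> B) \<omega> - W A \<omega> - W B \<omega>)\<^sup>2 =
      W (A \<union> B) \<omega> * W (A \<union> B) \<omega> + W A \<omega> * W A \<omega> + W B \<omega> * W B \<omega>
      - 2 * (W (A \<union> B) \<omega> * W A \<omega>) - 2 * (W (A \<union> B) \<omega> * W B \<omega>) + 2 * (W A \<omega> * W B \<omega>)" for \<omega>
    by (simp add: power2_eq_square algebra_simps)
  have s: "(A \<union> B) \<inter> A = A" "(A \<union> B) \<inter> B = B" by auto
  note i = integrable_W_mult[OF A A] integrable_W_mult[OF A B] integrable_W_mult[OF B B]
    integrable_W_mult[OF C A] integrable_W_mult[OF C B] integrable_W_mult[OF C C]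
  note c = covariance_W[OF A A] covariance_W[OF A B] covariance_W[OF B B]
    covariance_W[OF C A] covariance_W[OF C B] covariance_W[OF C C]
  have "expectation (\<lambda>\<omega>. (W (A \<union> B) \<omega> - W A \<omega> - W B \<omega>)\<^sup>2) = 0"
    unfolding sq using i c assms(3) m by (simp add: s)
  moreover have si: "integrable M (\<lambda>\<omega>. (W (A \<union> B) \<omega> - W A \<omega> - W B \<omega>)\<^sup>2)"
    unfolding sq using i by simp
  ultimately have "AE \<omega> in M. (W (A \<union> B) \<omega> - W A \<omega> - W B \<omega>)\<^sup>2 = 0"
    using integral_nonneg_eq_0_iff_AE[OF si] by simp
  then show ?thesis by eventually_elim simp
qed

lemma slab_noise_set:
  fixes A :: "'a set"
  assumes "0 \<le> a" "A \<in> sets borel" "emeasure lborel A < \<infinity>"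
  shows "{a<..b} \<times> A \<in> noise_sets"
proof -
  have "{a<..b} \<times> A \<in> sets (borel \<Otimes>\<^sub>M borel)" using assms by simp
  then have s: "{a<..b} \<times> A \<in> sets borel" by (simp only: borel_prod)
  have "emeasure lborel ({a<..b} \<times> A) = emeasure lborel {a<..b} * emeasure lborel A"
    using assms lborel.emeasure_pair_measure_Times[of "{a<..b}" "lborel :: real measure" A] by (simp add: lborel_prod)
  also have "\<dots> < \<infinity>"
    using assms by (cases "a \<le> b") (auto simp: ennreal_mult_less_top)
  finally show ?thesis using s assms by (auto simp: noise_sets_def)
qed

text \<open>Allows all slabs of an elementary process to be cut along one common time grid. Each cut
  costs a null set, because additivity of \<open>W\<close> holds only almost surely.\<close>

lemma W_slab_chain:
  fixes A :: "'a set" and t :: "nat \<Rightarrow> real"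
  assumes "k \<le> l" and mono: "\<And>i j. k \<le> i \<Longrightarrow> i \<le> j \<Longrightarrow> j \<le> l \<Longrightarrow> t i \<le> t j" and "0 \<le> t k"
    and A: "A \<in> sets borel" "emeasure lborel A < \<infinity>"
  shows "AE \<omega> in M. W ({t k<..t l} \<times> A) \<omega> = (\<Sum>j=k..<l. W ({t j<..t (Suc j)} \<times> A) \<omega>)"
  using assms(1,2)
proof (induction l rule: dec_induct)
  case base
  then show ?case using W_empty by simp
next
  case (step l)
  have l: "t k \<le> t l" "t l \<le> t (Suc l)" using step.prems step.hyps by auto
  have IH: "AE \<omega> in M. W ({t k<..t l} \<times> A) \<omega> = (\<Sum>j=k..<l. W ({t j<..t (Suc j)} \<times> A) \<omega>)"
    using step.prems by (intro step.IH) auto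
  have u: "{t k<..t (Suc l)} \<times> A = {t k<..t l} \<times> A \<union> {t l<..t (Suc l)} \<times> A" using l by auto
  have "AE \<omega> in M. W ({t k<..t (Suc l)} \<times> A) \<omega> = W ({t k<..t l} \<times> A) \<omega> + W ({t l<..t (Suc l)} \<times> A) \<omega>"
    unfolding u using l assms(3) A by (intro W_Un slab_noise_set) auto
  with IH show ?case by eventually_elim (use step.hyps in simp)
qed

lemma indicator_slab_chain:
  fixes A :: "'a set" and t :: "nat \<Rightarrow> real"
  assumes "k \<le> l" and mono: "\<And>i j. k \<le> i \<Longrightarrow> i \<le> j \<Longrightarrow> j \<le> l \<Longrightarrow> t i \<le> t j"
  shows "indicator ({t k<..t l} \<times> A) z = (\<Sum>j=k..<l. indicator ({t j<..t (Suc j)} \<times> A) z :: real)"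
  using assms(1,2)
proof (induction l rule: dec_induct)
  case base
  then show ?case by simp
next
  case (step l)
  have l: "t k \<le> t l" "t l \<le> t (Suc l)" using step.prems step.hyps by auto
  have IH: "indicator ({t k<..t l} \<times> A) z = (\<Sum>j=k..<l. indicator ({t j<..t (Suc j)} \<times> A) z :: real)"
    using step.prems by (intro step.IH) auto
  have "indicator ({t k<..t (Suc l)} \<times> A) z =
      (indicator ({t k<..t l} \<times> A) z + indicator ({t l<..t (Suc l)} \<times> A) z :: real)"
    using l by (cases z) (auto simp: indicator_def)
  with IH show ?case using step.hyps by simp
qed

text \<open>Stopping just before the quadratic variation exceeds \<open>K\<close> is possible because the next
  increment \<open>q j\<close> of the quadratic variation is already known at time \<open>t j\<close>.\<close>

lemma elementary_truncation:
  assumes es: "elementary M W es" and K: "0 \<le> K"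
  obtains N where "N \<in> borel_measurable M" "integrable M (\<lambda>\<omega>. (N \<omega>)\<^sup>2)" "expectation N = 0"
    "expectation (\<lambda>\<omega>. (N \<omega>)\<^sup>2) \<le> K"
    "AE \<omega> in M. (\<integral>\<^sup>+z. ennreal ((elementary_process es z \<omega>)\<^sup>2) \<partial>lborel) \<le> ennreal K \<longrightarrow>
       N \<omega> = elementary_integral W es \<omega>"
proof -
  define n where "n = length es"
  define a where "a i = fst (es ! i)" for i
  define b where "b i = fst (snd (es ! i))" for i
  define A where "A i = fst (snd (snd (es ! i)))" for i
  define X where "X i = snd (snd (snd (es ! i)))" for i
  have ab: "0 \<le> a i" "a i \<le> b i" "A i \<in> sets borel" "emeasure lborel (A i) < \<infinity>"
      "X i \<in> borel_measurable (noise_filtration M W (a i))" "\<exists>C. \<forall>\<omega>\<in>space M. \<bar>X i \<omega>\<bar> \<le> C"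
    if "i < n" for i
  proof -
    have mem: "(a i, b i, A i, X i) \<in> set es" using that by (simp add: n_def a_def b_def A_def X_def)
    show "0 \<le> a i" "a i \<le> b i" "A i \<in> sets borel" "emeasure lborel (A i) < \<infinity>"
      "X i \<in> borel_measurable (noise_filtration M W (a i))" "\<exists>C. \<forall>\<omega>\<in>space M. \<bar>X i \<omega>\<bar> \<le> C"
      using bspec[OF es[unfolded elementary_def] mem] by auto
  qed
  have I_sum: "elementary_integral W es \<omega> = (\<Sum>i<n. X i \<omega> * W ({a i<..b i} \<times> A i) \<omega>)" for \<omega>
    unfolding elementary_integral_def
    by (simp add: sum_list_sum_nth n_def a_def b_def A_def X_def atLeast0LessThan split_beta)
  have P_sum: "elementary_process es z \<omega> = (\<Sum>i<n. X i \<omega> * indicator ({a i<..b i} \<times> A i) z)" for z \<omega>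
    unfolding elementary_process_def
    by (simp add: sum_list_sum_nth n_def a_def b_def A_def X_def atLeast0LessThan split_beta)

  \<comment> \<open>All end points together form the grid: each slab of the process is then a union
    of consecutive grid steps, and the integral becomes a discrete martingale transform.\<close>
  define P where "P = a ` {..<n} \<union> b ` {..<n}"
  have finP: "finite P" by (simp add: P_def)
  define ts where "ts = sorted_list_of_set P"
  define t where "t j = ts ! j" for j
  \<comment> \<open>The number of grid steps. For an empty process truncated subtraction gives 0,
    and all sums over steps are empty.\<close>
  define m where "m = length ts - 1"
  have ts: "sorted ts" "distinct ts" "set ts = P"
    using finP by (simp_all add: ts_def)
  have tmono: "t i \<le> t j" if "i \<le> j" "j < length ts" for i j
    using sorted_nth_mono[OF ts(1) that] by (simp add: t_def)
  have tstrict: "t i < t j" if "i < j" "j < length ts" for i j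
    using tmono[of i j] that nth_eq_iff_index_eq[OF ts(2), of i j] by (simp add: t_def less_le)
  have t_iff: "t i \<le> t j \<longleftrightarrow> i \<le> j" if "i < length ts" "j < length ts" for i j
    using tmono[of i j] tstrict[of j i] that by (cases "i \<le> j") auto
  have tpos: "0 \<le> t j" if "j < length ts" for j
  proof -
    have "t j \<in> P" using that ts(3) by (auto simp: t_def)
    then show ?thesis using ab(1,2) by (fastforce simp: P_def)
  qed
  have "\<exists>k l. k < length ts \<and> l < length ts \<and> a i = t k \<and> b i = t l" if "i < n" for i
  proof -
    have "a i \<in> set ts" "b i \<in> set ts" using that ts(3) by (auto simp: P_def)
    then show ?thesis unfolding in_set_conv_nth t_def by metis
  qed
  then obtain ka kb where kab: "\<And>i. i < n \<Longrightarrow> ka i < length ts \<and> kb i < length ts \<and> a i = t (ka i) \<and> b i = t (kb i)"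
    by metis
  have kle: "ka i \<le> kb i" if "i < n" for i
    using ab(2)[OF that] kab[OF that] t_iff by auto
  have kbm: "kb i \<le> m" if "i < n" for i using kab[OF that] unfolding m_def by arith
  \<comment> \<open>The grid step from \<open>t j\<close> to \<open>t (Suc j)\<close> belongs to the
    interval of entry i. In this case a i \<le> t j, so the coefficient \<open>X i\<close> is known
    when the step begins.\<close>
  define act where "act i j \<longleftrightarrow> ka i \<le> j \<and> j < kb i" for i j
  have act_sum: "(\<Sum>j=ka i..<kb i. f j) = (\<Sum>j<m. if act i j then f j else 0)" if "i < n" for i and f :: "nat \<Rightarrow> real"
    using kbm[OF that] by (intro sum.mono_neutral_cong_left) (auto simp: act_def)

  define C where "C i j = {t j<..t (Suc j)} \<times> A i" for i j
  define Y where "Y i j \<omega> = (if act i j then X i \<omega> else 0)" for i j \<omega>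
  define q where "q j \<omega> = (\<Sum>i<n. \<Sum>k<n. Y i j \<omega> * Y k j \<omega> * measure lborel (C i j \<inter> C k j))" for j \<omega>
  \<comment> \<open>The restriction of the process to grid step j. Different steps have disjoint
    support in time, so the energy of the process is the sum of the energies \<open>q j\<close> of
    these pieces.\<close>
  define g where "g j z \<omega> = (\<Sum>i<n. Y i j \<omega> * indicator (C i j) z)" for j z \<omega>
  have Cn: "C i j \<in> noise_sets" if "j < m" "i < n" for i j
    unfolding C_def using that ab(3,4)[of i] tpos[of j] by (intro slab_noise_set) (auto simp: m_def)
  have Ym: "Y i j \<in> borel_measurable (noise_filtration M W (t j))" if "j < m" "i < n" for i j
  proof (cases "act i j")
    case True
    then have "a i \<le> t j" using that kab[of i] tmono[of "ka i" j] by (simp add: act_def m_def)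
    then show ?thesis using True noise_filtration_mono[OF ab(5)] that by (simp add: Y_def[abs_def])
  qed (simp add: Y_def[abs_def])
  have Yb: "\<exists>c. \<forall>\<omega>\<in>space M. \<bar>Y i j \<omega>\<bar> \<le> c" if "i < n" for i j
    using ab(6)[OF that] by (cases "act i j") (auto simp: Y_def intro: exI[of _ 0])
  have P_g: "elementary_process es z \<omega> = (\<Sum>j<m. g j z \<omega>)" for z \<omega>
  proof -
    have "elementary_process es z \<omega> = (\<Sum>i<n. \<Sum>j<m. Y i j \<omega> * indicator (C i j) z)"
      unfolding P_sum
    proof (intro sum.cong refl)
      fix i assume "i \<in> {..<n}"
      then have i: "i < n" by simp
      have "indicator ({a i<..b i} \<times> A i) z = (\<Sum>j=ka i..<kb i. indicator (C i j) z :: real)"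
        using kab[OF i] kle[OF i] tmono unfolding C_def
        by (simp only:) (rule indicator_slab_chain, auto)
      also have "\<dots> = (\<Sum>j<m. if act i j then indicator (C i j) z else 0)" by (rule act_sum[OF i])
      finally show "X i \<omega> * indicator ({a i<..b i} \<times> A i) z = (\<Sum>j<m. Y i j \<omega> * indicator (C i j) z)"
        by (simp only: sum_distrib_left) (intro sum.cong refl, simp add: Y_def)
    qed
    also have "\<dots> = (\<Sum>j<m. g j z \<omega>)" unfolding g_def by (rule sum.swap)
    finally show ?thesis .
  qed
  have g0: "g j z \<omega> = 0" if "fst z \<notin> {t j<..t (Suc j)}" for j z \<omega>
    unfolding g_def using that by (intro sum.neutral) (auto simp: C_def indicator_def)
  have g_orth: "g j z \<omega> * g k z \<omega> = 0" if "j < m" "k < m" "j \<noteq> k" for j k z \<omega>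
  proof -
    have "t (Suc j) \<le> t k \<or> t (Suc k) \<le> t j"
      using that by (cases "j < k") (auto intro!: tmono simp: m_def)
    then have "fst z \<notin> {t j<..t (Suc j)} \<or> fst z \<notin> {t k<..t (Suc k)}" by auto
    then have "g j z \<omega> = 0 \<or> g k z \<omega> = 0" using g0[of z j \<omega>] g0[of z k \<omega>] by blast
    then show ?thesis by auto
  qed
  have P2: "(elementary_process es z \<omega>)\<^sup>2 = (\<Sum>j<m. (g j z \<omega>)\<^sup>2)" for z \<omega>
  proof -
    have "(elementary_process es z \<omega>)\<^sup>2 = (\<Sum>j<m. \<Sum>k<m. g j z \<omega> * g k z \<omega>)"
      by (simp add: P_g power2_eq_square sum_product)
    also have "\<dots> = (\<Sum>j<m. \<Sum>k<m. if k = j then (g j z \<omega>)\<^sup>2 else 0)"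
      using g_orth by (intro sum.cong refl) (auto simp: power2_eq_square)
    also have "\<dots> = (\<Sum>j<m. (g j z \<omega>)\<^sup>2)" by simp
    finally show ?thesis .
  qed
  have g2: "integrable lborel (\<lambda>z. (g j z \<omega>)\<^sup>2)" "(LINT z|lborel. (g j z \<omega>)\<^sup>2) = q j \<omega>" if "j < m" for j \<omega>
  proof -
    have sq: "(g j z \<omega>)\<^sup>2 = (\<Sum>i<n. \<Sum>k<n. Y i j \<omega> * Y k j \<omega> * indicator (C i j \<inter> C k j) z)" for z
      unfolding g_def power2_eq_square sum_product
      by (intro sum.cong refl) (simp only: indicator_inter_arith mult_ac)
    have ii: "integrable lborel (indicator (C i j \<inter> C k j) :: _ \<Rightarrow> real)" if "i < n" "k < n" for i k
    proof -
      have "C i j \<in> sets lborel" "C k j \<in> sets lborel" "emeasure lborel (C i j) \<noteq> \<infinity>"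
        using Cn[OF \<open>j < m\<close>] that noise_sets_emeasure by blast+
      moreover have "emeasure lborel (C i j \<inter> C k j) \<le> emeasure lborel (C i j)"
        by (rule emeasure_mono) (use calculation in auto)
      ultimately show ?thesis
        by (intro integrable_real_indicator) (auto simp: top.not_eq_extremum le_less_trans)
    qed
    show "integrable lborel (\<lambda>z. (g j z \<omega>)\<^sup>2)"
      unfolding sq by (intro Bochner_Integration.integrable_sum integrable_mult_right ii) auto
    have "(LINT z|lborel. (g j z \<omega>)\<^sup>2) =
        (\<Sum>i<n. (LINT z|lborel. (\<Sum>k<n. Y i j \<omega> * Y k j \<omega> * indicator (C i j \<inter> C k j) z)))"
      unfolding sq
      by (intro Bochner_Integration.integral_sum Bochner_Integration.integrable_sum integrable_mult_right ii) auto
    also have "\<dots> = (\<Sum>i<n. \<Sum>k<n. (LINT z|lborel. Y i j \<omega> * Y k j \<omega> * indicator (C i j \<inter> C k j) z))"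
      by (intro sum.cong refl Bochner_Integration.integral_sum integrable_mult_right ii) auto
    also have "\<dots> = q j \<omega>" by (simp add: q_def)
    finally show "(LINT z|lborel. (g j z \<omega>)\<^sup>2) = q j \<omega>" .
  qed
  have q0: "0 \<le> q j \<omega>" if "j < m" for j \<omega>
    unfolding g2(2)[OF that, symmetric] by (rule Bochner_Integration.integral_nonneg) simp
  have norm2: "(\<integral>\<^sup>+z. ennreal ((elementary_process es z \<omega>)\<^sup>2) \<partial>lborel) = ennreal (\<Sum>j<m. q j \<omega>)" for \<omega>
  proof -
    have "(\<integral>\<^sup>+z. ennreal (\<Sum>j<m. (g j z \<omega>)\<^sup>2) \<partial>lborel) = ennreal (LINT z|lborel. (\<Sum>j<m. (g j z \<omega>)\<^sup>2))"
      using g2 by (intro nn_integral_eq_integral Bochner_Integration.integrable_sum) (auto intro!: sum_nonneg)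
    also have "(LINT z|lborel. (\<Sum>j<m. (g j z \<omega>)\<^sup>2)) = (\<Sum>j<m. q j \<omega>)"
      using g2 by (subst Bochner_Integration.integral_sum) auto
    finally show ?thesis unfolding P2 .
  qed

  define \<rho> where "\<rho> j \<omega> = (if (\<Sum>r\<le>j. q r \<omega>) \<le> K then 1 else 0 :: real)" for j \<omega>
  define Y' where "Y' i j \<omega> = \<rho> j \<omega> * Y i j \<omega>" for i j \<omega>
  have qm: "q j \<in> borel_measurable (noise_filtration M W (t j))" if "j < m" for j
    unfolding q_def using Ym that by (intro borel_measurable_sum borel_measurable_times) auto
  have \<rho>m: "\<rho> j \<in> borel_measurable (noise_filtration M W (t j))" if j: "j < m" for j
  proof -
    have "(\<lambda>\<omega>. \<Sum>r\<le>j. q r \<omega>) \<in> borel_measurable (noise_filtration M W (t j))"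
      using j by (intro borel_measurable_sum noise_filtration_mono[OF qm] tmono) (auto simp: m_def)
    then show ?thesis unfolding \<rho>_def by measurable
  qed
  have Y'm: "Y' i j \<in> borel_measurable (noise_filtration M W (t j))" if "j < m" "i < n" for i j
    unfolding Y'_def using \<rho>m[OF that(1)] Ym[OF that] by (rule borel_measurable_times)
  have Y'b: "\<exists>c. \<forall>\<omega>\<in>space M. \<bar>Y' i j \<omega>\<bar> \<le> c" if i: "i < n" for i j
  proof -
    obtain c where c: "\<forall>\<omega>\<in>space M. \<bar>Y i j \<omega>\<bar> \<le> c" using Yb[OF i] by blast
    then have "\<forall>\<omega>\<in>space M. \<bar>Y' i j \<omega>\<bar> \<le> \<bar>c\<bar>" by (auto simp: Y'_def \<rho>_def intro: order_trans[OF _ abs_ge_self])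
    then show ?thesis by blast
  qed
  define N where "N \<omega> = (\<Sum>j<m. \<Sum>i<n. Y' i j \<omega> * W (C i j) \<omega>)" for \<omega>
  have tS: "t j \<le> t (Suc j)" if "j < m" for j using that by (intro tmono) (auto simp: m_def)
  have Csub: "C i j \<subseteq> {t j<..t (Suc j)} \<times> UNIV" for i j by (auto simp: C_def)
  note mt = martingale_transform[of m t n Y' C, OF tS Y'm Y'b Cn Csub]
  show ?thesis
  proof (rule that)
    show "N \<in> borel_measurable M" using mt(1) unfolding N_def[abs_def] by (intro noise_filtration_measurable_imp) auto
    show "integrable M (\<lambda>\<omega>. (N \<omega>)\<^sup>2)" using mt(2) unfolding N_def[abs_def] by auto
    show "expectation N = 0" using mt(3) unfolding N_def[abs_def] by auto
    have q'_eq: "(\<Sum>i<n. \<Sum>k<n. Y' i j \<omega> * Y' k j \<omega> * measure lborel (C i j \<inter> C k j)) =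
        (if (\<Sum>r\<le>j. q r \<omega>) \<le> K then q j \<omega> else 0)" for j \<omega>
      by (auto simp: q_def Y'_def \<rho>_def)
    have q'_i: "integrable M (\<lambda>\<omega>. if (\<Sum>r\<le>j. q r \<omega>) \<le> K then q j \<omega> else 0)" if j: "j < m" for j
    proof (rule integrable_const_bound[where B=K])
      show "AE \<omega> in M. norm (if (\<Sum>r\<le>j. q r \<omega>) \<le> K then q j \<omega> else 0) \<le> K"
      proof (rule AE_I2)
        fix \<omega>
        have "q j \<omega> \<le> (\<Sum>r\<le>j. q r \<omega>)" by (rule member_le_sum) (use q0 j in auto)
        then show "norm (if (\<Sum>r\<le>j. q r \<omega>) \<le> K then q j \<omega> else 0) \<le> K" using q0[OF j] K by auto
      qed
      have qM: "q r \<in> borel_measurable M" if "r \<le> j" for r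
        using that j by (intro noise_filtration_measurable_imp[OF qm]) auto
      then have [measurable]: "(\<lambda>\<omega>. \<Sum>r\<le>j. q r \<omega>) \<in> borel_measurable M" by (intro borel_measurable_sum) auto
      have [measurable]: "q j \<in> borel_measurable M" by (rule qM) simp
      show "(\<lambda>\<omega>. if (\<Sum>r\<le>j. q r \<omega>) \<le> K then q j \<omega> else 0) \<in> borel_measurable M" by measurable
    qed
    have "expectation (\<lambda>\<omega>. (N \<omega>)\<^sup>2) =
        (\<Sum>j<m. expectation (\<lambda>\<omega>. if (\<Sum>r\<le>j. q r \<omega>) \<le> K then q j \<omega> else 0))"
      using mt(4) unfolding N_def[abs_def] by (auto simp: q'_eq)
    also have "\<dots> = expectation (\<lambda>\<omega>. \<Sum>j<m. if (\<Sum>r\<le>j. q r \<omega>) \<le> K then q j \<omega> else 0)"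
      by (rule Bochner_Integration.integral_sum[symmetric]) (use q'_i in auto)
    also have "\<dots> \<le> expectation (\<lambda>\<omega>. K)"
    proof (intro integral_mono)
      fix \<omega>
      \<comment> \<open>Nonnegativity of \<open>q\<close> is available for grid steps only; the
        extension by 0 to all indices makes the truncation lemma applicable.\<close>
      have "(\<Sum>j<m. if (\<Sum>r\<le>j. q r \<omega>) \<le> K then q j \<omega> else 0) =
          (\<Sum>j<m. if (\<Sum>r\<le>j. if r < m then q r \<omega> else 0) \<le> K then (if j < m then q j \<omega> else 0) else 0)"
        by (intro sum.cong refl if_cong arg_cong2[where f="(\<le>)"]) auto
      also have "\<dots> \<le> K" by (rule sum_truncated_le) (use q0 K in auto)
      finally show "(\<Sum>j<m. if (\<Sum>r\<le>j. q r \<omega>) \<le> K then q j \<omega> else 0) \<le> K" .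
    qed (use q'_i in auto)
    also have "\<dots> = K" by (simp add: prob_space)
    finally show "expectation (\<lambda>\<omega>. (N \<omega>)\<^sup>2) \<le> K" .
    have "AE \<omega> in M. \<forall>i\<in>{..<n}. W ({a i<..b i} \<times> A i) \<omega> = (\<Sum>j=ka i..<kb i. W (C i j) \<omega>)"
    proof (rule AE_finite_allI)
      fix i assume "i \<in> {..<n}"
      then have i: "i < n" by simp
      show "AE \<omega> in M. W ({a i<..b i} \<times> A i) \<omega> = (\<Sum>j=ka i..<kb i. W (C i j) \<omega>)"
        using kab[OF i] kle[OF i] tmono tpos ab(3,4)[OF i] unfolding C_def
        by (simp only:) (rule W_slab_chain, auto)
    qed simp
    then show "AE \<omega> in M. (\<integral>\<^sup>+z. ennreal ((elementary_process es z \<omega>)\<^sup>2) \<partial>lborel) \<le> ennreal K \<longrightarrow>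
       N \<omega> = elementary_integral W es \<omega>"
    proof eventually_elim
      case (elim \<omega>)
      show ?case
      proof
        assume "(\<integral>\<^sup>+z. ennreal ((elementary_process es z \<omega>)\<^sup>2) \<partial>lborel) \<le> ennreal K"
        then have le: "(\<Sum>j<m. q j \<omega>) \<le> K" using K by (simp add: norm2)
        \<comment> \<open>If the total energy is at most \<open>K\<close>, so is every partial sum,
          and the stopping never acts.\<close>
        have \<rho>1: "\<rho> j \<omega> = 1" if "j < m" for j
        proof -
          have "(\<Sum>r\<le>j. q r \<omega>) \<le> (\<Sum>r<m. q r \<omega>)" using that q0 by (intro sum_mono2) auto
          then show ?thesis using le by (simp add: \<rho>_def)
        qed
        have "elementary_integral W es \<omega> = (\<Sum>i<n. \<Sum>j<m. Y i j \<omega> * W (C i j) \<omega>)"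
          unfolding I_sum
        proof (intro sum.cong refl)
          fix i assume i: "i \<in> {..<n}"
          then have "W ({a i<..b i} \<times> A i) \<omega> = (\<Sum>j<m. if act i j then W (C i j) \<omega> else 0)"
            using elim act_sum by simp
          then show "X i \<omega> * W ({a i<..b i} \<times> A i) \<omega> = (\<Sum>j<m. Y i j \<omega> * W (C i j) \<omega>)"
            by (simp only: sum_distrib_left) (intro sum.cong refl, simp add: Y_def)
        qed
        also have "\<dots> = (\<Sum>j<m. \<Sum>i<n. Y i j \<omega> * W (C i j) \<omega>)" by (rule sum.swap)
        also have "\<dots> = N \<omega>" unfolding N_def using \<rho>1 by (intro sum.cong refl) (simp add: Y'_def)
        finally show "N \<omega> = elementary_integral W es \<omega>" ..
      qed
    qed
  qed
qed

end

text \<open>Converts a second moment bound and a small probability into a bound for the first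
  moment. Beyond \<delta> the weighted inequality |x| \<le> \<theta> x^2 + 1 / (4 \<theta>) is used,
  and the constant 1 / (4 \<theta>) is paid on that event only.\<close>

lemma abs_le_weighted_square:
  fixes x \<delta> \<theta> :: real
  assumes "0 < \<delta>" "0 < \<theta>"
  shows "\<bar>x\<bar> \<le> \<delta> + \<theta> * x\<^sup>2 + indicator {y. \<bar>y\<bar> > \<delta>} x / (4 * \<theta>)"
proof -
  have "0 \<le> (2 * \<theta> * \<bar>x\<bar> - 1)\<^sup>2 / (4 * \<theta>)" using assms by simp
  also have "\<dots> = \<theta> * x\<^sup>2 + 1 / (4 * \<theta>) - \<bar>x\<bar>"
    using assms by (simp add: power2_eq_square field_simps)
  finally have 1: "\<bar>x\<bar> \<le> \<theta> * x\<^sup>2 + 1 / (4 * \<theta>)" by simp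
  have 0: "0 \<le> \<theta> * x\<^sup>2" using assms by simp
  show ?thesis
  proof (cases "\<bar>x\<bar> > \<delta>")
    case True
    then have "(indicator {y. \<bar>y\<bar> > \<delta>} x :: real) = 1" by simp
    then show ?thesis using 1 assms by simp
  next
    case False
    then have "(indicator {y. \<bar>y\<bar> > \<delta>} x :: real) = 0" by simp
    moreover have "\<bar>x\<bar> \<le> \<delta> + \<theta> * x\<^sup>2" using 0 False by linarith
    ultimately show ?thesis by simp
  qed
qed

section \<open>From elementary integrals to Walsh integrals\<close>

context noise_space
begin

lemma elementary_process_measurable:
  assumes "elementary M W es"
  shows "(\<lambda>(z, \<omega>). elementary_process es z \<omega>) \<in> borel_measurable (lborel \<Otimes>\<^sub>M M)"
  using assms
proof (induction es)
  case Nil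
  then show ?case by (simp add: elementary_process_def)
next
  case (Cons e es)
  obtain a b A X where e: "e = (a, b, A, X)" by (cases e)
  have "elementary M W es" and X: "X \<in> borel_measurable (noise_filtration M W a)" and A: "A \<in> sets borel"
    using Cons.prems by (auto simp: elementary_def e)
  then have [measurable]: "(\<lambda>(z, \<omega>). elementary_process es z \<omega>) \<in> borel_measurable (lborel \<Otimes>\<^sub>M M)"
    using Cons.IH by blast
  have [measurable]: "X \<in> borel_measurable M" by (rule noise_filtration_measurable_imp[OF X])
  have "{a<..b} \<times> A \<in> sets (borel \<Otimes>\<^sub>M borel)" using A by simp
  then have [measurable]: "{a<..b} \<times> A \<in> sets borel" by (simp only: borel_prod)
  have "(\<lambda>(z, \<omega>). elementary_process (e # es) z \<omega>) =
      (\<lambda>(z, \<omega>). X \<omega> * indicator ({a<..b} \<times> A) z + elementary_process es z \<omega>)"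
    by (simp add: elementary_process_def e)
  also have "\<dots> \<in> borel_measurable (lborel \<Otimes>\<^sub>M M)" by measurable
  finally show ?case .
qed

lemma elementary_integral_measurable:
  assumes "elementary M W es"
  shows "elementary_integral W es \<in> borel_measurable M"
  using assms
proof (induction es)
  case Nil
  then show ?case by (simp add: elementary_integral_def[abs_def])
next
  case (Cons e es)
  obtain a b A X where e: "e = (a, b, A, X)" by (cases e)
  have "elementary M W es" and X: "X \<in> borel_measurable (noise_filtration M W a)"
    and A: "A \<in> sets borel" "emeasure lborel A < \<infinity>" "0 \<le> a"
    using Cons.prems by (auto simp: elementary_def e)
  then have [measurable]: "elementary_integral W es \<in> borel_measurable M"
    using Cons.IH by blast
  have [measurable]: "X \<in> borel_measurable M" by (rule noise_filtration_measurable_imp[OF X])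
  have [measurable]: "W ({a<..b} \<times> A) \<in> borel_measurable M"
    using A by (intro measurable_W slab_noise_set)
  have "elementary_integral W (e # es) = (\<lambda>\<omega>. X \<omega> * W ({a<..b} \<times> A) \<omega> + elementary_integral W es \<omega>)"
    by (simp add: elementary_integral_def e fun_eq_iff)
  also have "\<dots> \<in> borel_measurable M" by measurable
  finally show ?case .
qed

text \<open>\<open>Z\<close> is compared with a stopped elementary integral \<open>N\<close>, which
  has mean zero and second moment at most K. The difference has second moment at most 2 E Z^2 + 2 K
  and is small off an event whose probability, as n grows, comes down to that of the energy
  \<open>S\<close> of \<Phi> exceeding K / 4. Only afterwards is K sent to infinity, with a weight
  \<theta> of order 1 / K.\<close>

lemma walsh_integral_expectation:
  assumes walsh: "walsh_integral M W \<Phi> Z"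
    and fin: "(\<integral>\<^sup>+\<omega>. (\<integral>\<^sup>+z. ennreal ((\<Phi> z \<omega>)\<^sup>2) \<partial>lborel) \<partial>M) < \<infinity>"
  shows "integrable M (\<lambda>\<omega>. (Z \<omega>)\<^sup>2)" and "expectation Z = 0"
proof -
  have \<Phi>m[measurable]: "(\<lambda>(z, \<omega>). \<Phi> z \<omega>) \<in> borel_measurable (lborel \<Otimes>\<^sub>M M)"
    and Zm[measurable]: "Z \<in> borel_measurable M"
    and iso: "(\<integral>\<^sup>+\<omega>. ennreal ((Z \<omega>)\<^sup>2) \<partial>M) = (\<integral>\<^sup>+\<omega>. (\<integral>\<^sup>+z. ennreal ((\<Phi> z \<omega>)\<^sup>2) \<partial>lborel) \<partial>M)"
    using walsh by (auto simp: walsh_integral_def)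
  obtain es where es: "\<And>n. elementary M W (es n)"
    and lim\<Phi>: "\<And>\<epsilon>. \<epsilon> > 0 \<Longrightarrow> (\<lambda>n. measure M {\<omega> \<in> space M.
            (\<integral>\<^sup>+z. ennreal ((elementary_process (es n) z \<omega> - \<Phi> z \<omega>)\<^sup>2) \<partial>lborel) > ennreal \<epsilon>}) \<longlonglongrightarrow> 0"
    and limZ: "\<And>\<epsilon>. \<epsilon> > 0 \<Longrightarrow> (\<lambda>n. measure M {\<omega> \<in> space M. \<bar>elementary_integral W (es n) \<omega> - Z \<omega>\<bar> > \<epsilon>}) \<longlonglongrightarrow> 0"
    using walsh unfolding walsh_integral_def by blast
  show Z2: "integrable M (\<lambda>\<omega>. (Z \<omega>)\<^sup>2)"
    using iso fin by (intro integrableI_nonneg) auto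
  then have Zi: "integrable M Z" by (rule integrable_square_imp_integrable[OF Zm])
  note em[measurable] = elementary_process_measurable[OF es]
  note eim[measurable] = elementary_integral_measurable[OF es]
  define S where "S \<omega> = (\<integral>\<^sup>+z. ennreal ((\<Phi> z \<omega>)\<^sup>2) \<partial>lborel)" for \<omega>
  define Q where "Q n \<omega> = (\<integral>\<^sup>+z. ennreal ((elementary_process (es n) z \<omega> - \<Phi> z \<omega>)\<^sup>2) \<partial>lborel)" for n \<omega>
  have Sm[measurable]: "S \<in> borel_measurable M" unfolding S_def by measurable
  have Qm[measurable]: "Q n \<in> borel_measurable M" for n unfolding Q_def by measurable
  have V_le: "(\<integral>\<^sup>+z. ennreal ((elementary_process (es n) z \<omega>)\<^sup>2) \<partial>lborel) \<le> 2 * Q n \<omega> + 2 * S \<omega>"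
    if \<omega>[measurable]: "\<omega> \<in> space M" for n \<omega>
  proof -
    have [measurable]: "(\<lambda>z. \<Phi> z \<omega>) \<in> borel_measurable lborel"
      "(\<lambda>z. elementary_process (es n) z \<omega>) \<in> borel_measurable lborel"
      using measurable_Pair1[OF \<Phi>m \<omega>] measurable_Pair1[OF em \<omega>] by auto
    have pt: "e\<^sup>2 \<le> 2 * (e - f)\<^sup>2 + 2 * f\<^sup>2" for e f :: real
    proof -
      have "0 \<le> (e - 2 * f)\<^sup>2" by simp
      then show ?thesis by (simp add: power2_eq_square algebra_simps)
    qed
    have "(\<integral>\<^sup>+z. ennreal ((elementary_process (es n) z \<omega>)\<^sup>2) \<partial>lborel) \<le>
      (\<integral>\<^sup>+z. 2 * ennreal ((elementary_process (es n) z \<omega> - \<Phi> z \<omega>)\<^sup>2) + 2 * ennreal ((\<Phi> z \<omega>)\<^sup>2) \<partial>lborel)"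
    proof (rule nn_integral_mono)
      fix z
      have "ennreal ((elementary_process (es n) z \<omega>)\<^sup>2) \<le>
          ennreal (2 * (elementary_process (es n) z \<omega> - \<Phi> z \<omega>)\<^sup>2 + 2 * (\<Phi> z \<omega>)\<^sup>2)"
        by (intro ennreal_leI pt)
      then show "ennreal ((elementary_process (es n) z \<omega>)\<^sup>2) \<le>
          2 * ennreal ((elementary_process (es n) z \<omega> - \<Phi> z \<omega>)\<^sup>2) + 2 * ennreal ((\<Phi> z \<omega>)\<^sup>2)"
        by (simp add: ennreal_plus ennreal_mult)
    qed
    also have "\<dots> = 2 * Q n \<omega> + 2 * S \<omega>"
      unfolding Q_def S_def by (subst nn_integral_add) (auto simp: nn_integral_cmult)
    finally show ?thesis .
  qed
  define z2 where "z2 = expectation (\<lambda>\<omega>. (Z \<omega>)\<^sup>2)"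

  have est: "\<bar>expectation Z\<bar> \<le> \<delta> + \<theta> * (2 * z2 + 2 * K) + prob {\<omega> \<in> space M. S \<omega> > ennreal (K / 4)} / (4 * \<theta>)"
    if \<delta>: "0 < \<delta>" and \<theta>: "0 < \<theta>" and K: "0 < K" for \<delta> \<theta> K
  proof -
    let ?pS = "prob {\<omega> \<in> space M. S \<omega> > ennreal (K / 4)}"
    let ?pQ = "\<lambda>n. prob {\<omega> \<in> space M. Q n \<omega> > ennreal (K / 4)}"
    let ?pI = "\<lambda>n. prob {\<omega> \<in> space M. \<bar>elementary_integral W (es n) \<omega> - Z \<omega>\<bar> > \<delta>}"
    have bound: "\<bar>expectation Z\<bar> \<le> \<delta> + \<theta> * (2 * z2 + 2 * K) + (?pI n + ?pQ n + ?pS) / (4 * \<theta>)" for n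
    proof -
      obtain N where [measurable]: "N \<in> borel_measurable M" and N: "integrable M (\<lambda>\<omega>. (N \<omega>)\<^sup>2)" "expectation N = 0"
        "expectation (\<lambda>\<omega>. (N \<omega>)\<^sup>2) \<le> K"
        "AE \<omega> in M. (\<integral>\<^sup>+z. ennreal ((elementary_process (es n) z \<omega>)\<^sup>2) \<partial>lborel) \<le> ennreal K \<longrightarrow>
           N \<omega> = elementary_integral W (es n) \<omega>"
        by (rule elementary_truncation[OF es less_imp_le[OF K]]) blast
      have Ni: "integrable M N" using N(1) by (rule integrable_square_imp_integrable[rotated]) measurable
      define B where "B = {\<omega> \<in> space M. \<bar>Z \<omega> - N \<omega>\<bar> > \<delta>}"
      have [measurable]: "B \<in> sets M" unfolding B_def by measurable
      have ZN: "integrable M (\<lambda>\<omega>. Z \<omega> * N \<omega>)" by (rule integrable_mult_of_squares[OF _ _ Z2 N(1)]) measurable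
      have d2: "(Z \<omega> - N \<omega>)\<^sup>2 = (Z \<omega>)\<^sup>2 + (N \<omega>)\<^sup>2 - 2 * (Z \<omega> * N \<omega>)" for \<omega>
        by (simp add: power2_diff)
      have i2: "integrable M (\<lambda>\<omega>. (Z \<omega> - N \<omega>)\<^sup>2)"
        unfolding d2 using Z2 N(1) ZN by auto
      have e2: "expectation (\<lambda>\<omega>. (Z \<omega> - N \<omega>)\<^sup>2) \<le> 2 * z2 + 2 * K"
      proof -
        have "expectation (\<lambda>\<omega>. (Z \<omega> - N \<omega>)\<^sup>2) \<le> expectation (\<lambda>\<omega>. 2 * (Z \<omega>)\<^sup>2 + 2 * (N \<omega>)\<^sup>2)"
        proof (rule integral_mono)
          fix \<omega>
          have "0 \<le> (Z \<omega> + N \<omega>)\<^sup>2" by simp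
          then show "(Z \<omega> - N \<omega>)\<^sup>2 \<le> 2 * (Z \<omega>)\<^sup>2 + 2 * (N \<omega>)\<^sup>2"
            by (simp add: power2_eq_square algebra_simps)
        qed (use i2 Z2 N(1) in auto)
        also have "\<dots> = 2 * z2 + 2 * expectation (\<lambda>\<omega>. (N \<omega>)\<^sup>2)" using Z2 N(1) by (simp add: z2_def)
        finally show ?thesis using N(3) by simp
      qed
      \<comment> \<open>Off the last two events the energy of \<open>es n\<close> is at most 2 K/4 +
        2 K/4 = K, so almost surely \<open>N\<close> is the elementary integral itself, and
        \<open>B\<close> can then occur only within the first event.\<close>
      have PB: "prob B \<le> ?pI n + ?pQ n + ?pS"
      proof -
        have "prob B \<le> prob ({\<omega> \<in> space M. \<bar>elementary_integral W (es n) \<omega> - Z \<omega>\<bar> > \<delta>} \<union>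
           {\<omega> \<in> space M. Q n \<omega> > ennreal (K / 4)} \<union> {\<omega> \<in> space M. S \<omega> > ennreal (K / 4)})"
        proof (rule finite_measure_mono_AE)
          show "AE \<omega> in M. \<omega> \<in> B \<longrightarrow> \<omega> \<in> {\<omega> \<in> space M. \<bar>elementary_integral W (es n) \<omega> - Z \<omega>\<bar> > \<delta>} \<union>
             {\<omega> \<in> space M. Q n \<omega> > ennreal (K / 4)} \<union> {\<omega> \<in> space M. S \<omega> > ennreal (K / 4)}"
            using N(4) AE_space
          proof eventually_elim
            case (elim \<omega>)
            show ?case
            proof (cases "Q n \<omega> > ennreal (K / 4) \<or> S \<omega> > ennreal (K / 4)")
              case True
              then show ?thesis using elim(2) by auto
            next
              case False
              then have "2 * Q n \<omega> + 2 * S \<omega> \<le> 2 * ennreal (K / 4) + 2 * ennreal (K / 4)"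
                by (intro add_mono mult_left_mono) auto
              also have "\<dots> = ennreal (2 * (K / 4) + 2 * (K / 4))"
                using K by (simp only: ennreal_plus ennreal_mult'' ennreal_numeral)
              also have "\<dots> = ennreal K" by simp
              finally show ?thesis using elim V_le[OF elim(2), of n] by (auto simp: B_def abs_minus_commute)
            qed
          qed
        qed measurable
        also have "\<dots> \<le> prob ({\<omega> \<in> space M. \<bar>elementary_integral W (es n) \<omega> - Z \<omega>\<bar> > \<delta>} \<union>
           {\<omega> \<in> space M. Q n \<omega> > ennreal (K / 4)}) + ?pS"
          by (rule measure_Un_le) measurable
        also have "\<dots> \<le> ?pI n + ?pQ n + ?pS"
          by (intro add_right_mono measure_Un_le) measurable
        finally show ?thesis .
      qed
      have "\<bar>expectation Z\<bar> = \<bar>expectation (\<lambda>\<omega>. Z \<omega> - N \<omega>)\<bar>" using Zi Ni N(2) by simp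
      also have "\<dots> \<le> expectation (\<lambda>\<omega>. \<bar>Z \<omega> - N \<omega>\<bar>)" by (rule integral_abs_bound)
      also have "\<dots> \<le> expectation (\<lambda>\<omega>. \<delta> + \<theta> * (Z \<omega> - N \<omega>)\<^sup>2 + indicator B \<omega> / (4 * \<theta>))"
      proof (rule integral_mono)
        fix \<omega> assume "\<omega> \<in> space M"
        then show "\<bar>Z \<omega> - N \<omega>\<bar> \<le> \<delta> + \<theta> * (Z \<omega> - N \<omega>)\<^sup>2 + indicator B \<omega> / (4 * \<theta>)"
          using abs_le_weighted_square[OF \<delta> \<theta>, of "Z \<omega> - N \<omega>"] by (simp add: B_def indicator_def)
      qed (use Zi Ni i2 in \<open>auto simp: emeasure_eq_measure\<close>)
      also have "\<dots> = \<delta> + \<theta> * expectation (\<lambda>\<omega>. (Z \<omega> - N \<omega>)\<^sup>2) + prob B / (4 * \<theta>)"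
        using i2 by (simp add: emeasure_eq_measure prob_space)
      also have "\<dots> \<le> \<delta> + \<theta> * (2 * z2 + 2 * K) + (?pI n + ?pQ n + ?pS) / (4 * \<theta>)"
        using e2 PB \<theta> by (intro add_mono mult_left_mono divide_right_mono) auto
      finally show ?thesis .
    qed
    have "(\<lambda>n. \<delta> + \<theta> * (2 * z2 + 2 * K) + (?pI n + ?pQ n + ?pS) / (4 * \<theta>)) \<longlonglongrightarrow>
        \<delta> + \<theta> * (2 * z2 + 2 * K) + (0 + 0 + ?pS) / (4 * \<theta>)"
      using lim\<Phi>[of "K / 4"] limZ[OF \<delta>] K \<theta> unfolding Q_def by (intro tendsto_intros) auto
    then show ?thesis using bound by (auto intro!: LIMSEQ_le_const)
  qed

  \<comment> \<open>Markov's inequality would only bound this sequence. It tends to 0 by dominated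
    convergence: the variables k * 1[S > k/4] are at most 4 S and are eventually 0 wherever S is
    finite.\<close>
  have tail: "(\<lambda>k. real k * prob {\<omega> \<in> space M. S \<omega> > ennreal (real k / 4)}) \<longlonglongrightarrow> 0"
  proof -
    define s where "s \<omega> = enn2real (S \<omega>)" for \<omega>
    have [measurable]: "s \<in> borel_measurable M" unfolding s_def by measurable
    have Sfin: "AE \<omega> in M. S \<omega> \<noteq> \<infinity>"
      using fin unfolding S_def[symmetric] by (intro nn_integral_PInf_AE) auto
    have si: "integrable M s"
    proof (rule integrableI_nonneg)
      have "(\<integral>\<^sup>+\<omega>. ennreal (s \<omega>) \<partial>M) \<le> (\<integral>\<^sup>+\<omega>. S \<omega> \<partial>M)"
        unfolding s_def by (intro nn_integral_mono) (simp add: ennreal_enn2real_if)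
      also have "\<dots> < \<infinity>" using fin unfolding S_def .
      finally show "(\<integral>\<^sup>+\<omega>. ennreal (s \<omega>) \<partial>M) < \<infinity>" .
    qed (auto simp: s_def)
    have "(\<lambda>k. expectation (\<lambda>\<omega>. real k * indicator {\<omega> \<in> space M. S \<omega> > ennreal (real k / 4)} \<omega>)) \<longlonglongrightarrow> expectation (\<lambda>\<omega>. 0)"
    proof (rule integral_dominated_convergence[where w="\<lambda>\<omega>. 4 * s \<omega>"])
      show "AE \<omega> in M. (\<lambda>k. real k * indicator {\<omega> \<in> space M. S \<omega> > ennreal (real k / 4)} \<omega>) \<longlonglongrightarrow> 0"
        using Sfin
      proof eventually_elim
        case (elim \<omega>)
        have "real k * indicator {\<omega> \<in> space M. S \<omega> > ennreal (real k / 4)} \<omega> = 0" if "k \<ge> nat \<lceil>4 * s \<omega>\<rceil>" for k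
        proof -
          have "s \<omega> \<le> real k / 4" using that by linarith
          then have "S \<omega> \<le> ennreal (real k / 4)"
            using elim ennreal_leI[of "s \<omega>" "real k / 4"] by (simp add: s_def top.not_eq_extremum)
          then show ?thesis by (simp add: indicator_def not_less)
        qed
        then have "eventually (\<lambda>k. real k * indicator {\<omega> \<in> space M. S \<omega> > ennreal (real k / 4)} \<omega> = 0) sequentially"
          unfolding eventually_sequentially by blast
        then show ?case by (rule tendsto_eventually)
      qed
      show "AE \<omega> in M. norm (real k * indicator {\<omega> \<in> space M. S \<omega> > ennreal (real k / 4)} \<omega>) \<le> 4 * s \<omega>" for k
        using Sfin
      proof eventually_elim
        case (elim \<omega>)
        show ?case
        proof (cases "S \<omega> > ennreal (real k / 4)")
          case True
          have "ennreal (real k / 4) \<le> ennreal (s \<omega>)"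
            using True elim by (simp add: s_def top.not_eq_extremum)
          then have "real k / 4 \<le> s \<omega>" by (subst (asm) ennreal_le_iff) (simp_all add: s_def)
          then show ?thesis by (auto simp: indicator_def s_def)
        qed (simp add: indicator_def s_def)
      qed
    qed (use si in auto)
    then show ?thesis by simp
  qed
  show "expectation Z = 0"
  proof (rule ccontr)
    assume ne: "expectation Z \<noteq> 0"
    \<comment> \<open>With \<delta> = \<rho>, \<theta> = \<rho> / k and K = k the estimate tends to
      3 \<rho>; the factor 1/8 makes this limit smaller than |E Z|.\<close>
    define \<rho> where "\<rho> = \<bar>expectation Z\<bar> / 8"
    have \<rho>: "\<rho> > 0" using ne by (simp add: \<rho>_def)
    have lim: "(\<lambda>k. \<rho> + (\<rho> * (2 * z2) * inverse (real k) + 2 * \<rho>) +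
        real k * prob {\<omega> \<in> space M. S \<omega> > ennreal (real k / 4)} / (4 * \<rho>)) \<longlonglongrightarrow>
        \<rho> + (\<rho> * (2 * z2) * 0 + 2 * \<rho>) + 0 / (4 * \<rho>)"
      using \<rho> by (intro tendsto_intros tail lim_inverse_n) auto
    have "\<bar>expectation Z\<bar> \<le> \<rho> + (\<rho> * (2 * z2) * 0 + 2 * \<rho>) + 0 / (4 * \<rho>)"
    proof (rule LIMSEQ_le_const[OF lim], intro exI[of _ 1] allI impI)
      fix k :: nat assume "1 \<le> k"
      then have k: "real k > 0" by simp
      have "\<bar>expectation Z\<bar> \<le> \<rho> + (\<rho> / real k) * (2 * z2 + 2 * real k) +
         prob {\<omega> \<in> space M. S \<omega> > ennreal (real k / 4)} / (4 * (\<rho> / real k))"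
        using \<rho> k by (intro est) auto
      also have "\<dots> = \<rho> + (\<rho> * (2 * z2) * inverse (real k) + 2 * \<rho>) +
        real k * prob {\<omega> \<in> space M. S \<omega> > ennreal (real k / 4)} / (4 * \<rho>)"
        using \<rho> k by (simp add: field_simps)
      finally show "\<bar>expectation Z\<bar> \<le> \<rho> + (\<rho> * (2 * z2) * inverse (real k) + 2 * \<rho>) +
        real k * prob {\<omega> \<in> space M. S \<omega> > ennreal (real k / 4)} / (4 * \<rho>)" .
    qed
    then show False using \<rho> by (simp add: \<rho>_def)
  qed
qed

text \<open>If E Z^2 is finite, \<open>Z\<close> has mean zero and the cross term drops out. If it
  is infinite, then Z^2 \<le> 2 (c + Z)^2 + 2 c^2 forces the second moment of \<open>U\<close> to be
  infinite as well.\<close>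

lemma second_moment_lower_bound:
  assumes walsh: "walsh_integral M W \<Phi> Z" and U: "AE \<omega> in M. U \<omega> = c + Z \<omega>"
    and Um: "U \<in> borel_measurable M"
  shows "ennreal (c\<^sup>2) + (\<integral>\<^sup>+\<omega>. (\<integral>\<^sup>+z. ennreal ((\<Phi> z \<omega>)\<^sup>2) \<partial>lborel) \<partial>M) \<le> (\<integral>\<^sup>+\<omega>. ennreal ((U \<omega>)\<^sup>2) \<partial>M)"
proof -
  have [measurable]: "Z \<in> borel_measurable M" "U \<in> borel_measurable M"
    and iso: "(\<integral>\<^sup>+\<omega>. (\<integral>\<^sup>+z. ennreal ((\<Phi> z \<omega>)\<^sup>2) \<partial>lborel) \<partial>M) = (\<integral>\<^sup>+\<omega>. ennreal ((Z \<omega>)\<^sup>2) \<partial>M)"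
    using walsh Um by (auto simp: walsh_integral_def)
  have UZ: "(\<integral>\<^sup>+\<omega>. ennreal ((U \<omega>)\<^sup>2) \<partial>M) = (\<integral>\<^sup>+\<omega>. ennreal ((c + Z \<omega>)\<^sup>2) \<partial>M)"
    by (rule nn_integral_cong_AE) (use U in auto)
  show ?thesis
  proof (cases "(\<integral>\<^sup>+\<omega>. ennreal ((Z \<omega>)\<^sup>2) \<partial>M) < \<infinity>")
    case True
    note w = walsh_integral_expectation[OF walsh True[folded iso]]
    have Zi: "integrable M Z" by (rule integrable_square_imp_integrable[OF _ w(1)]) measurable
    have sq: "(c + Z \<omega>)\<^sup>2 = c\<^sup>2 + (Z \<omega>)\<^sup>2 + 2 * c * Z \<omega>" for \<omega> by (simp add: power2_sum)
    have "(\<integral>\<^sup>+\<omega>. ennreal ((c + Z \<omega>)\<^sup>2) \<partial>M) = ennreal (expectation (\<lambda>\<omega>. (c + Z \<omega>)\<^sup>2))"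
      by (rule nn_integral_eq_integral) (simp add: sq w Zi, simp)
    also have "expectation (\<lambda>\<omega>. (c + Z \<omega>)\<^sup>2) = c\<^sup>2 + expectation (\<lambda>\<omega>. (Z \<omega>)\<^sup>2)"
      unfolding sq using w Zi by (simp add: prob_space)
    also have "ennreal \<dots> = ennreal (c\<^sup>2) + ennreal (expectation (\<lambda>\<omega>. (Z \<omega>)\<^sup>2))"
      by (intro ennreal_plus) auto
    also have "ennreal (expectation (\<lambda>\<omega>. (Z \<omega>)\<^sup>2)) = (\<integral>\<^sup>+\<omega>. ennreal ((Z \<omega>)\<^sup>2) \<partial>M)"
      by (rule nn_integral_eq_integral[symmetric]) (use w in auto)
    finally show ?thesis by (simp add: UZ iso)
  next
    case False
    have "(\<integral>\<^sup>+\<omega>. ennreal ((Z \<omega>)\<^sup>2) \<partial>M) \<le> (\<integral>\<^sup>+\<omega>. 2 * ennreal ((c + Z \<omega>)\<^sup>2) + ennreal (2 * c\<^sup>2) \<partial>M)"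
    proof (rule nn_integral_mono)
      fix \<omega>
      have "0 \<le> (Z \<omega> + 2 * c)\<^sup>2" by simp
      then have "(Z \<omega>)\<^sup>2 \<le> 2 * (c + Z \<omega>)\<^sup>2 + 2 * c\<^sup>2" by (simp add: power2_eq_square algebra_simps)
      then have "ennreal ((Z \<omega>)\<^sup>2) \<le> ennreal (2 * (c + Z \<omega>)\<^sup>2 + 2 * c\<^sup>2)" by (rule ennreal_leI)
      then show "ennreal ((Z \<omega>)\<^sup>2) \<le> 2 * ennreal ((c + Z \<omega>)\<^sup>2) + ennreal (2 * c\<^sup>2)"
        by (simp add: ennreal_plus ennreal_mult)
    qed
    also have "\<dots> = 2 * (\<integral>\<^sup>+\<omega>. ennreal ((U \<omega>)\<^sup>2) \<partial>M) + ennreal (2 * c\<^sup>2)"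
      unfolding UZ by (subst nn_integral_add) (auto simp: nn_integral_cmult emeasure_space_1)
    finally have "2 * (\<integral>\<^sup>+\<omega>. ennreal ((U \<omega>)\<^sup>2) \<partial>M) + ennreal (2 * c\<^sup>2) = \<infinity>"
      using False by (simp add: less_top[symmetric] top_unique)
    then have "(\<integral>\<^sup>+\<omega>. ennreal ((U \<omega>)\<^sup>2) \<partial>M) = \<infinity>"
      by (auto simp: ennreal_mult_eq_top_iff)
    then show ?thesis by simp
  qed
qed

end

section \<open>Lower bound for the kernel\<close>

lemma ennreal_half_add_half: "ennreal (1 / 2) + ennreal (1 / 2) = 1"
proof -
  have "ennreal (1 / 2) + ennreal (1 / 2) = ennreal (1 / 2 + 1 / 2)" by (rule ennreal_plus[symmetric]) auto
  then show ?thesis by simp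
qed

text \<open>Chernoff bound from the Laplace transform at 1 / r: on the event in question, exp(1 -
  D_a / r) is at least 1.\<close>

lemma stable_subordinator_le_prob:
  assumes D: "stable_subordinator N \<beta> D" and a: "0 \<le> a" and r: "0 < r"
  shows "measure N {\<omega> \<in> space N. D a \<omega> \<le> r} \<le> exp (1 - a * r powr (- \<beta>))"
proof -
  interpret prob_space N using D by (simp add: stable_subordinator_def)
  have [measurable]: "D a \<in> borel_measurable N" using D a by (simp add: stable_subordinator_def)
  have "\<forall>r\<ge>0. \<forall>l\<ge>0. (LINT \<omega>|N. exp (- l * D r \<omega>)) = exp (- r * l powr \<beta>)"
    using D unfolding stable_subordinator_def by (elim conjE)
  note L = this[rule_format, of a "1 / r", OF a less_imp_le[OF divide_pos_pos[OF zero_less_one r]]]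
  \<comment> \<open>A function that is not integrable has integral 0 by convention, whereas the
    Laplace transform is an exponential and thus nonzero.\<close>
  have i: "integrable N (\<lambda>\<omega>. exp (- (1 / r) * D a \<omega>))"
    using L not_integrable_integral_eq[of N "\<lambda>\<omega>. exp (- (1 / r) * D a \<omega>)"] by auto
  have "measure N {\<omega> \<in> space N. D a \<omega> \<le> r} = expectation (\<lambda>\<omega>. indicator {\<omega> \<in> space N. D a \<omega> \<le> r} \<omega>)"
    by simp
  also have "\<dots> \<le> expectation (\<lambda>\<omega>. exp 1 * exp (- (1 / r) * D a \<omega>))"
  proof (rule integral_mono)
    fix \<omega>
    show "indicator {\<omega> \<in> space N. D a \<omega> \<le> r} \<omega> \<le> exp 1 * exp (- (1 / r) * D a \<omega>)"
      using r by (auto simp: indicator_def exp_add[symmetric] field_simps)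
  qed (use i in \<open>auto simp: emeasure_eq_measure\<close>)
  also have "\<dots> = exp 1 * exp (- a * (1 / r) powr \<beta>)" using L by simp
  also have "\<dots> = exp (1 - a * r powr (- \<beta>))"
    using r by (simp add: exp_add[symmetric] powr_minus_divide powr_divide)
  finally show ?thesis .
qed

context
  fixes N :: "'b measure" and \<beta> :: real and D f
  assumes D: "stable_subordinator N \<beta> D" and f: "first_passage_density N D f"
begin

context
  fixes r :: real assumes r: "0 < r"
begin

lemma passage_density_nonneg: "0 \<le> f r s"
  using f r by (simp add: first_passage_density_def)

lemma passage_distributed: "distributed N lborel (first_passage_time D r) (\<lambda>s. ennreal (f r s))"
  using f r by (simp add: first_passage_density_def)

lemma passage_density_measurable: "f r \<in> borel_measurable borel"
proof -
  have "(\<lambda>s. ennreal (f r s)) \<in> borel_measurable lborel"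
    using passage_distributed by (rule distributed_borel_measurable)
  then have "(\<lambda>s. enn2real (ennreal (f r s))) \<in> borel_measurable lborel" by measurable
  then show ?thesis by (simp add: passage_density_nonneg)
qed

text \<open>If D_a > r, then \<open>a\<close> belongs to the set whose infimum is the passage time.
  A passage time beyond \<open>a\<close> therefore forces D_a \<le> r, and the Chernoff bound
  applies.\<close>

lemma passage_time_tail:
  assumes a: "0 \<le> a"
  shows "(\<integral>\<^sup>+s\<in>{a<..}. ennreal (f r s) \<partial>lborel) \<le> ennreal (exp (1 - a * r powr (- \<beta>)))"
proof -
  interpret prob_space N using D by (simp add: stable_subordinator_def)
  have [measurable]: "D a \<in> borel_measurable N" using D a by (simp add: stable_subordinator_def)
  have "(\<integral>\<^sup>+s\<in>{a<..}. ennreal (f r s) \<partial>lborel) = emeasure N (first_passage_time D r -` {a<..} \<inter> space N)"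
    using distributed_emeasure[OF passage_distributed, of "{a<..}"] by simp
  also have "\<dots> \<le> emeasure N {\<omega> \<in> space N. D a \<omega> \<le> r}"
  proof (rule emeasure_mono)
    show "first_passage_time D r -` {a<..} \<inter> space N \<subseteq> {\<omega> \<in> space N. D a \<omega> \<le> r}"
    proof safe
      fix \<omega> assume \<omega>: "first_passage_time D r \<omega> > a"
      show "D a \<omega> \<le> r"
      proof (rule ccontr)
        assume "\<not> D a \<omega> \<le> r"
        then have "first_passage_time D r \<omega> \<le> a"
          unfolding first_passage_time_def using a by (intro cInf_lower bdd_belowI[of _ 0]) auto
        then show False using \<omega> by simp
      qed
    qed
  qed measurable
  also have "\<dots> \<le> ennreal (exp (1 - a * r powr (- \<beta>)))"
    using stable_subordinator_le_prob[OF D a r] by (simp add: emeasure_eq_measure ennreal_leI)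
  finally show ?thesis .
qed

text \<open>The infimum of the empty set is an unspecified real, so the passage time could be
  negative where \<open>D\<close> never exceeds \<open>r\<close>. This happens with probability at
  most P(D_n \<le> r) for every n, which tends to 0; the single point 0 is a Lebesgue null
  set.\<close>

lemma passage_time_pos: "(\<integral>\<^sup>+s\<in>{..0}. ennreal (f r s) \<partial>lborel) = 0"
proof -
  interpret prob_space N using D by (simp add: stable_subordinator_def)
  have "(\<integral>\<^sup>+s\<in>{..0}. ennreal (f r s) \<partial>lborel) = (\<integral>\<^sup>+s\<in>{..<0}. ennreal (f r s) \<partial>lborel)"
  proof (rule nn_integral_cong_AE)
    show "AE s in lborel. ennreal (f r s) * indicator {..0} s = ennreal (f r s) * indicator {..<0} s"
      using AE_lborel_singleton[of "0::real"] by eventually_elim (auto simp: indicator_def)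
  qed
  also have "\<dots> = emeasure N (first_passage_time D r -` {..<0} \<inter> space N)"
    using distributed_emeasure[OF passage_distributed, of "{..<0}"] by simp
  also have "\<dots> = 0"
  proof -
    let ?S = "first_passage_time D r -` {..<0} \<inter> space N"
    have "measure N ?S \<le> exp (1 - real n * r powr (- \<beta>))" for n :: nat
    proof -
      have [measurable]: "D n \<in> borel_measurable N" using D by (simp add: stable_subordinator_def)
      have "measure N ?S \<le> measure N {\<omega> \<in> space N. D n \<omega> \<le> r}"
      proof (rule finite_measure_mono)
        show "?S \<subseteq> {\<omega> \<in> space N. D n \<omega> \<le> r}"
        proof safe
          fix \<omega> assume \<omega>: "first_passage_time D r \<omega> < 0"
          show "D n \<omega> \<le> r"
          proof (rule ccontr)
            assume "\<not> D n \<omega> \<le> r"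
            then have "{s. 0 \<le> s \<and> r < D s \<omega>} \<noteq> {}" by (auto intro!: exI[of _ "real n"])
            then have "0 \<le> first_passage_time D r \<omega>"
              unfolding first_passage_time_def by (intro cInf_greatest) auto
            then show False using \<omega> by simp
          qed
        qed
      qed measurable
      also have "\<dots> \<le> exp (1 - real n * r powr (- \<beta>))"
        by (rule stable_subordinator_le_prob[OF D _ r]) simp
      finally show ?thesis .
    qed
    moreover have "(\<lambda>n::nat. exp (1 - real n * r powr (- \<beta>))) \<longlonglongrightarrow> 0"
    proof -
      have "filterlim (\<lambda>n::nat. - 1 + r powr (- \<beta>) * real n) at_top sequentially"
        using r by (intro filterlim_tendsto_add_at_top[OF tendsto_const]
          filterlim_tendsto_pos_mult_at_top[OF tendsto_const] filterlim_real_sequentially) auto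
      then have "(\<lambda>n::nat. exp (- (- 1 + r powr (- \<beta>) * real n))) \<longlonglongrightarrow> 0"
        by (intro filterlim_compose[OF exp_at_bot] filterlim_uminus_at_bot[THEN iffD1]) (simp add: filterlim_uminus_at_bot)
      then show ?thesis by (simp add: mult.commute)
    qed
    ultimately have "measure N ?S \<le> 0" by (intro LIMSEQ_le_const) auto
    then show ?thesis by (simp add: emeasure_eq_measure measure_le_0_iff)
  qed
  finally show ?thesis .
qed

lemma passage_density_split:
  assumes "0 \<le> a"
  shows "(\<integral>\<^sup>+s\<in>{0<..a}. ennreal (f r s) \<partial>lborel) + (\<integral>\<^sup>+s\<in>{a<..}. ennreal (f r s) \<partial>lborel) = 1"
proof -
  note [measurable] = passage_density_measurable
  interpret prob_space N using D by (simp add: stable_subordinator_def)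
  have "1 = (\<integral>\<^sup>+s. ennreal (f r s) \<partial>lborel)"
    using distributed_emeasure[OF passage_distributed, of UNIV]
      distributed_measurable[OF passage_distributed] by (simp add: emeasure_space_1)
  also have "\<dots> = (\<integral>\<^sup>+s. ennreal (f r s) * indicator {..0} s +
      (ennreal (f r s) * indicator {0<..a} s + ennreal (f r s) * indicator {a<..} s) \<partial>lborel)"
    using assms by (intro nn_integral_cong) (auto simp: indicator_def)
  also have "\<dots> = (\<integral>\<^sup>+s\<in>{..0}. ennreal (f r s) \<partial>lborel) +
      ((\<integral>\<^sup>+s\<in>{0<..a}. ennreal (f r s) \<partial>lborel) + (\<integral>\<^sup>+s\<in>{a<..}. ennreal (f r s) \<partial>lborel))"
    by (subst nn_integral_add, measurable)+
  finally show ?thesis by (simp add: passage_time_pos)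
qed

lemma passage_density_total: "(\<integral>\<^sup>+s\<in>{0<..}. ennreal (f r s) \<partial>lborel) = 1"
  using passage_density_split[of 0] by simp

text \<open>At time 3 r^\<beta> the Chernoff bound for the complementary tail equals exp(1 - 3),
  which is below 1/2.\<close>

lemma passage_density_half: "ennreal (1 / 2) \<le> (\<integral>\<^sup>+s\<in>{0<..3 * r powr \<beta>}. ennreal (f r s) \<partial>lborel)"
proof -
  let ?a = "3 * r powr \<beta>" and ?I = "\<integral>\<^sup>+s\<in>{0<..3 * r powr \<beta>}. ennreal (f r s) \<partial>lborel"
  have "(\<integral>\<^sup>+s\<in>{?a<..}. ennreal (f r s) \<partial>lborel) \<le> ennreal (exp (1 - ?a * r powr (- \<beta>)))"
    by (rule passage_time_tail) simp
  also have "1 - ?a * r powr (- \<beta>) = - 2" using r by (simp add: powr_minus)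
  also have "exp (- 2) \<le> (1 / 2 :: real)"
    using exp_ge_add_one_self[of 2] by (simp add: exp_minus field_simps)
  finally have "(\<integral>\<^sup>+s\<in>{?a<..}. ennreal (f r s) \<partial>lborel) \<le> ennreal (1 / 2)" by (simp add: ennreal_leI)
  then have "?I + (\<integral>\<^sup>+s\<in>{?a<..}. ennreal (f r s) \<partial>lborel) \<le> ?I + ennreal (1 / 2)" by (rule add_left_mono)
  moreover have "?I + (\<integral>\<^sup>+s\<in>{?a<..}. ennreal (f r s) \<partial>lborel) = 1" by (rule passage_density_split) simp
  ultimately have "ennreal (1 / 2) + ennreal (1 / 2) \<le> ennreal (1 / 2) + ?I" by (simp only: ennreal_half_add_half add.commute)
  then show ?thesis by (simp only: ennreal_add_left_cancel_le ennreal_neq_top simp_thms infinity_ennreal_def)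
qed

end

end

text \<open>The antiderivative n - sin(n y) / y gives the value 1 - sin(y) / y, and the quotient is
  at most 1/2 in modulus.\<close>

lemma nn_integral_one_minus_cos:
  fixes y :: real
  assumes y: "2 \<le> \<bar>y\<bar>"
  shows "ennreal (1 / 2) \<le> (\<integral>\<^sup>+n\<in>{0..1}. ennreal (1 - cos (n * y)) \<partial>lborel)"
proof -
  have y0: "y \<noteq> 0" using y by auto
  have "(\<integral>\<^sup>+n. ennreal (1 - cos (n * y)) * indicator {0..1} n \<partial>lborel) =
      ennreal ((1 - sin (1 * y) / y) - (0 - sin (0 * y) / y))"
    by (rule nn_integral_FTC_Icc[where F="\<lambda>n. n - sin (n * y) / y"])
      (use y0 in \<open>auto intro!: derivative_eq_intros\<close>)
  moreover have "1 / 2 \<le> 1 - sin y / y"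
  proof -
    have "\<bar>sin y / y\<bar> \<le> 1 / 2"
    proof -
      have "2 * \<bar>sin y\<bar> \<le> \<bar>y\<bar>" using y abs_sin_le_one[of y] by linarith
      then show ?thesis unfolding abs_divide using y0 by (simp add: field_simps)
    qed
    then show ?thesis by linarith
  qed
  then have "ennreal (1 / 2) \<le> ennreal ((1 - sin (1 * y) / y) - (0 - sin (0 * y) / y))"
    by (intro ennreal_leI) simp
  ultimately show ?thesis by (simp only:)
qed

section \<open>Tails of the stable density\<close>

context
  fixes \<nu> \<alpha> :: real and p :: "real \<Rightarrow> 'a::euclidean_space \<Rightarrow> real"
  assumes \<nu>: "0 < \<nu>" and \<alpha>: "0 < \<alpha>" and p: "stable_transition_density \<nu> \<alpha> p"
begin

text \<open>Comes from joint continuity; the indicator removes the times s \<le> 0, at which the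
  values of \<open>p\<close> are arbitrary.\<close>

lemma stable_density_jointly_measurable:
  "(\<lambda>(s, x). indicator {0<..} s * p s x) \<in> borel_measurable (borel \<Otimes>\<^sub>M borel)"
proof -
  have c: "continuous_on ({0<..} \<times> UNIV) (\<lambda>(s, x). p s x)"
    using p by (simp add: stable_transition_density_def)
  have S: "({0<..} \<times> UNIV :: (real \<times> 'a) set) \<in> sets borel"
    unfolding borel_prod[symmetric] by measurable
  have "set_borel_measurable borel ({0<..} \<times> UNIV) (\<lambda>(s, x). p s x)"
    by (rule borel_measurable_continuous_on_indicator[OF S c, folded set_borel_measurable_def])
  then have "(\<lambda>z. indicator ({0<..} \<times> UNIV) z *\<^sub>R (case z of (s, x) \<Rightarrow> p s x)) \<in> borel_measurable borel"
    by (simp add: set_borel_measurable_def)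
  also have "(\<lambda>z. indicator ({0<..} \<times> UNIV) z *\<^sub>R (case z of (s, x) \<Rightarrow> p s x)) =
      (\<lambda>(s, x). indicator {0<..} s * p s x)"
    by (auto simp: fun_eq_iff indicator_def)
  finally show ?thesis by (simp add: borel_prod)
qed

context
  fixes s :: real assumes s: "0 < s"
begin

lemma stable_density_nonneg: "0 \<le> p s x"
  using p s by (simp add: stable_transition_density_def)

lemma stable_density_integrable: "integrable lborel (p s)"
  using p s by (simp add: stable_transition_density_def)

lemma stable_density_measurable: "p s \<in> borel_measurable borel"
  using borel_measurable_integrable[OF stable_density_integrable] by simp

lemma stable_density_fourier:
  "(LINT x|lborel. iexp (\<xi> \<bullet> x) * complex_of_real (p s x)) = complex_of_real (exp (- (s * \<nu> * norm \<xi> powr \<alpha>)))"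
  using p s by (simp add: stable_transition_density_def)

lemma stable_density_integral: "(LINT x|lborel. p s x) = 1"
proof -
  have "complex_of_real (LINT x|lborel. p s x) = 1"
    using stable_density_fourier[of 0] by simp
  then show ?thesis by simp
qed

lemma stable_density_total: "(\<integral>\<^sup>+x. ennreal (p s x) \<partial>lborel) = 1"
  using nn_integral_eq_integral[OF stable_density_integrable] stable_density_nonneg stable_density_integral
  by simp

text \<open>The real part of the Fourier transform evaluates the integral to 1 - exp(-z) with z = s
  \<nu> |\<xi>|^\<alpha>, and this is at most z.\<close>

lemma stable_density_one_minus_cos:
  "(\<integral>\<^sup>+x. ennreal (p s x * (1 - cos (\<xi> \<bullet> x))) \<partial>lborel) \<le> ennreal (s * \<nu> * norm \<xi> powr \<alpha>)"
proof -
  note [measurable] = stable_density_measurable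
  have ic: "integrable lborel (\<lambda>x. iexp (\<xi> \<bullet> x) * complex_of_real (p s x))"
  proof (rule Bochner_Integration.integrable_bound[OF stable_density_integrable])
    show "(\<lambda>x. iexp (\<xi> \<bullet> x) * complex_of_real (p s x)) \<in> borel_measurable lborel"
      by measurable
  qed (simp add: norm_mult)
  have re: "Re (iexp (\<xi> \<bullet> x) * complex_of_real (p s x)) = p s x * cos (\<xi> \<bullet> x)" for x
    by (simp add: Re_exp)
  have i: "integrable lborel (\<lambda>x. p s x * cos (\<xi> \<bullet> x))"
    using integrable_Re[OF ic] unfolding re .
  have "(LINT x|lborel. p s x * cos (\<xi> \<bullet> x)) = exp (- (s * \<nu> * norm \<xi> powr \<alpha>))"
    using integral_Re[OF ic] unfolding re stable_density_fourier by simp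
  then have "(LINT x|lborel. p s x * (1 - cos (\<xi> \<bullet> x))) = 1 - exp (- (s * \<nu> * norm \<xi> powr \<alpha>))"
    using i stable_density_integrable by (simp add: right_diff_distrib stable_density_integral)
  also have "\<dots> \<le> s * \<nu> * norm \<xi> powr \<alpha>"
    using exp_ge_add_one_self[of "- (s * \<nu> * norm \<xi> powr \<alpha>)"] by simp
  finally have le: "(LINT x|lborel. p s x * (1 - cos (\<xi> \<bullet> x))) \<le> s * \<nu> * norm \<xi> powr \<alpha>" .
  have "(\<integral>\<^sup>+x. ennreal (p s x * (1 - cos (\<xi> \<bullet> x))) \<partial>lborel) =
      ennreal (LINT x|lborel. p s x * (1 - cos (\<xi> \<bullet> x)))"
    using i stable_density_integrable stable_density_nonneg
    by (intro nn_integral_eq_integral) (auto simp: right_diff_distrib intro!: mult_left_le)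
  then show ?thesis using le by (simp add: ennreal_leI)
qed

text \<open>Truncation inequality: \<open>1 - cos (n * y)\<close> has mean at least \<open>1/2\<close> over \<open>n \<in> [0,1]\<close>
  as soon as \<open>\<bar>y\<bar> \<ge> 2\<close>.\<close>

lemma stable_density_tail:
  assumes b: "b \<in> Basis" and R: "0 < R"
  shows "(\<integral>\<^sup>+x\<in>{x. 2 * R \<le> \<bar>x \<bullet> b\<bar>}. ennreal (p s x) \<partial>lborel) \<le> ennreal (2 * (s * \<nu> * R powr (- \<alpha>)))"
proof -
  note [measurable] = stable_density_measurable
  let ?T = "\<integral>\<^sup>+x\<in>{x. 2 * R \<le> \<bar>x \<bullet> b\<bar>}. ennreal (p s x) \<partial>lborel"
  \<comment> \<open>The test frequencies are (n / R) b with n in [0,1]. Their norm is at most 1 / R,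
    which yields the factor R^(-\<alpha>), and |x . b| \<ge> 2 R makes the argument y = (b . x) / R
    at least 2 in modulus.\<close>
  define h where "h n x = ennreal (p s x * (1 - cos (((n / R) *\<^sub>R b) \<bullet> x))) * indicator {0..1} n" for n :: real and x
  have hm[measurable]: "(\<lambda>(n, x). h n x) \<in> borel_measurable (lborel \<Otimes>\<^sub>M lborel)"
    unfolding h_def by measurable
  have "?T * ennreal (1 / 2) = (\<integral>\<^sup>+x. ennreal (p s x) * indicator {x. 2 * R \<le> \<bar>x \<bullet> b\<bar>} x * ennreal (1 / 2) \<partial>lborel)"
    by (subst nn_integral_multc) auto
  also have "\<dots> \<le> (\<integral>\<^sup>+x. (\<integral>\<^sup>+n. h n x \<partial>lborel) \<partial>lborel)"
  proof (rule nn_integral_mono)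
    fix x :: 'a
    show "ennreal (p s x) * indicator {x. 2 * R \<le> \<bar>x \<bullet> b\<bar>} x * ennreal (1 / 2) \<le> (\<integral>\<^sup>+n. h n x \<partial>lborel)"
    proof (cases "2 * R \<le> \<bar>x \<bullet> b\<bar>")
      case True
      then have y: "2 \<le> \<bar>(b \<bullet> x) / R\<bar>" using R by (simp add: abs_divide field_simps inner_commute)
      have "ennreal (p s x) * ennreal (1 / 2) \<le>
          ennreal (p s x) * (\<integral>\<^sup>+n\<in>{0..1}. ennreal (1 - cos (n * ((b \<bullet> x) / R))) \<partial>lborel)"
        by (intro mult_left_mono nn_integral_one_minus_cos[OF y]) simp
      also have "\<dots> = (\<integral>\<^sup>+n. ennreal (p s x) * (ennreal (1 - cos (n * ((b \<bullet> x) / R))) * indicator {0..1} n) \<partial>lborel)"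
        by (subst nn_integral_cmult) auto
      also have "\<dots> = (\<integral>\<^sup>+n. h n x \<partial>lborel)"
        by (intro nn_integral_cong) (simp add: h_def ennreal_mult' stable_density_nonneg mult.assoc)
      finally show ?thesis using True by simp
    qed simp
  qed
  also have "\<dots> = (\<integral>\<^sup>+n. (\<integral>\<^sup>+x. h n x \<partial>lborel) \<partial>lborel)"
    by (rule lborel_pair.Fubini') measurable
  also have "\<dots> \<le> (\<integral>\<^sup>+n. ennreal (s * \<nu> * R powr (- \<alpha>)) * indicator {0..1::real} n \<partial>lborel)"
  proof (rule nn_integral_mono)
    fix n :: real
    show "(\<integral>\<^sup>+x. h n x \<partial>lborel) \<le> ennreal (s * \<nu> * R powr (- \<alpha>)) * indicator {0..1} n"
    proof (cases "n \<in> {0..1}")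
      case True
      have "(\<integral>\<^sup>+x. h n x \<partial>lborel) = (\<integral>\<^sup>+x. ennreal (p s x * (1 - cos (((n / R) *\<^sub>R b) \<bullet> x))) \<partial>lborel)"
        using True by (simp add: h_def)
      also have "\<dots> \<le> ennreal (s * \<nu> * norm ((n / R) *\<^sub>R b) powr \<alpha>)"
        by (rule stable_density_one_minus_cos)
      also have "\<dots> \<le> ennreal (s * \<nu> * R powr (- \<alpha>))"
      proof -
        have "norm ((n / R) *\<^sub>R b) \<le> inverse R" using True R b by (simp add: field_simps)
        then have "norm ((n / R) *\<^sub>R b) powr \<alpha> \<le> inverse R powr \<alpha>" using \<alpha> by (intro powr_mono2) auto
        also have "\<dots> = R powr (- \<alpha>)" using R by (simp add: powr_minus inverse_powr)
        finally show ?thesis using s \<nu> by (intro ennreal_leI mult_left_mono) auto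
      qed
      finally show ?thesis using True by simp
    qed (simp add: h_def)
  qed
  also have "\<dots> = ennreal (s * \<nu> * R powr (- \<alpha>))"
    by (subst nn_integral_cmult_indicator) auto
  finally have "?T * ennreal (1 / 2) \<le> ennreal (s * \<nu> * R powr (- \<alpha>))" .
  then have "?T * ennreal (1 / 2) * ennreal 2 \<le> ennreal (s * \<nu> * R powr (- \<alpha>)) * ennreal 2"
    by (rule mult_right_mono) simp
  moreover have "?T * ennreal (1 / 2) * ennreal 2 = ?T"
  proof -
    have "ennreal (1 / 2) * ennreal 2 = ennreal (1 / 2 * 2)" by (rule ennreal_mult[symmetric]) auto
    then have "ennreal (1 / 2) * ennreal 2 = 1" by simp
    then show ?thesis by (simp only: mult.assoc mult_1_right)
  qed
  moreover have "ennreal (s * \<nu> * R powr (- \<alpha>)) * ennreal 2 = ennreal (2 * (s * \<nu> * R powr (- \<alpha>)))"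
    by (subst mult.commute[of 2], rule ennreal_mult[symmetric]) (use s \<nu> in auto)
  ultimately show ?thesis by (simp only:)
qed

text \<open>Union bound over the coordinates: a point outside the box has some coordinate of size at
  least 2 R, and the hypothesis makes the sum of the coordinate tails at most 1/2.\<close>

lemma stable_density_box:
  assumes R: "0 < R" and le: "4 * (real DIM('a) * (s * \<nu> * R powr (- \<alpha>))) \<le> 1"
  shows "ennreal (1 / 2) \<le> (\<integral>\<^sup>+x\<in>box (- (2 * R) *\<^sub>R One) ((2 * R) *\<^sub>R One). ennreal (p s x) \<partial>lborel)"
proof -
  note [measurable] = stable_density_measurable
  let ?B = "box (- (2 * R) *\<^sub>R One) ((2 * R) *\<^sub>R One) :: 'a set"
  have "1 = (\<integral>\<^sup>+x. ennreal (p s x) \<partial>lborel)" by (simp add: stable_density_total)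
  also have "\<dots> \<le> (\<integral>\<^sup>+x. ennreal (p s x) * indicator ?B x +
      (\<Sum>b\<in>Basis. ennreal (p s x) * indicator {x. 2 * R \<le> \<bar>x \<bullet> b\<bar>} x) \<partial>lborel)"
  proof (rule nn_integral_mono)
    fix x :: 'a
    show "ennreal (p s x) \<le> ennreal (p s x) * indicator ?B x +
      (\<Sum>b\<in>Basis. ennreal (p s x) * indicator {x. 2 * R \<le> \<bar>x \<bullet> b\<bar>} x)"
    proof (cases "x \<in> ?B")
      case False
      then obtain b where b: "b \<in> Basis" "2 * R \<le> \<bar>x \<bullet> b\<bar>"
        by (force simp: mem_box inner_diff_left inner_minus_left inner_sum_left_Basis abs_if split: if_splits)
      then have "ennreal (p s x) = ennreal (p s x) * indicator {x. 2 * R \<le> \<bar>x \<bullet> b\<bar>} x" by simp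
      also have "\<dots> \<le> (\<Sum>b\<in>Basis. ennreal (p s x) * indicator {x. 2 * R \<le> \<bar>x \<bullet> b\<bar>} x)"
        by (rule member_le_sum) (use b in auto)
      finally show ?thesis by (simp add: add_increasing)
    qed simp
  qed
  also have "\<dots> = (\<integral>\<^sup>+x\<in>?B. ennreal (p s x) \<partial>lborel) +
      (\<Sum>b\<in>Basis. (\<integral>\<^sup>+x\<in>{x. 2 * R \<le> \<bar>x \<bullet> b\<bar>}. ennreal (p s x) \<partial>lborel))"
    by (subst nn_integral_add, measurable) (subst nn_integral_sum, measurable)
  also have "\<dots> \<le> (\<integral>\<^sup>+x\<in>?B. ennreal (p s x) \<partial>lborel) +
      (\<Sum>b\<in>(Basis::'a set). ennreal (2 * (s * \<nu> * R powr (- \<alpha>))))"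
    by (intro add_left_mono sum_mono stable_density_tail R)
  also have "(\<Sum>b\<in>(Basis::'a set). ennreal (2 * (s * \<nu> * R powr (- \<alpha>)))) =
      ennreal (real DIM('a) * (2 * (s * \<nu> * R powr (- \<alpha>))))"
    using s \<nu> by (subst sum_ennreal) auto
  also have "\<dots> \<le> ennreal (1 / 2)" using le by (intro ennreal_leI) simp
  finally have "1 \<le> (\<integral>\<^sup>+x\<in>?B. ennreal (p s x) \<partial>lborel) + ennreal (1 / 2)" by (simp add: add_left_mono)
  then have "ennreal (1 / 2) + ennreal (1 / 2) \<le> ennreal (1 / 2) + (\<integral>\<^sup>+x\<in>?B. ennreal (p s x) \<partial>lborel)"
    by (simp only: ennreal_half_add_half add.commute)
  then show ?thesis by (simp only: ennreal_add_left_cancel_le ennreal_neq_top simp_thms infinity_ennreal_def)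
qed

end

end

text \<open>Cauchy-Schwarz on \<open>B\<close>, obtained by integrating 2 l g \<le> g^2 + l^2 with
  the optimal l = m / V. In this form it needs no finiteness of the integral of g^2.\<close>

lemma nn_integral_square_ge:
  fixes g :: "'a \<Rightarrow> real"
  assumes [measurable]: "g \<in> borel_measurable M" "B \<in> sets M" and g: "\<And>x. 0 \<le> g x"
    and V: "emeasure M B = ennreal V" "0 < V"
    and m: "0 \<le> m" "ennreal m \<le> (\<integral>\<^sup>+x\<in>B. ennreal (g x) \<partial>M)"
  shows "ennreal (m\<^sup>2 / V) \<le> (\<integral>\<^sup>+x. ennreal ((g x)\<^sup>2) \<partial>M)"
proof -
  define l where "l = m / V"
  have l: "0 \<le> l" using m V by (simp add: l_def)
  have "ennreal (2 * l) * ennreal m \<le> ennreal (2 * l) * (\<integral>\<^sup>+x\<in>B. ennreal (g x) \<partial>M)"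
    by (intro mult_left_mono m) simp
  also have "\<dots> = (\<integral>\<^sup>+x. ennreal (2 * l) * (ennreal (g x) * indicator B x) \<partial>M)"
    by (subst nn_integral_cmult) auto
  also have "\<dots> \<le> (\<integral>\<^sup>+x. ennreal ((g x)\<^sup>2) + ennreal (l\<^sup>2) * indicator B x \<partial>M)"
  proof (rule nn_integral_mono)
    fix x
    have "0 \<le> (g x - l)\<^sup>2" by simp
    then have "2 * l * g x \<le> (g x)\<^sup>2 + l\<^sup>2" by (simp add: power2_diff mult_ac)
    then have "ennreal (2 * l * g x) \<le> ennreal ((g x)\<^sup>2 + l\<^sup>2)" by (rule ennreal_leI)
    also have "\<dots> = ennreal ((g x)\<^sup>2) + ennreal (l\<^sup>2)" by (rule ennreal_plus) auto
    finally show "ennreal (2 * l) * (ennreal (g x) * indicator B x) \<le> ennreal ((g x)\<^sup>2) + ennreal (l\<^sup>2) * indicator B x"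
      using l g by (cases "x \<in> B") (auto simp: ennreal_mult)
  qed
  also have "\<dots> = (\<integral>\<^sup>+x. ennreal ((g x)\<^sup>2) \<partial>M) + ennreal (l\<^sup>2) * ennreal V"
    by (subst nn_integral_add) (auto simp: nn_integral_cmult_indicator V(1))
  also have "ennreal (l\<^sup>2) * ennreal V = ennreal (l\<^sup>2 * V)"
    using V by (simp add: ennreal_mult)
  also have "l\<^sup>2 * V = m\<^sup>2 / V" using V by (simp add: l_def power2_eq_square)
  also have "ennreal (2 * l) * ennreal m = ennreal (2 * l * m)" by (rule ennreal_mult[symmetric]) (use l m in auto)
  also have "2 * l * m = m\<^sup>2 / V + m\<^sup>2 / V" by (simp add: l_def power2_eq_square)
  also have "ennreal \<dots> = ennreal (m\<^sup>2 / V) + ennreal (m\<^sup>2 / V)"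
    by (rule ennreal_plus) (use V in auto)
  finally have "ennreal (m\<^sup>2 / V) + ennreal (m\<^sup>2 / V) \<le> ennreal (m\<^sup>2 / V) + (\<integral>\<^sup>+x. ennreal ((g x)\<^sup>2) \<partial>M)"
    by (simp only: add.commute)
  then show ?thesis by (simp only: ennreal_add_left_cancel_le ennreal_neq_top simp_thms infinity_ennreal_def)
qed

section \<open>The time-changed kernel and its second power\<close>

context
  fixes \<nu> \<alpha> \<beta> :: real and p :: "real \<Rightarrow> 'a::euclidean_space \<Rightarrow> real"
    and N :: "'b measure" and D :: "real \<Rightarrow> 'b \<Rightarrow> real" and f :: "real \<Rightarrow> real \<Rightarrow> real"
  assumes \<nu>: "0 < \<nu>" and \<alpha>: "0 < \<alpha>" and p: "stable_transition_density \<nu> \<alpha> p"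
    and D: "stable_subordinator N \<beta> D" and f: "first_passage_density N D f"
begin

context
  fixes r :: real assumes r: "0 < r"
begin

lemma kernel_integrand_measurable:
  "(\<lambda>(x, s). indicator {0<..} s * p s x * f r s) \<in> borel_measurable (borel \<Otimes>\<^sub>M borel)"
proof -
  note [measurable] = stable_density_jointly_measurable[OF \<nu> \<alpha> p] passage_density_measurable[OF D f r]
  have "(\<lambda>(x, s). (\<lambda>(s, x). indicator {0<..} s * p s x) (s, x)) \<in> borel_measurable (borel \<Otimes>\<^sub>M borel)"
    by measurable
  then have [measurable]: "(\<lambda>(x, s). indicator {0<..} s * p s x) \<in> borel_measurable (borel \<Otimes>\<^sub>M borel)" by simp
  show ?thesis by measurable
qed

lemma time_changed_density_eq:
  "time_changed_density p f r x = (LINT s|lborel. indicator {0<..} s * p s x * f r s)"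
  by (simp add: time_changed_density_def set_lebesgue_integral_def mult.assoc)

lemma time_changed_density_measurable: "time_changed_density p f r \<in> borel_measurable borel"
proof -
  have [measurable]: "(\<lambda>(x, s). indicator {0<..} s * p s x * f r s) \<in> borel_measurable (borel \<Otimes>\<^sub>M lborel)"
    using kernel_integrand_measurable by (simp cong: measurable_cong_sets sets_pair_measure_cong)
  show ?thesis unfolding time_changed_density_eq[abs_def]
    by (rule lborel.borel_measurable_lebesgue_integral) measurable
qed

lemma kernel_integrand_nonneg: "0 \<le> indicator {0<..} s * p s x * f r s"
  using stable_density_nonneg[OF \<nu> \<alpha> p, of s x] passage_density_nonneg[OF D f r, of s]
  by (cases "0 < s") (auto simp: indicator_def)

lemma time_changed_density_nonneg: "0 \<le> time_changed_density p f r x"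
  unfolding time_changed_density_eq by (intro Bochner_Integration.integral_nonneg kernel_integrand_nonneg)

text \<open>The kernel is defined by a Bochner integral, which would be 0 in the absence of
  integrability. Tonelli with constant weight 1 gives total mass 1, so the integrand is integrable
  in \<open>s\<close> for almost every \<open>x\<close>; there both integrals agree, and Tonelli can
  be applied with the weight \<open>h\<close>.\<close>

lemma time_changed_density_nn_integral:
  assumes h[measurable]: "h \<in> borel_measurable borel"
  shows "(\<integral>\<^sup>+x. ennreal (time_changed_density p f r x) * h x \<partial>lborel) =
    (\<integral>\<^sup>+s\<in>{0<..}. ennreal (f r s) * (\<integral>\<^sup>+x. ennreal (p s x) * h x \<partial>lborel) \<partial>lborel)"
proof -
  define H where "H x s = indicator {0<..} s * p s x * f r s" for x s
  have Hm[measurable]: "(\<lambda>(x, s). H x s) \<in> borel_measurable (lborel \<Otimes>\<^sub>M lborel)"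
    using kernel_integrand_measurable by (simp add: H_def cong: measurable_cong_sets sets_pair_measure_cong)
  note [measurable] = passage_density_measurable[OF D f r]
  have H0: "0 \<le> H x s" for x s unfolding H_def by (rule kernel_integrand_nonneg)
  have swap: "(\<integral>\<^sup>+x. (\<integral>\<^sup>+s. ennreal (H x s) \<partial>lborel) * k x \<partial>lborel) =
    (\<integral>\<^sup>+s\<in>{0<..}. ennreal (f r s) * (\<integral>\<^sup>+x. ennreal (p s x) * k x \<partial>lborel) \<partial>lborel)"
    if k[measurable]: "k \<in> borel_measurable borel" for k :: "'a \<Rightarrow> ennreal"
  proof -
    have "(\<integral>\<^sup>+x. (\<integral>\<^sup>+s. ennreal (H x s) \<partial>lborel) * k x \<partial>lborel) = (\<integral>\<^sup>+x. (\<integral>\<^sup>+s. ennreal (H x s) * k x \<partial>lborel) \<partial>lborel)"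
      by (intro nn_integral_cong nn_integral_multc[symmetric]) measurable
    also have "\<dots> = (\<integral>\<^sup>+s. (\<integral>\<^sup>+x. ennreal (H x s) * k x \<partial>lborel) \<partial>lborel)"
      by (rule lborel_pair.Fubini'[symmetric]) measurable
    also have "\<dots> = (\<integral>\<^sup>+s\<in>{0<..}. ennreal (f r s) * (\<integral>\<^sup>+x. ennreal (p s x) * k x \<partial>lborel) \<partial>lborel)"
    proof (rule nn_integral_cong)
      fix s :: real
      show "(\<integral>\<^sup>+x. ennreal (H x s) * k x \<partial>lborel) =
        ennreal (f r s) * (\<integral>\<^sup>+x. ennreal (p s x) * k x \<partial>lborel) * indicator {0<..} s"
      proof (cases "0 < s")
        case True
        note [measurable] = stable_density_measurable[OF \<nu> \<alpha> p True]
        have "(\<integral>\<^sup>+x. ennreal (H x s) * k x \<partial>lborel) = (\<integral>\<^sup>+x. ennreal (f r s) * (ennreal (p s x) * k x) \<partial>lborel)"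
          using True stable_density_nonneg[OF \<nu> \<alpha> p True] passage_density_nonneg[OF D f r]
          by (intro nn_integral_cong) (simp add: H_def ennreal_mult mult_ac)
        then show ?thesis using True by (simp add: nn_integral_cmult)
      qed (simp add: H_def)
    qed
    finally show ?thesis .
  qed
  have "(\<integral>\<^sup>+x. (\<integral>\<^sup>+s. ennreal (H x s) \<partial>lborel) \<partial>lborel) = (\<integral>\<^sup>+s\<in>{0<..}. ennreal (f r s) \<partial>lborel)"
    using swap[of "\<lambda>_. 1"] stable_density_total[OF \<nu> \<alpha> p]
    by (auto simp: indicator_def intro!: nn_integral_cong)
  also have "\<dots> = 1" by (rule passage_density_total[OF D f r])
  finally have "AE x in lborel. (\<integral>\<^sup>+s. ennreal (H x s) \<partial>lborel) \<noteq> \<infinity>"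
    by (intro nn_integral_PInf_AE) auto
  then have "AE x in lborel. ennreal (time_changed_density p f r x) = (\<integral>\<^sup>+s. ennreal (H x s) \<partial>lborel)"
  proof eventually_elim
    case (elim x)
    have [measurable]: "(\<lambda>s. H x s) \<in> borel_measurable lborel" using measurable_Pair2[OF Hm, of x] by simp
    have i: "integrable lborel (\<lambda>s. H x s)"
      using elim H0 by (intro integrableI_nonneg) (auto simp: less_top)
    have "time_changed_density p f r x = (LINT s|lborel. H x s)"
      by (simp only: time_changed_density_eq H_def)
    then show ?case using nn_integral_eq_integral[OF i] H0 by simp
  qed
  then have "(\<integral>\<^sup>+x. ennreal (time_changed_density p f r x) * h x \<partial>lborel) =
      (\<integral>\<^sup>+x. (\<integral>\<^sup>+s. ennreal (H x s) \<partial>lborel) * h x \<partial>lborel)"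
    by (intro nn_integral_cong_AE) (auto elim: eventually_mono)
  then show ?thesis using swap[OF h] by simp
qed

lemma time_changed_density_total: "(\<integral>\<^sup>+x. ennreal (time_changed_density p f r x) \<partial>lborel) = 1"
proof -
  have "(\<integral>\<^sup>+x. ennreal (time_changed_density p f r x) \<partial>lborel) =
    (\<integral>\<^sup>+s\<in>{0<..}. ennreal (f r s) * (\<integral>\<^sup>+x. ennreal (p s x) \<partial>lborel) \<partial>lborel)"
    using time_changed_density_nn_integral[of "\<lambda>_. 1"] by simp
  also have "\<dots> = (\<integral>\<^sup>+s\<in>{0<..}. ennreal (f r s) \<partial>lborel)"
    using stable_density_total[OF \<nu> \<alpha> p] by (intro nn_integral_cong) (auto simp: indicator_def)
  also have "\<dots> = 1" by (rule passage_density_total[OF D f r])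
  finally show ?thesis .
qed

text \<open>With probability at least 1/2 the passage time lies in (0, 3 r^\<beta>], and for each
  such time the box carries mass at least 1/2. The 12 is the 4 of the box estimate times this
  3.\<close>

lemma time_changed_density_box:
  assumes R: "0 < R" and le: "12 * (real DIM('a) * (r powr \<beta> * \<nu> * R powr (- \<alpha>))) \<le> 1"
  shows "ennreal (1 / 4) \<le>
    (\<integral>\<^sup>+x\<in>box (- (2 * R) *\<^sub>R One) ((2 * R) *\<^sub>R One). ennreal (time_changed_density p f r x) \<partial>lborel)"
proof -
  let ?B = "box (- (2 * R) *\<^sub>R One) ((2 * R) *\<^sub>R One) :: 'a set"
  note [measurable] = passage_density_measurable[OF D f r]
  have "ennreal (1 / 4) = ennreal (1 / 2 * (1 / 2))" by simp
  also have "\<dots> = ennreal (1 / 2) * ennreal (1 / 2)" by (rule ennreal_mult) auto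
  also have "\<dots> \<le> (\<integral>\<^sup>+s\<in>{0<..3 * r powr \<beta>}. ennreal (f r s) \<partial>lborel) * ennreal (1 / 2)"
    by (intro mult_right_mono passage_density_half[OF D f r]) simp
  also have "\<dots> = (\<integral>\<^sup>+s. ennreal (f r s) * indicator {0<..3 * r powr \<beta>} s * ennreal (1 / 2) \<partial>lborel)"
    by (rule nn_integral_multc[symmetric]) measurable
  also have "\<dots> \<le> (\<integral>\<^sup>+s\<in>{0<..}. ennreal (f r s) * (\<integral>\<^sup>+x. ennreal (p s x) * indicator ?B x \<partial>lborel) \<partial>lborel)"
  proof (rule nn_integral_mono)
    fix s :: real
    show "ennreal (f r s) * indicator {0<..3 * r powr \<beta>} s * ennreal (1 / 2) \<le>
      ennreal (f r s) * (\<integral>\<^sup>+x. ennreal (p s x) * indicator ?B x \<partial>lborel) * indicator {0<..} s"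
    proof (cases "s \<in> {0<..3 * r powr \<beta>}")
      case True
      then have s: "0 < s" "s \<le> 3 * r powr \<beta>" by auto
      have "4 * (real DIM('a) * (s * \<nu> * R powr (- \<alpha>))) \<le> 4 * (real DIM('a) * (3 * r powr \<beta> * \<nu> * R powr (- \<alpha>)))"
        using s \<nu> by (intro mult_left_mono mult_right_mono) auto
      also have "\<dots> \<le> 1" using le by simp
      finally have "ennreal (1 / 2) \<le> (\<integral>\<^sup>+x. ennreal (p s x) * indicator ?B x \<partial>lborel)"
        by (rule stable_density_box[OF \<nu> \<alpha> p s(1) R])
      then show ?thesis using s by (simp add: mult_left_mono)
    qed simp
  qed
  also have "\<dots> = (\<integral>\<^sup>+x\<in>?B. ennreal (time_changed_density p f r x) \<partial>lborel)"
    by (rule time_changed_density_nn_integral[symmetric]) measurable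
  finally show ?thesis .
qed

end

lemma time_changed_density_square:
  "\<exists>c>0. \<forall>r>0. ennreal (c * r powr (- (\<beta> * real DIM('a) / \<alpha>))) \<le>
    (\<integral>\<^sup>+x. ennreal ((time_changed_density p f r x)\<^sup>2) \<partial>lborel)"
proof -
  define d where "d = DIM('a)"
  have d: "0 < real d" by (simp add: d_def)
  \<comment> \<open>\<open>K\<close> solves 12 d \<nu> K^(-\<alpha>) = 1, so that with R = K
    r^(\<beta>/\<alpha>) the hypothesis of the box estimate holds with equality.\<close>
  define K where "K = (12 * real d * \<nu>) powr (1 / \<alpha>)"
  have K: "0 < K" using d \<nu> by (simp add: K_def)
  have K\<alpha>: "K powr (- \<alpha>) = 1 / (12 * real d * \<nu>)"
    using d \<nu> \<alpha> by (simp add: K_def powr_powr powr_minus_divide)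
  \<comment> \<open>The square of the box mass 1/4, divided by the volume (4 R)^d with the power of
    \<open>r\<close> taken out.\<close>
  define c where "c = (1 / 16) / (4 * K) ^ d"
  show ?thesis
  proof (intro exI[of _ c] conjI allI impI)
    show "0 < c" using K by (simp add: c_def)
    fix r :: real assume r: "0 < r"
    define R where "R = K * r powr (\<beta> / \<alpha>)"
    have R: "0 < R" using K r by (simp add: R_def)
    have "R powr (- \<alpha>) = r powr (- \<beta>) / (12 * real d * \<nu>)"
      using K r \<alpha> by (simp add: R_def powr_mult K\<alpha> powr_powr)
    then have le: "12 * (real DIM('a) * (r powr \<beta> * \<nu> * R powr (- \<alpha>))) \<le> 1"
      using d \<nu> r by (simp add: d_def powr_minus)
    let ?B = "box (- (2 * R) *\<^sub>R One) ((2 * R) *\<^sub>R One) :: 'a set"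
    have side: "((2 * R) *\<^sub>R One - - (2 * R) *\<^sub>R One) \<bullet> b = 4 * R" if "b \<in> Basis" for b :: 'a
      using that by (simp add: inner_add_left)
    have "emeasure lborel ?B = ennreal (\<Prod>b\<in>(Basis::'a set). ((2 * R) *\<^sub>R One - - (2 * R) *\<^sub>R One) \<bullet> b)"
      using R by (intro emeasure_lborel_box) simp
    also have "\<dots> = ennreal (\<Prod>b\<in>(Basis::'a set). 4 * R)"
      by (intro arg_cong[where f=ennreal] prod.cong refl side)
    finally have "emeasure lborel ?B = ennreal (\<Prod>b\<in>(Basis::'a set). 4 * R)" .
    then have V: "emeasure lborel ?B = ennreal ((4 * R) ^ d)" by (simp add: d_def)
    have "ennreal ((1 / 4)\<^sup>2 / (4 * R) ^ d) \<le> (\<integral>\<^sup>+x. ennreal ((time_changed_density p f r x)\<^sup>2) \<partial>lborel)"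
      by (rule nn_integral_square_ge[OF _ _ _ V _ _ time_changed_density_box[OF r R le]])
        (use R time_changed_density_measurable[OF r] time_changed_density_nonneg[OF r] in auto)
    moreover have "(1 / 4)\<^sup>2 / (4 * R) ^ d = c * r powr (- (\<beta> * real DIM('a) / \<alpha>))"
    proof -
      have "(r powr (\<beta> / \<alpha>)) ^ d = r powr (\<beta> * real d / \<alpha>)"
        using r by (simp add: powr_power mult.commute)
      then show ?thesis using r
        by (simp add: c_def R_def power_mult_distrib powr_minus_divide d_def power2_eq_square mult.assoc)
    qed
    ultimately show "ennreal (c * r powr (- (\<beta> * real DIM('a) / \<alpha>))) \<le>
      (\<integral>\<^sup>+x. ennreal ((time_changed_density p f r x)\<^sup>2) \<partial>lborel)" by simp
  qed
qed

end

section \<open>Blow-up\<close>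

text \<open>Jensen's inequality, proved by integrating the tangent line of w^(1+\<gamma>) at w = a
  with w = U^2. The tangent form is valid in [0,infinity] and works with any lower bound
  \<open>a\<close> for the second moment, which may itself be infinite.\<close>

lemma (in prob_space) moment_ge_power:
  fixes U :: "'a \<Rightarrow> real"
  assumes [measurable]: "U \<in> borel_measurable M" and a: "0 < a" and \<gamma>: "0 < \<gamma>"
    and le: "ennreal a \<le> (\<integral>\<^sup>+\<omega>. ennreal ((U \<omega>)\<^sup>2) \<partial>M)"
  shows "ennreal (a powr (1 + \<gamma>)) \<le> (\<integral>\<^sup>+\<omega>. ennreal ((\<bar>U \<omega>\<bar> powr (1 + \<gamma>))\<^sup>2) \<partial>M)"
proof -
  have pt: "((1 + \<gamma>) * a powr \<gamma>) * x\<^sup>2 \<le> (\<bar>x\<bar> powr (1 + \<gamma>))\<^sup>2 + \<gamma> * a powr (1 + \<gamma>)" for x :: real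
  proof (cases "x = 0")
    case True
    then show ?thesis using \<gamma> by simp
  next
    case False
    then have w: "0 < x\<^sup>2" by simp
    have xx: "(\<bar>x\<bar> powr (1 + \<gamma>))\<^sup>2 = (x\<^sup>2) powr (1 + \<gamma>)"
      using False by (simp add: power2_eq_square powr_mult[symmetric] abs_mult[symmetric])
    \<comment> \<open>Young's inequality with weights 1 / (1 + \<gamma>) and \<gamma> / (1 +
      \<gamma>); multiplied by 1 + \<gamma> it is the tangent inequality.\<close>
    have "((x\<^sup>2) powr (1 + \<gamma>)) powr (1 / (1 + \<gamma>)) * (a powr (1 + \<gamma>)) powr (\<gamma> / (1 + \<gamma>)) \<le>
        1 / (1 + \<gamma>) * (x\<^sup>2) powr (1 + \<gamma>) + \<gamma> / (1 + \<gamma>) * a powr (1 + \<gamma>)"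
      using \<gamma> a w by (intro Youngs_inequality_0) (auto simp: field_simps)
    moreover have "((x\<^sup>2) powr (1 + \<gamma>)) powr (1 / (1 + \<gamma>)) = x\<^sup>2"
      using \<gamma> w by (simp add: powr_powr)
    moreover have "(a powr (1 + \<gamma>)) powr (\<gamma> / (1 + \<gamma>)) = a powr \<gamma>"
      using \<gamma> by (simp add: powr_powr)
    ultimately have "x\<^sup>2 * a powr \<gamma> \<le> 1 / (1 + \<gamma>) * (x\<^sup>2) powr (1 + \<gamma>) + \<gamma> / (1 + \<gamma>) * a powr (1 + \<gamma>)"
      by simp
    then have "(1 + \<gamma>) * (x\<^sup>2 * a powr \<gamma>) \<le>
        (1 + \<gamma>) * (1 / (1 + \<gamma>) * (x\<^sup>2) powr (1 + \<gamma>) + \<gamma> / (1 + \<gamma>) * a powr (1 + \<gamma>))"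
      using \<gamma> by (intro mult_left_mono) auto
    also have "\<dots> = (x\<^sup>2) powr (1 + \<gamma>) + \<gamma> * a powr (1 + \<gamma>)" using \<gamma> by (simp add: distrib_left)
    finally show ?thesis by (simp add: xx mult_ac)
  qed
  let ?b = "a powr (1 + \<gamma>)"
  have ab: "a powr \<gamma> * a = ?b" using a by (simp add: powr_add mult.commute)
  have "ennreal ((1 + \<gamma>) * a powr \<gamma>) * ennreal a \<le>
      ennreal ((1 + \<gamma>) * a powr \<gamma>) * (\<integral>\<^sup>+\<omega>. ennreal ((U \<omega>)\<^sup>2) \<partial>M)"
    by (intro mult_left_mono le) simp
  also have "\<dots> = (\<integral>\<^sup>+\<omega>. ennreal ((1 + \<gamma>) * a powr \<gamma>) * ennreal ((U \<omega>)\<^sup>2) \<partial>M)"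
    by (rule nn_integral_cmult[symmetric]) measurable
  also have "\<dots> \<le> (\<integral>\<^sup>+\<omega>. ennreal (\<gamma> * ?b) + ennreal ((\<bar>U \<omega>\<bar> powr (1 + \<gamma>))\<^sup>2) \<partial>M)"
  proof (rule nn_integral_mono)
    fix \<omega>
    have "ennreal ((1 + \<gamma>) * a powr \<gamma>) * ennreal ((U \<omega>)\<^sup>2) = ennreal (((1 + \<gamma>) * a powr \<gamma>) * (U \<omega>)\<^sup>2)"
      by (rule ennreal_mult[symmetric]) (use \<gamma> in auto)
    also have "\<dots> \<le> ennreal (\<gamma> * ?b + (\<bar>U \<omega>\<bar> powr (1 + \<gamma>))\<^sup>2)"
      by (rule ennreal_leI) (use pt[of "U \<omega>"] in simp)
    also have "\<dots> = ennreal (\<gamma> * ?b) + ennreal ((\<bar>U \<omega>\<bar> powr (1 + \<gamma>))\<^sup>2)"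
      by (rule ennreal_plus) (use \<gamma> in auto)
    finally show "ennreal ((1 + \<gamma>) * a powr \<gamma>) * ennreal ((U \<omega>)\<^sup>2) \<le>
      ennreal (\<gamma> * ?b) + ennreal ((\<bar>U \<omega>\<bar> powr (1 + \<gamma>))\<^sup>2)" .
  qed
  also have "\<dots> = ennreal (\<gamma> * ?b) + (\<integral>\<^sup>+\<omega>. ennreal ((\<bar>U \<omega>\<bar> powr (1 + \<gamma>))\<^sup>2) \<partial>M)"
    by (subst nn_integral_add) (auto simp: emeasure_space_1)
  also have "ennreal ((1 + \<gamma>) * a powr \<gamma>) * ennreal a = ennreal ((1 + \<gamma>) * a powr \<gamma> * a)"
    by (rule ennreal_mult[symmetric]) (use \<gamma> a in auto)
  also have "(1 + \<gamma>) * a powr \<gamma> * a = \<gamma> * ?b + ?b" by (simp only: mult.assoc ab) (simp add: algebra_simps)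
  also have "ennreal \<dots> = ennreal (\<gamma> * ?b) + ennreal ?b"
    by (rule ennreal_plus) (use \<gamma> in auto)
  finally show ?thesis
    by (simp only: ennreal_add_left_cancel_le ennreal_neq_top simp_thms infinity_ennreal_def)
qed

lemma lborel_distr_reflect:
  fixes x :: "'a::euclidean_space"
  shows "distr lborel borel (\<lambda>y. x - y) = lborel"
  by (subst (2) lborel_affine[of "-1" x]) (auto simp: density_1)

lemma nn_integral_reflect:
  fixes x :: "'a::euclidean_space" and h :: "'a \<Rightarrow> ennreal"
  assumes [measurable]: "h \<in> borel_measurable borel"
  shows "(\<integral>\<^sup>+y. h (x - y) \<partial>lborel) = (\<integral>\<^sup>+y. h y \<partial>lborel)"
proof -
  have "(\<integral>\<^sup>+y. h y \<partial>lborel) = (\<integral>\<^sup>+y. h y \<partial>distr lborel borel (\<lambda>y. x - y))"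
    by (simp only: lborel_distr_reflect)
  also have "\<dots> = (\<integral>\<^sup>+y. h (x - y) \<partial>lborel)" by (rule nn_integral_distr) measurable
  finally show ?thesis ..
qed

text \<open>Doubling the power each time half of the remaining time has passed: a lower bound \<open>a\<close> for
  the second moment on \<open>(t\<^sub>1, T]\<close> becomes \<open>(t - t\<^sub>1) L a\<^bsup>1+\<gamma>\<^esup>\<close> at time \<open>t\<close>, and the choice
  \<open>Q\<^bsup>\<gamma>\<^esup> = 2\<close> lets the gain in the power absorb the halving of the time step.\<close>

lemma blow_up:
  fixes F :: "real \<Rightarrow> 'a \<Rightarrow> ennreal"
  assumes T: "0 < T" and a0: "0 < a0" and \<gamma>: "0 < \<gamma>" and L: "0 \<le> L"
    and base: "\<And>t x. 0 < t \<Longrightarrow> t \<le> T \<Longrightarrow> ennreal a0 \<le> F t x"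
    and step: "\<And>a t1 t x. 0 < a \<Longrightarrow> 0 \<le> t1 \<Longrightarrow> t1 < t \<Longrightarrow> t \<le> T \<Longrightarrow>
      (\<And>s y. t1 < s \<Longrightarrow> s < t \<Longrightarrow> ennreal a \<le> F s y) \<Longrightarrow>
      ennreal ((t - t1) * (L * a powr (1 + \<gamma>))) \<le> F t x"
    and big: "2 * 2 powr (1 / \<gamma>) \<le> T * L * a0 powr \<gamma>"
  shows "F T x = \<infinity>"
proof -
  define Q :: real where "Q = 2 powr (1 / \<gamma>)"
  have Q1: "1 < Q" using \<gamma> by (simp add: Q_def)
  have Q\<gamma>: "Q powr \<gamma> = 2" using \<gamma> by (simp add: Q_def powr_powr)
  \<comment> \<open>The intervals (T - T / 2^k, T] shrink but all contain T, so at time T the bound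
    holds for every k and exceeds every real number.\<close>
  have claim: "ennreal (a0 * Q ^ k) \<le> F t x" if "T - T / 2 ^ k < t" "0 < t" "t \<le> T" for k t x
    using that
  proof (induction k arbitrary: t x)
    case 0
    then show ?case using base by simp
  next
    case (Suc k)
    define t1 where "t1 = T - T / 2 ^ k"
    have t1: "0 \<le> t1" using T by (simp add: t1_def field_simps)
    have gap: "T / 2 ^ Suc k \<le> t - t1" using Suc.prems(1) by (simp add: t1_def field_simps)
    moreover have "0 < T / 2 ^ Suc k" using T by simp
    ultimately have t1t: "t1 < t" by linarith
    define a where "a = a0 * Q ^ k"
    have a: "0 < a" using a0 Q1 by (simp add: a_def)
    have "ennreal ((t - t1) * (L * a powr (1 + \<gamma>))) \<le> F t x"
    proof (rule step[OF a t1 t1t Suc.prems(3)])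
      fix s y assume s: "t1 < s" "s < t"
      show "ennreal a \<le> F s y"
        unfolding a_def by (rule Suc.IH) (use s t1 Suc.prems in \<open>auto simp: t1_def\<close>)
    qed
    moreover have "a0 * Q ^ Suc k \<le> (t - t1) * (L * a powr (1 + \<gamma>))"
    proof -
      have a\<gamma>: "a powr (1 + \<gamma>) = a * (a0 powr \<gamma> * 2 ^ k)"
      proof -
        have "(Q ^ k) powr \<gamma> = (Q powr \<gamma>) ^ k"
          using Q1 by (simp add: powr_power powr_realpow[symmetric] powr_powr mult.commute)
        then have "a powr \<gamma> = a0 powr \<gamma> * 2 ^ k"
          using a0 Q1 by (simp add: a_def powr_mult Q\<gamma>)
        then show ?thesis using a by (simp add: powr_add)
      qed
      have "a0 * Q ^ Suc k = (1 / 2) * (2 * Q) * a" by (simp add: a_def)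
      also have "\<dots> \<le> (1 / 2) * (T * L * a0 powr \<gamma>) * a"
        using big a by (intro mult_right_mono mult_left_mono) (auto simp: Q_def)
      also have "\<dots> = (T / 2 ^ Suc k) * (L * a powr (1 + \<gamma>))" by (simp add: a\<gamma>)
      also have "\<dots> \<le> (t - t1) * (L * a powr (1 + \<gamma>))"
        using gap L by (intro mult_right_mono) auto
      finally show ?thesis .
    qed
    ultimately show ?case by (meson ennreal_leI order_trans)
  qed
  have "ennreal B \<le> F T x" for B
  proof -
    obtain k where k: "B / a0 < Q ^ k" using real_arch_pow[OF Q1] by blast
    then have "B \<le> a0 * Q ^ k" using a0 by (simp add: field_simps)
    then have "ennreal B \<le> ennreal (a0 * Q ^ k)" by (rule ennreal_leI)
    also have "\<dots> \<le> F T x" by (rule claim) (use T in auto)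
    finally show ?thesis .
  qed
  then have le: "ennreal (enn2real (F T x) + 1) \<le> F T x" .
  show ?thesis
  proof (rule ccontr)
    assume "F T x \<noteq> \<infinity>"
    then have "F T x = ennreal (enn2real (F T x))" by (simp add: less_top)
    then have "ennreal (enn2real (F T x) + 1) \<le> ennreal (enn2real (F T x))" using le by simp
    then show False by (simp add: ennreal_le_iff)
  qed
qed

text \<open>By Tonelli the expectation may be taken first: at a point (s, y) with t1 < s < t it is
  at least G^2 a^(1+\<gamma>), by the growth of \<sigma> and the convexity bound. Integration over y
  gives at least L a^(1+\<gamma>) after reflection of the kernel, and the times s contribute the
  length t - t1.\<close>

lemma (in noise_space) walsh_energy_lower_bound:
  fixes G :: "real \<Rightarrow> 'a \<Rightarrow> real" and \<sigma> :: "real \<Rightarrow> real" and u :: "real \<Rightarrow> 'a \<Rightarrow> 'o \<Rightarrow> real"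
  defines "\<Phi> t x \<equiv> (\<lambda>(s, y) \<omega>. indicator {0<..<t} s * (G (t - s) (x - y) * \<sigma> (u s y \<omega>)))"
  assumes \<Phi>: "(\<lambda>(z, \<omega>). \<Phi> t x z \<omega>) \<in> borel_measurable (lborel \<Otimes>\<^sub>M M)"
    and G: "\<And>r. 0 < r \<Longrightarrow> G r \<in> borel_measurable borel"
    and u: "\<And>s y. 0 \<le> s \<Longrightarrow> u s y \<in> borel_measurable M"
    and \<sigma>: "\<And>v. \<bar>v\<bar> powr (1 + \<gamma>) \<le> \<sigma> v" and \<gamma>: "0 < \<gamma>"
    and L: "0 \<le> L" "\<And>r. 0 < r \<Longrightarrow> r \<le> t \<Longrightarrow> ennreal L \<le> (\<integral>\<^sup>+y. ennreal ((G r y)\<^sup>2) \<partial>lborel)"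
    and t: "0 \<le> t1" "t1 < t" and a: "0 < a"
    and lower: "\<And>s y. t1 < s \<Longrightarrow> s < t \<Longrightarrow> ennreal a \<le> (\<integral>\<^sup>+\<omega>. ennreal ((u s y \<omega>)\<^sup>2) \<partial>M)"
  shows "ennreal ((t - t1) * (L * a powr (1 + \<gamma>))) \<le>
    (\<integral>\<^sup>+\<omega>. (\<integral>\<^sup>+z. ennreal ((\<Phi> t x z \<omega>)\<^sup>2) \<partial>lborel) \<partial>M)"
proof -
  interpret P: pair_sigma_finite lborel M ..
  note [measurable] = \<Phi>
  let ?a = "a powr (1 + \<gamma>)"
  define h where "h z = (\<integral>\<^sup>+\<omega>. ennreal ((\<Phi> t x z \<omega>)\<^sup>2) \<partial>M)" for z
  have hm: "h \<in> borel_measurable lborel" unfolding h_def by measurable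
  then have hm': "h \<in> borel_measurable (lborel \<Otimes>\<^sub>M lborel)" by (simp add: lborel_prod)
  have h_ge: "ennreal ?a * ennreal ((G (t - s) (x - y))\<^sup>2) \<le> h (s, y)" if s: "t1 < s" "s < t" for s y
  proof -
    have s0: "0 \<le> s" using s t by simp
    note [measurable] = u[OF s0, of y]
    have "ennreal ?a * ennreal ((G (t - s) (x - y))\<^sup>2) =
        ennreal ((G (t - s) (x - y))\<^sup>2) * ennreal ?a" by (rule mult.commute)
    also have "\<dots> \<le> ennreal ((G (t - s) (x - y))\<^sup>2) * (\<integral>\<^sup>+\<omega>. ennreal ((\<bar>u s y \<omega>\<bar> powr (1 + \<gamma>))\<^sup>2) \<partial>M)"
      by (intro mult_left_mono moment_ge_power[OF u[OF s0] a \<gamma> lower[OF s]]) simp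
    also have "\<dots> = (\<integral>\<^sup>+\<omega>. ennreal ((G (t - s) (x - y))\<^sup>2) * ennreal ((\<bar>u s y \<omega>\<bar> powr (1 + \<gamma>))\<^sup>2) \<partial>M)"
      by (rule nn_integral_cmult[symmetric]) measurable
    also have "\<dots> \<le> h (s, y)"
      unfolding h_def
    proof (rule nn_integral_mono)
      fix \<omega>
      have "(\<bar>u s y \<omega>\<bar> powr (1 + \<gamma>))\<^sup>2 \<le> (\<sigma> (u s y \<omega>))\<^sup>2" by (intro power_mono \<sigma>) simp
      then have "(G (t - s) (x - y))\<^sup>2 * (\<bar>u s y \<omega>\<bar> powr (1 + \<gamma>))\<^sup>2 \<le> (\<Phi> t x (s, y) \<omega>)\<^sup>2"
        using s t by (simp add: \<Phi>_def power_mult_distrib mult_left_mono)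
      then have "ennreal ((G (t - s) (x - y))\<^sup>2 * (\<bar>u s y \<omega>\<bar> powr (1 + \<gamma>))\<^sup>2) \<le> ennreal ((\<Phi> t x (s, y) \<omega>)\<^sup>2)"
        by (rule ennreal_leI)
      then show "ennreal ((G (t - s) (x - y))\<^sup>2) * ennreal ((\<bar>u s y \<omega>\<bar> powr (1 + \<gamma>))\<^sup>2) \<le> ennreal ((\<Phi> t x (s, y) \<omega>)\<^sup>2)"
        by (subst ennreal_mult[symmetric]) auto
    qed
    finally show ?thesis .
  qed
  have "ennreal ((t - t1) * (L * ?a)) = ennreal (L * ?a) * ennreal (t - t1)"
    by (subst mult.commute, rule ennreal_mult) (use L t in auto)
  also have "\<dots> = (\<integral>\<^sup>+s. ennreal (L * ?a) * indicator {t1<..<t} s \<partial>lborel)"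
    using t by (subst nn_integral_cmult_indicator) auto
  also have "\<dots> \<le> (\<integral>\<^sup>+s. (\<integral>\<^sup>+y. h (s, y) \<partial>lborel) \<partial>lborel)"
  proof (rule nn_integral_mono)
    fix s :: real
    show "ennreal (L * ?a) * indicator {t1<..<t} s \<le> (\<integral>\<^sup>+y. h (s, y) \<partial>lborel)"
    proof (cases "s \<in> {t1<..<t}")
      case True
      then have s: "t1 < s" "s < t" by auto
      then have r: "0 < t - s" "t - s \<le> t" using t by auto
      note [measurable] = G[OF r(1)]
      have "ennreal (L * ?a) = ennreal ?a * ennreal L"
        by (subst mult.commute, rule ennreal_mult) (use L in auto)
      also have "\<dots> \<le> ennreal ?a * (\<integral>\<^sup>+y. ennreal ((G (t - s) y)\<^sup>2) \<partial>lborel)"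
        by (intro mult_left_mono L(2) r) simp
      also have "(\<integral>\<^sup>+y. ennreal ((G (t - s) y)\<^sup>2) \<partial>lborel) = (\<integral>\<^sup>+y. ennreal ((G (t - s) (x - y))\<^sup>2) \<partial>lborel)"
        by (rule nn_integral_reflect[symmetric]) measurable
      also have "ennreal ?a * \<dots> = (\<integral>\<^sup>+y. ennreal ?a * ennreal ((G (t - s) (x - y))\<^sup>2) \<partial>lborel)"
        by (rule nn_integral_cmult[symmetric]) measurable
      also have "\<dots> \<le> (\<integral>\<^sup>+y. h (s, y) \<partial>lborel)"
        by (intro nn_integral_mono h_ge s)
      finally show ?thesis using True by simp
    qed simp
  qed
  also have "\<dots> = (\<integral>\<^sup>+z. h z \<partial>(lborel \<Otimes>\<^sub>M lborel))" by (rule lborel.nn_integral_fst[OF hm'])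
  also have "\<dots> = (\<integral>\<^sup>+z. h z \<partial>lborel)" by (simp add: lborel_prod)
  also have "\<dots> = (\<integral>\<^sup>+\<omega>. (\<integral>\<^sup>+z. ennreal ((\<Phi> t x z \<omega>)\<^sup>2) \<partial>lborel) \<partial>M)"
    unfolding h_def by (rule P.Fubini'[symmetric]) measurable
  finally show ?thesis .
qed

theorem theorem1p2:
  fixes \<nu> \<beta> \<alpha> \<gamma> \<kappa> :: real
    and \<sigma> :: "real \<Rightarrow> real"
    and p :: "real \<Rightarrow> 'a::euclidean_space \<Rightarrow> real"
    and N :: "'b measure" and D :: "real \<Rightarrow> 'b \<Rightarrow> real" and f :: "real \<Rightarrow> real \<Rightarrow> real"
    and M :: "'o measure" and W :: "(real \<times> 'a) set \<Rightarrow> 'o \<Rightarrow> real"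
    and u0 :: "'a \<Rightarrow> real" and u :: "real \<Rightarrow> 'a \<Rightarrow> 'o \<Rightarrow> real"
  assumes "\<nu> > 0" and "0 < \<beta>" "\<beta> < 1" and "0 < \<alpha>" "\<alpha> < 2"
    and "real DIM('a) < min 2 (1 / \<beta>) * \<alpha>"
    and "locally_lipschitz \<sigma>"
    and "\<gamma> > 0" and "\<And>x. \<sigma> x \<ge> \<bar>x\<bar> powr (1 + \<gamma>)"
    and "\<And>x. 0 \<le> u0 x" and "bounded (range u0)" and "u0 \<in> borel_measurable borel"
    and "\<kappa> = (INF x. u0 x)" and "\<kappa> > 0"
    and "stable_transition_density \<nu> \<alpha> p"
    and "stable_subordinator N \<beta> D"
    and "first_passage_density N D f"
    and "prob_space M" and "white_noise M W"
    and "mild_solution M W (time_changed_density p f) \<sigma> u0 u"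
  shows "\<exists>t0>0. \<forall>x. \<forall>t\<ge>t0. (\<integral>\<^sup>+\<omega>. ennreal (\<bar>u t x \<omega>\<bar>\<^sup>2) \<partial>M) = \<infinity>"
proof -
  interpret prob_space M by fact
  interpret noise_space M W by unfold_locales fact
  note kernel = assms(1,4,15-17)
  define G where "G = time_changed_density p f"
  define \<Phi> where "\<Phi> t x = (\<lambda>(s, y) \<omega>. indicator {0<..<t} s * (G (t - s) (x - y) * \<sigma> (u s y \<omega>)))" for t x
  define F where "F t x = (\<integral>\<^sup>+\<omega>. ennreal ((u t x \<omega>)\<^sup>2) \<partial>M)" for t x
  define \<eta> where "\<eta> = \<beta> * real DIM('a) / \<alpha>"
  have \<eta>: "0 \<le> \<eta>" "\<eta> < 1"
  proof -
    show "0 \<le> \<eta>" using assms(2,4) by (simp add: \<eta>_def)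
    have "real DIM('a) < (1 / \<beta>) * \<alpha>"
      using assms(6) mult_right_mono[OF min.cobounded2[of 2 "1 / \<beta>"] less_imp_le[OF assms(4)]] by linarith
    then show "\<eta> < 1" using assms(2,4) by (simp add: \<eta>_def field_simps)
  qed
  obtain c where c: "0 < c" "\<And>r. 0 < r \<Longrightarrow> ennreal (c * r powr (- \<eta>)) \<le> (\<integral>\<^sup>+y. ennreal ((G r y)\<^sup>2) \<partial>lborel)"
    using time_changed_density_square[OF kernel] unfolding \<eta>_def G_def by blast
  have Gm: "G r \<in> borel_measurable borel" and G0: "0 \<le> G r y" and G1: "(\<integral>\<^sup>+y. ennreal (G r y) \<partial>lborel) = 1"
    if "0 < r" for r y
    using time_changed_density_measurable[OF kernel that] time_changed_density_nonneg[OF kernel that]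
      time_changed_density_total[OF kernel that] by (simp_all add: G_def)
  have um: "u s y \<in> borel_measurable M" if "0 \<le> s" for s y
    using assms(20) that by (intro noise_filtration_measurable_imp[of _ s]) (auto simp: mild_solution_def)
  \<comment> \<open>The kernel is nonnegative with mass one, so averaging \<open>u0\<close> against
    it cannot fall below the infimum.\<close>
  have initial: "\<kappa> \<le> (LINT y|lborel. G t (x - y) * u0 y)" if t: "0 < t" for t x
  proof -
    note [measurable] = Gm[OF t] assms(12)
    obtain C where C: "\<And>y. \<bar>u0 y\<bar> \<le> C" using assms(11) by (auto simp: bounded_iff)
    have mass: "(\<integral>\<^sup>+y. ennreal (G t (x - y)) \<partial>lborel) = 1"
      using nn_integral_reflect[of "\<lambda>y. ennreal (G t y)" x] G1[OF t] by simp
    have i: "integrable lborel (\<lambda>y. G t (x - y))"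
      by (rule integrableI_nonneg) (use mass G0[OF t] in auto)
    have one: "(LINT y|lborel. G t (x - y)) = 1"
      using mass G0[OF t] nn_integral_eq_integral[OF i] by simp
    have iu: "integrable lborel (\<lambda>y. G t (x - y) * u0 y)"
    proof (rule Bochner_Integration.integrable_bound[OF integrable_mult_left[OF i, of C]])
      show "AE y in lborel. norm (G t (x - y) * u0 y) \<le> norm (G t (x - y) * C)"
        using C G0[OF t] order_trans[OF C abs_ge_self] by (auto simp: abs_mult intro!: mult_left_mono)
    qed measurable
    have "\<kappa> = (LINT y|lborel. G t (x - y) * \<kappa>)" using one by simp
    also have "\<dots> \<le> (LINT y|lborel. G t (x - y) * u0 y)"
    proof (rule integral_mono)
      fix y
      have "\<kappa> \<le> u0 y" unfolding assms(13) by (rule cINF_lower) (use assms(10) in \<open>auto intro!: bdd_belowI[of _ 0]\<close>)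
      then show "G t (x - y) * \<kappa> \<le> G t (x - y) * u0 y" using G0[OF t] by (intro mult_left_mono)
    qed (use i iu in auto)
    finally show ?thesis .
  qed
  have sol: "ennreal (\<kappa>\<^sup>2) + (\<integral>\<^sup>+\<omega>. (\<integral>\<^sup>+z. ennreal ((\<Phi> t x z \<omega>)\<^sup>2) \<partial>lborel) \<partial>M) \<le> F t x"
    and \<Phi>m: "(\<lambda>(z, \<omega>). \<Phi> t x z \<omega>) \<in> borel_measurable (lborel \<Otimes>\<^sub>M M)" if t: "0 < t" for t x
  proof -
    obtain Z where walsh: "walsh_integral M W (\<Phi> t x) Z"
      and Z: "AE \<omega> in M. u t x \<omega> = (LINT y|lborel. G t (x - y) * u0 y) + Z \<omega>"
      using assms(20) t unfolding mild_solution_def \<Phi>_def G_def by blast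
    show "(\<lambda>(z, \<omega>). \<Phi> t x z \<omega>) \<in> borel_measurable (lborel \<Otimes>\<^sub>M M)"
      using walsh by (simp add: walsh_integral_def)
    have "\<kappa>\<^sup>2 \<le> (LINT y|lborel. G t (x - y) * u0 y)\<^sup>2"
      using initial[OF t, of x] assms(14) by (intro power_mono) auto
    then have "ennreal (\<kappa>\<^sup>2) + (\<integral>\<^sup>+\<omega>. (\<integral>\<^sup>+z. ennreal ((\<Phi> t x z \<omega>)\<^sup>2) \<partial>lborel) \<partial>M) \<le>
        ennreal ((LINT y|lborel. G t (x - y) * u0 y)\<^sup>2) + (\<integral>\<^sup>+\<omega>. (\<integral>\<^sup>+z. ennreal ((\<Phi> t x z \<omega>)\<^sup>2) \<partial>lborel) \<partial>M)"
      by (intro add_right_mono ennreal_leI)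
    also have "\<dots> \<le> F t x"
      unfolding F_def by (rule second_moment_lower_bound[OF walsh Z um]) (use t in simp)
    finally show "ennreal (\<kappa>\<^sup>2) + (\<integral>\<^sup>+\<omega>. (\<integral>\<^sup>+z. ennreal ((\<Phi> t x z \<omega>)\<^sup>2) \<partial>lborel) \<partial>M) \<le> F t x" .
  qed
  \<comment> \<open>Chosen so that T^(1-\<eta>) \<ge> B is the largeness condition of the blow-up
    lemma for L = c T^(-\<eta>) and the initial bound \<kappa>^2; since 1 - \<eta> > 0, it holds for
    all T \<ge> t0.\<close>
  define B where "B = 2 * 2 powr (1 / \<gamma>) / (c * (\<kappa>\<^sup>2) powr \<gamma>)"
  have \<kappa>\<gamma>: "0 < (\<kappa>\<^sup>2) powr \<gamma>" using assms(14) by simp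
  have B: "0 < B" using c(1) \<kappa>\<gamma> by (simp add: B_def)
  define t0 where "t0 = B powr (1 / (1 - \<eta>))"
  have t0: "0 < t0" using B by (simp add: t0_def)
  have "F T x = \<infinity>" if T: "t0 \<le> T" for T x
  proof -
    have T0: "0 < T" using t0 T by simp
    \<comment> \<open>The kernel bound c r^(-\<eta>) decreases in \<open>r\<close>, so its value at
      the horizon T serves for all r \<le> T.\<close>
    define L where "L = c * T powr (- \<eta>)"
    have L0: "0 \<le> L" using c by (simp add: L_def)
    have L: "ennreal L \<le> (\<integral>\<^sup>+y. ennreal ((G r y)\<^sup>2) \<partial>lborel)" if r: "0 < r" "r \<le> T" for r
    proof -
      have "T powr (- \<eta>) \<le> r powr (- \<eta>)" using r \<eta> by (intro powr_mono2') auto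
      then have "ennreal L \<le> ennreal (c * r powr (- \<eta>))"
        unfolding L_def using c by (intro ennreal_leI mult_left_mono) auto
      also note c(2)[OF r(1)]
      finally show ?thesis .
    qed
    show ?thesis
    proof (rule blow_up[where F=F and T=T and \<gamma>=\<gamma> and L=L and ?a0.0="\<kappa>\<^sup>2"])
      show "ennreal (\<kappa>\<^sup>2) \<le> F t x" if "0 < t" "t \<le> T" for t x
        using sol[OF that(1), of x] by (rule order_trans[rotated]) simp
      show "ennreal ((t - t1) * (L * a powr (1 + \<gamma>))) \<le> F t x"
        if "0 < a" "0 \<le> t1" "t1 < t" "t \<le> T" "\<And>s y. t1 < s \<Longrightarrow> s < t \<Longrightarrow> ennreal a \<le> F s y" for a t1 t x
      proof -
        have t: "0 < t" using that by simp
        have "ennreal ((t - t1) * (L * a powr (1 + \<gamma>))) \<le>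
            (\<integral>\<^sup>+\<omega>. (\<integral>\<^sup>+z. ennreal ((\<Phi> t x z \<omega>)\<^sup>2) \<partial>lborel) \<partial>M)"
          unfolding \<Phi>_def
          by (rule walsh_energy_lower_bound[OF \<Phi>m[OF t, unfolded \<Phi>_def] Gm um assms(9) assms(8) L0 L that(2,3,1) that(5)[unfolded F_def]])
            (use that in auto)
        also have "\<dots> \<le> F t x" by (rule order_trans[OF _ sol[OF t, of x]]) simp
        finally show ?thesis .
      qed
      have "B = t0 powr (1 - \<eta>)" using B \<eta> by (simp add: t0_def powr_powr)
      also have "\<dots> \<le> T powr (1 - \<eta>)" using t0 T \<eta> by (intro powr_mono2) auto
      also have "\<dots> = T * T powr (- \<eta>)" using T0 by (simp add: powr_diff powr_minus divide_inverse)
      finally have "B * (c * (\<kappa>\<^sup>2) powr \<gamma>) \<le> T * T powr (- \<eta>) * (c * (\<kappa>\<^sup>2) powr \<gamma>)"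
        using c \<kappa>\<gamma> by (intro mult_right_mono) auto
      moreover have "B * (c * (\<kappa>\<^sup>2) powr \<gamma>) = 2 * 2 powr (1 / \<gamma>)"
        using c(1) \<kappa>\<gamma> unfolding B_def by (intro nonzero_divide_eq_eq[THEN iffD1]) auto
      ultimately show "2 * 2 powr (1 / \<gamma>) \<le> T * L * (\<kappa>\<^sup>2) powr \<gamma>"
        by (simp add: L_def mult_ac)
    qed (use T0 assms(8,14) L0 in auto)
  qed
  then show ?thesis using t0 unfolding F_def by (intro exI[of _ t0]) auto
qed

end
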